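(* Let $(X,d_X)$ be a (possibly asymmetric) geodesic metric space, let $o\in X$, and let $G$ be a countable group acting by isometries on $X$. Let $\mu$ be a probability measure on $G$ with finite second moment with respect to $d_X^{sym}$. Assume that there exists a $G$-invariant measurable subset $Y^-\subseteq\partial_h^-X$ on which there exists a $\mu$-ergodic $\mu$-stationary probability measure $\nu$, and a $G$-invariant measurable subset $Y^+\subseteq\partial_h^+X$ on which there exists a $\check\mu$-stationary probability measure $\nu^\ast$. Further assume that: (1) there exists $\lambda\in\mathbb{R}$ such that $\int_{G\times Y^+}\beta^+(g,y)\,d\check\mu(g)\,d\nu^\ast(y)=\lambda$; and (2) there exist $\alpha>0$ and a sequence $(C_n)_{n\in\mathbb{N}}\in l^1(\mathbb{N})$ such that for all $x\in Y^-$ and all $n\in\mathbb{N}$, $\nu^\ast(\{y\in Y^+ : (x|y)_o\ge\alpha n\})\le C_n$. Then $\beta^-_{|Y^-}$ is $\mu$-centerable. Moreover, let $\beta_0^-$ be a constant-drift cocycle provided by centerability, let $$V_\nu:=\int_{G\times Y^-}(\beta_0^-(g,x)-\lambda)^2\,d\mu(g)\,d\nu(x),$$ and let $N_\nu$ be the centered Gaussian law on $\mathbb{R}$ with variance $V_\nu$. Then $$\lim_{n\to+\infty}\int_G F\left(\frac{\beta^-(g,x)-n\lambda}{\sqrt n}\right)d\mu^{\ast n}(g)=\int_{\mathbb{R}}F(t)\,dN_\nu(t)$$ for $\nu$-a.e. $x\in Y^-$ and every compactly supported continuous function $F$ on $\mathbb{R}$.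
   Context: A possibly asymmetric metric satisfies the separation axiom and the triangle inequality but may fail to be symmetric. Put $d_X^+:=d_X$, $d_X^-(x,y):=d_X(y,x)$, $d_X^{sym}:=\max(d_X^+,d_X^-)$. For $z\in X$ let $h_z^{\pm}(x):=d_X^{\pm}(x,z)-d_X^{\pm}(o,z)$. Let $\mathcal{C}(X)$ be the space of continuous real functions on $X$ with uniform convergence on compact sets of $(X,d_X^{sym})$; $\mathrm{cl}_h^{\pm}X$ is the closure in $\mathcal{C}(X)$ of $\{h_z^{\pm}:z\in X\}$ and $\partial_h^{\pm}X:=\mathrm{cl}_h^{\pm}X\smallsetminus\{h_z^{\pm}:z\in X\}$ (forward/backward horoboundary). For $x$ in the horoboundary, $h_x^{\pm}$ denotes the corresponding function. $G$ acts by $g.h^{\pm}_x(z):=h^{\pm}_x(g^{-1}z)-h^{\pm}_x(g^{-1}o)$. The Busemann cocycles are $\beta^{\pm}(g,x):=h_x^{\pm}(g^{-1}.o)$. For $x\in\partial_h^-X$, $y\in\partial_h^+X$, the Gromov product is $(x|y)_o:=-\frac12\inf_{z\in X}(h_x^-(z)+h_y^+(z))\in[0,+\infty]$. The reflected measure is $\check\mu(g):=\mu(g^{-1})$; $\mu^{\ast n}$ is the $n$-th convolution power. A probability measure $\nu$ on a $G$-space is $\mu$-stationary if $\nu=\sum_g\mu(g)\,g_*\nu$, and $\mu$-ergodic if it is extremal among $\mu$-stationary probability measures. Finite second moment with respect to $d$: $\int_G d(go,o)^2d\mu(g)<+\infty$. A cocycle on a $G$-space $Y$ is a map $\sigma:G\times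 Y\to\mathbb{R}$ with $\sigma(gh,y)=\sigma(g,hy)+\sigma(h,y)$. It has constant drift $\ell$ if $\int_G\sigma(g,y)d\mu(g)=\ell$ for all $y\in Y$. It is $\mu$-centerable if there are a measurable cocycle $\sigma_0$ with constant drift and a bounded measurable $\psi:Y\to\mathbb{R}$ with $\sigma(g,y)=\sigma_0(g,y)+\psi(y)-\psi(gy)$ for all $g,y$. The variance $V_\nu$ does not depend on the choice of $\beta_0^-$. The Gaussian law of variance $0$ is the Dirac mass at $0$. *)

theory Defs
  imports "HOL-Probability.Probability" "HOL-Algebra.Group_Action"
begin

section \<open>Asymmetric metric spaces\<close>

locale asymmetric_metric =
  fixes d :: "'x \<Rightarrow> 'x \<Rightarrow> real"
  assumes nonneg: "0 \<le> d x y"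
    and separation: "d x y = 0 \<longleftrightarrow> x = y"
    and triangle: "d x z \<le> d x y + d y z"

text \<open>Since \<open>d\<close> need not be symmetric, a geodesic from \<open>x\<close> to \<open>y\<close> is only constrained in
  the forward direction.\<close>

definition geodesic :: "('x \<Rightarrow> 'x \<Rightarrow> real) \<Rightarrow> bool" where
  "geodesic d \<longleftrightarrow> (\<forall>x y. \<exists>\<gamma> :: real \<Rightarrow> 'x. \<gamma> 0 = x \<and> \<gamma> (d x y) = y \<and>
     (\<forall>s t. 0 \<le> s \<and> s \<le> t \<and> t \<le> d x y \<longrightarrow> d (\<gamma> s) (\<gamma> t) = t - s))"

text \<open>The forward metric is \<open>d\<close> itself. Every backward notion is obtained from the forward one
  by replacing \<open>d\<close> with \<open>reverse d\<close>; the symmetrised metric does not change.\<close>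

definition reverse :: "('x \<Rightarrow> 'x \<Rightarrow> real) \<Rightarrow> 'x \<Rightarrow> 'x \<Rightarrow> real" where
  "reverse d x y = d y x"

definition sym_dist :: "('x \<Rightarrow> 'x \<Rightarrow> real) \<Rightarrow> 'x \<Rightarrow> 'x \<Rightarrow> real" where
  "sym_dist d x y = max (d x y) (d y x)"

lemma sym_dist_reverse [simp]: "sym_dist (reverse d) = sym_dist d"
  by (intro ext) (simp add: sym_dist_def reverse_def max.commute)

lemma (in asymmetric_metric) Metric_space_sym_dist: "Metric_space UNIV (sym_dist d)"
proof
  show "0 \<le> sym_dist d x y" for x y
    using nonneg[of x y] by (simp add: sym_dist_def max_def)
  show "sym_dist d x y = sym_dist d y x" for x y
    by (simp add: sym_dist_def max.commute)
  show "sym_dist d x y = 0 \<longleftrightarrow> x = y" for x y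
    using nonneg[of x y] nonneg[of y x] separation[of x y] separation[of y x]
    by (auto simp: sym_dist_def max_def)
  show "sym_dist d x z \<le> sym_dist d x y + sym_dist d y z" for x y z
    using triangle[of x z y] triangle[of z x y] by (auto simp: sym_dist_def max_def)
qed

abbreviation sym_topology :: "('x \<Rightarrow> 'x \<Rightarrow> real) \<Rightarrow> 'x topology" where
  "sym_topology d \<equiv> Metric_space.mtopology UNIV (sym_dist d)"


section \<open>Horofunctions\<close>

definition cont_functions :: "('x \<Rightarrow> 'x \<Rightarrow> real) \<Rightarrow> ('x \<Rightarrow> real) set" where
  "cont_functions d = {f. continuous_map (sym_topology d) euclideanreal f}"

text \<open>Uniform convergence on compact subsets: the sets
  \<open>{g. \<forall>x\<in>K. \<bar>g x - f x\<bar> < \<epsilon>}\<close>, for \<open>K\<close> compact and \<open>\<epsilon> > 0\<close>, form a basis of neighbourhoods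
  of \<open>f\<close>.\<close>

definition ucc_open :: "('x \<Rightarrow> 'x \<Rightarrow> real) \<Rightarrow> ('x \<Rightarrow> real) set \<Rightarrow> bool" where
  "ucc_open d U \<longleftrightarrow> U \<subseteq> cont_functions d \<and>
     (\<forall>f\<in>U. \<exists>K \<epsilon>. compactin (sym_topology d) K \<and> \<epsilon> > 0 \<and>
        {g \<in> cont_functions d. \<forall>x\<in>K. \<bar>g x - f x\<bar> < \<epsilon>} \<subseteq> U)"

definition ucc_topology :: "('x \<Rightarrow> 'x \<Rightarrow> real) \<Rightarrow> ('x \<Rightarrow> real) topology" where
  "ucc_topology d = topology (ucc_open d)"

lemma openin_ucc_topology: "openin (ucc_topology d) = ucc_open d"
proof -
  have "ucc_open d (S \<inter> T)" if S: "ucc_open d S" and T: "ucc_open d T" for S T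
  proof -
    have "\<exists>K \<epsilon>. compactin (sym_topology d) K \<and> \<epsilon> > 0 \<and>
        {g \<in> cont_functions d. \<forall>x\<in>K. \<bar>g x - f x\<bar> < \<epsilon>} \<subseteq> S \<inter> T" if f: "f \<in> S" "f \<in> T" for f
    proof -
      from S f obtain K a where K: "compactin (sym_topology d) K" "a > 0"
        "{g \<in> cont_functions d. \<forall>x\<in>K. \<bar>g x - f x\<bar> < a} \<subseteq> S"
        unfolding ucc_open_def by blast
      from T f obtain L b where L: "compactin (sym_topology d) L" "b > 0"
        "{g \<in> cont_functions d. \<forall>x\<in>L. \<bar>g x - f x\<bar> < b} \<subseteq> T"
        unfolding ucc_open_def by blast
      have "{g \<in> cont_functions d. \<forall>x\<in>K \<union> L. \<bar>g x - f x\<bar> < min a b} \<subseteq> S \<inter> T"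
        using K(3) L(3) by auto
      moreover have "compactin (sym_topology d) (K \<union> L)"
        using K(1) L(1) by (rule compactin_Un)
      ultimately show ?thesis
        using K(2) L(2) by (intro exI[of _ "K \<union> L"] exI[of _ "min a b"]) auto
    qed
    then show ?thesis
      using S by (auto simp: ucc_open_def)
  qed
  moreover have "ucc_open d (\<Union>\<U>)" if "\<forall>U\<in>\<U>. ucc_open d U" for \<U>
    unfolding ucc_open_def
  proof (intro conjI ballI)
    show "\<Union>\<U> \<subseteq> cont_functions d"
      using that by (auto simp: ucc_open_def)
    fix f assume "f \<in> \<Union>\<U>"
    then obtain U where U: "U \<in> \<U>" "f \<in> U" by blast
    with that have "ucc_open d U" by blast
    with U(2) obtain K a where "compactin (sym_topology d) K" "a > 0"
      "{g \<in> cont_functions d. \<forall>x\<in>K. \<bar>g x - f x\<bar> < a} \<subseteq> U"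
      unfolding ucc_open_def by blast
    with U(1) show "\<exists>K \<epsilon>. compactin (sym_topology d) K \<and> \<epsilon> > 0 \<and>
        {g \<in> cont_functions d. \<forall>x\<in>K. \<bar>g x - f x\<bar> < \<epsilon>} \<subseteq> \<Union>\<U>"
      by (meson Union_upper order_trans)
  qed
  ultimately have "istopology (ucc_open d)"
    by (simp add: istopology_def)
  then show ?thesis
    by (simp add: ucc_topology_def)
qed

lemma topspace_ucc_topology: "topspace (ucc_topology d) = cont_functions d"
proof -
  have "ucc_open d (cont_functions d)"
    by (auto simp: ucc_open_def intro!: exI[of _ "{}"] exI[of _ "1 :: real"])
  then show ?thesis
    by (auto simp: topspace_def openin_ucc_topology) (auto simp: ucc_open_def)
qed

definition horofun :: "('x \<Rightarrow> 'x \<Rightarrow> real) \<Rightarrow> 'x \<Rightarrow> 'x \<Rightarrow> 'x \<Rightarrow> real" where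
  "horofun d x\<^sub>0 z x = d x z - d x\<^sub>0 z"

definition horoclosure :: "('x \<Rightarrow> 'x \<Rightarrow> real) \<Rightarrow> 'x \<Rightarrow> ('x \<Rightarrow> real) set" where
  "horoclosure d x\<^sub>0 = ucc_topology d closure_of range (horofun d x\<^sub>0)"

definition horoboundary :: "('x \<Rightarrow> 'x \<Rightarrow> real) \<Rightarrow> 'x \<Rightarrow> ('x \<Rightarrow> real) set" where
  "horoboundary d x\<^sub>0 = horoclosure d x\<^sub>0 - range (horofun d x\<^sub>0)"

text \<open>A subset \<open>Y\<close> of the horoboundary carries the Borel \<open>\<sigma>\<close>-algebra of the subspace topology.\<close>

definition borel_on :: "('x \<Rightarrow> 'x \<Rightarrow> real) \<Rightarrow> ('x \<Rightarrow> real) set \<Rightarrow> ('x \<Rightarrow> real) measure" where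
  "borel_on d Y = sigma Y {U. openin (subtopology (ucc_topology d) Y) U}"

text \<open>Here and below \<open>\<phi>\<close> is an action of \<open>G\<close> on \<open>X\<close>; a point of the horoboundary is identified
  with its horofunction.\<close>

definition horo_act :: "('g, 'm) monoid_scheme \<Rightarrow> ('g \<Rightarrow> 'x \<Rightarrow> 'x) \<Rightarrow> 'x \<Rightarrow>
    'g \<Rightarrow> ('x \<Rightarrow> real) \<Rightarrow> ('x \<Rightarrow> real)" where
  "horo_act G \<phi> x\<^sub>0 g h = (\<lambda>z. h (\<phi> (inv\<^bsub>G\<^esub> g) z) - h (\<phi> (inv\<^bsub>G\<^esub> g) x\<^sub>0))"

definition busemann :: "('g, 'm) monoid_scheme \<Rightarrow> ('g \<Rightarrow> 'x \<Rightarrow> 'x) \<Rightarrow> 'x \<Rightarrow>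
    'g \<Rightarrow> ('x \<Rightarrow> real) \<Rightarrow> real" where
  "busemann G \<phi> x\<^sub>0 g h = h (\<phi> (inv\<^bsub>G\<^esub> g) x\<^sub>0)"

text \<open>The base point enters only through the normalisation of the horofunctions.\<close>

definition gromov_product :: "('x \<Rightarrow> real) \<Rightarrow> ('x \<Rightarrow> real) \<Rightarrow> ereal" where
  "gromov_product h k = - (1 / 2) * (INF z. ereal (h z + k z))"


section \<open>Measures on a countable group\<close>

text \<open>A probability measure on the discrete group \<open>G\<close> lives on \<open>count_space (carrier G)\<close>.\<close>

definition group_prob :: "('g, 'm) monoid_scheme \<Rightarrow> 'g measure \<Rightarrow> bool" where
  "group_prob G \<mu> \<longleftrightarrow> prob_space \<mu> \<and> sets \<mu> = sets (count_space (carrier G))"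

definition reflected :: "('g, 'm) monoid_scheme \<Rightarrow> 'g measure \<Rightarrow> 'g measure" where
  "reflected G \<mu> = distr \<mu> (count_space (carrier G)) (\<lambda>g. inv\<^bsub>G\<^esub> g)"

primrec conv_power :: "('g, 'm) monoid_scheme \<Rightarrow> 'g measure \<Rightarrow> nat \<Rightarrow> 'g measure" where
  "conv_power G \<mu> 0 = return (count_space (carrier G)) \<one>\<^bsub>G\<^esub>"
| "conv_power G \<mu> (Suc n) =
     distr (\<mu> \<Otimes>\<^sub>M conv_power G \<mu> n) (count_space (carrier G)) (\<lambda>(g, h). g \<otimes>\<^bsub>G\<^esub> h)"


section \<open>Stationary measures and cocycles\<close>

text \<open>Throughout, the measurable space \<open>M\<close> together with \<open>act\<close> is the \<open>G\<close>-space.\<close>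

definition stationary :: "'g measure \<Rightarrow> ('g \<Rightarrow> 'y \<Rightarrow> 'y) \<Rightarrow> 'y measure \<Rightarrow> 'y measure \<Rightarrow> bool" where
  "stationary \<mu> act M \<nu> \<longleftrightarrow> prob_space \<nu> \<and> sets \<nu> = sets M \<and>
     (\<forall>A\<in>sets M. emeasure \<nu> A = (\<integral>\<^sup>+g. emeasure (distr \<nu> M (act g)) A \<partial>\<mu>))"

text \<open>Ergodic means extremal among the stationary probability measures.\<close>

definition ergodic_stationary ::
    "'g measure \<Rightarrow> ('g \<Rightarrow> 'y \<Rightarrow> 'y) \<Rightarrow> 'y measure \<Rightarrow> 'y measure \<Rightarrow> bool" where
  "ergodic_stationary \<mu> act M \<nu> \<longleftrightarrow> stationary \<mu> act M \<nu> \<and>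
     (\<forall>\<nu>\<^sub>1 \<nu>\<^sub>2 t. stationary \<mu> act M \<nu>\<^sub>1 \<and> stationary \<mu> act M \<nu>\<^sub>2 \<and> 0 < t \<and> t < (1 :: real) \<and>
        (\<forall>A\<in>sets M. measure \<nu> A = t * measure \<nu>\<^sub>1 A + (1 - t) * measure \<nu>\<^sub>2 A)
        \<longrightarrow> \<nu>\<^sub>1 = \<nu> \<and> \<nu>\<^sub>2 = \<nu>)"

definition measurable_cocycle :: "('g, 'm) monoid_scheme \<Rightarrow> ('g \<Rightarrow> 'y \<Rightarrow> 'y) \<Rightarrow> 'y measure \<Rightarrow>
    ('g \<Rightarrow> 'y \<Rightarrow> real) \<Rightarrow> bool" where
  "measurable_cocycle G act M \<sigma> \<longleftrightarrow>
     (\<forall>g\<in>carrier G. \<forall>h\<in>carrier G. \<forall>y\<in>space M. \<sigma> (g \<otimes>\<^bsub>G\<^esub> h) y = \<sigma> g (act h y) + \<sigma> h y) \<and>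
     (\<lambda>(g, y). \<sigma> g y) \<in> borel_measurable (count_space (carrier G) \<Otimes>\<^sub>M M)"

definition constant_drift :: "'g measure \<Rightarrow> 'y measure \<Rightarrow> ('g \<Rightarrow> 'y \<Rightarrow> real) \<Rightarrow> real \<Rightarrow> bool" where
  "constant_drift \<mu> M \<sigma> l \<longleftrightarrow> (\<forall>y\<in>space M. has_bochner_integral \<mu> (\<lambda>g. \<sigma> g y) l)"

text \<open>\<open>\<sigma>\<^sub>0\<close> is a constant-drift cocycle provided by centerability of \<open>\<sigma>\<close>.\<close>

definition centering :: "('g, 'm) monoid_scheme \<Rightarrow> 'g measure \<Rightarrow> ('g \<Rightarrow> 'y \<Rightarrow> 'y) \<Rightarrow> 'y measure \<Rightarrow>
    ('g \<Rightarrow> 'y \<Rightarrow> real) \<Rightarrow> ('g \<Rightarrow> 'y \<Rightarrow> real) \<Rightarrow> bool" where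
  "centering G \<mu> act M \<sigma> \<sigma>\<^sub>0 \<longleftrightarrow>
     measurable_cocycle G act M \<sigma>\<^sub>0 \<and> (\<exists>l. constant_drift \<mu> M \<sigma>\<^sub>0 l) \<and>
     (\<exists>\<psi> \<in> borel_measurable M. bounded (\<psi> ` space M) \<and>
        (\<forall>g\<in>carrier G. \<forall>y\<in>space M. \<sigma> g y = \<sigma>\<^sub>0 g y + \<psi> y - \<psi> (act g y)))"

definition centerable :: "('g, 'm) monoid_scheme \<Rightarrow> 'g measure \<Rightarrow> ('g \<Rightarrow> 'y \<Rightarrow> 'y) \<Rightarrow> 'y measure \<Rightarrow>
    ('g \<Rightarrow> 'y \<Rightarrow> real) \<Rightarrow> bool" where
  "centerable G \<mu> act M \<sigma> \<longleftrightarrow> (\<exists>\<sigma>\<^sub>0. centering G \<mu> act M \<sigma> \<sigma>\<^sub>0)"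

definition cocycle_variance ::
    "'g measure \<Rightarrow> 'y measure \<Rightarrow> ('g \<Rightarrow> 'y \<Rightarrow> real) \<Rightarrow> real \<Rightarrow> real" where
  "cocycle_variance \<mu> \<nu> \<sigma>\<^sub>0 l = (\<integral>(g, x). (\<sigma>\<^sub>0 g x - l)\<^sup>2 \<partial>(\<mu> \<Otimes>\<^sub>M \<nu>))"

definition centered_gaussian :: "real \<Rightarrow> real measure" where
  "centered_gaussian V =
     (if V = 0 then return borel 0 else density lborel (\<lambda>t. ennreal (normal_density 0 (sqrt V) t)))"

end

theory Submission
  imports Defs
begin

text \<open>Write \<open>x\<close>, \<open>y\<close> for points of \<open>Y\<^sup>-\<close>, \<open>Y\<^sup>+\<close> and \<open>(x|y)\<close> for their Gromov product. The action changes the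
Gromov product by \<open>(gx|gy) = (x|y) + (\<beta>\<^sup>-(g,x) + \<beta>\<^sup>+(g,y)) / 2\<close>. Integrating this identity against
\<open>\<nu>\<^sup>*\<close> and \<open>\<mu>\<close> and using that \<open>\<nu>\<^sup>*\<close> is stationary for the reflected measure shows that
\<open>\<beta>\<^sup>-(g,x) + \<psi>(x) - \<psi>(gx)\<close> has constant drift \<open>lam\<close>, where \<open>\<psi>(x)\<close> is twice the \<open>\<nu>\<^sup>*\<close>-integral of
\<open>(x|y)\<close>; the summable tail bound makes \<open>\<psi>\<close> bounded. Since \<open>X\<close> need not be separable, an infimum
over all of \<open>X\<close> need not be jointly measurable in \<open>(x,y)\<close>. The proof therefore replaces \<open>(x|y)\<close> by
the smaller quantity in which the infimum runs over the countable orbit of the base point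
(\<open>kernel\<close>): it obeys the same transformation rule (\<open>kernel_act\<close>) and inherits the tail bound
(\<open>kernel_integral_bound\<close>). This gives centerability (\<open>drift_potential\<close>, \<open>centering_potential\<close>),
and integrating against \<open>\<nu>\<close> shows that every centering has drift \<open>lam\<close> (\<open>drift_unique\<close>).

Let now \<open>\<sigma>\<close> be a centering of \<open>\<beta>\<^sup>-\<close>. The central limit theorem for \<open>\<sigma>\<close> is proved with characteristic
functions and without a path space. Let \<open>P\<close> be the Markov operator \<open>P f x = \<integral> f (gx) d\<mu>(g)\<close>, let
\<open>v x\<close> be the variance of \<open>\<sigma> g x\<close> under \<open>\<mu>\<close>, and \<open>V = \<integral> v d\<nu>\<close>. The characteristic function at \<open>s\<close> of
\<open>\<sigma>(g,x) - n lam\<close> under the \<open>n\<close>-th convolution power is \<open>Q\<^sup>n 1 x\<close>, where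
\<open>Q f x = \<integral> exp(\<i> s (\<sigma>(g,x) - lam)) f (gx) d\<mu>(g)\<close>. Suppose that \<open>v = V + u - P u + r\<close> with \<open>u\<close>
bounded. A second-order expansion shows that \<open>w = 1 - s\<^sup>2 u / 2\<close> is almost an eigenfunction:
\<open>Q w = (1 - s\<^sup>2 V / 2) w - s\<^sup>2 r / 2 + o(s\<^sup>2)\<close>, uniformly in \<open>x\<close> (\<open>twist_corrector\<close>). Iterating \<open>n\<close>
times with \<open>s = t / sqrt n\<close> bounds the distance from the characteristic function to
\<open>exp(- t\<^sup>2 V / 2)\<close> by \<open>t\<^sup>2 / 2\<close> times the ergodic average of \<open>\<bar>r\<bar>\<close> at \<open>x\<close>, up to \<open>o(1)\<close>
(\<open>twist_pow_bound\<close>). With \<open>r\<close> the \<open>m\<close>-th ergodic average of \<open>v - V\<close>, such a \<open>u\<close> exists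
(\<open>poisson_decomposition\<close>), the \<open>L\<^sup>1(\<nu>)\<close> norm of \<open>r\<close> tends to \<open>0\<close> as \<open>m\<close> grows, and the ergodic
averages of \<open>\<bar>r\<bar>\<close> converge \<open>\<nu>\<close>-almost everywhere to that norm. Levy's continuity theorem then gives
convergence in law; replacing \<open>\<sigma>\<close> by \<open>\<beta>\<^sup>-\<close> costs only a bounded error divided by \<open>sqrt n\<close>.

What remains is the pointwise ergodic theorem for \<open>P\<close> and bounded functions
(\<open>pointwise_ergodic\<close>). The upper limit \<open>l\<close> of the ergodic averages satisfies \<open>l \<le> P l\<close>, hence
\<open>P l = l\<close> almost everywhere because \<open>\<nu>\<close> is stationary, hence \<open>l\<close> is constant almost everywhere
because \<open>\<nu>\<close> is extremal. Garsia's maximal inequality shows that the constant is at most the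
integral of \<open>f\<close>, and the same argument for \<open>-f\<close> gives the matching lower bound.\<close>

section \<open>Random maps and their Markov operator\<close>

text \<open>The bounded measurable functions on \<open>M\<close>; only values on \<open>space M\<close> count.\<close>

definition bdd_meas :: "'y measure \<Rightarrow> ('y \<Rightarrow> 'b :: {banach, second_countable_topology}) set" where
  "bdd_meas M = {f \<in> borel_measurable M. \<exists>C. \<forall>x\<in>space M. norm (f x) \<le> C}"

lemma bdd_measI:
  "f \<in> borel_measurable M \<Longrightarrow> (\<And>x. x \<in> space M \<Longrightarrow> norm (f x) \<le> C) \<Longrightarrow> f \<in> bdd_meas M"
  by (auto simp: bdd_meas_def)

lemma bdd_measD [measurable_dest]: "f \<in> bdd_meas M \<Longrightarrow> f \<in> borel_measurable M"
  by (auto simp: bdd_meas_def)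

lemma bdd_measE:
  assumes "f \<in> bdd_meas M"
  obtains C where "0 \<le> C" "\<And>x. x \<in> space M \<Longrightarrow> norm (f x) \<le> C"
proof -
  obtain C where "\<And>x. x \<in> space M \<Longrightarrow> norm (f x) \<le> C"
    using assms by (auto simp: bdd_meas_def)
  then show ?thesis
    by (intro that[of "max 0 C"]) (auto simp: le_max_iff_disj)
qed

lemma bdd_meas_const [intro, simp]: "(\<lambda>x. c) \<in> bdd_meas M"
  by (rule bdd_measI[of _ _ "norm c"]) auto

lemma bdd_meas_add [intro]:
  assumes "f \<in> bdd_meas M" "g \<in> bdd_meas M" shows "(\<lambda>x. f x + g x) \<in> bdd_meas M"
proof -
  note [measurable] = bdd_measD[OF assms(1)] bdd_measD[OF assms(2)]
  obtain C where C: "\<And>x. x \<in> space M \<Longrightarrow> norm (f x) \<le> C" using assms(1) by (rule bdd_measE) blast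
  obtain D where D: "\<And>x. x \<in> space M \<Longrightarrow> norm (g x) \<le> D" using assms(2) by (rule bdd_measE) blast
  show ?thesis
    by (rule bdd_measI[of _ _ "C + D"]) (use C D in \<open>auto intro: norm_triangle_le add_mono\<close>)
qed

lemma bdd_meas_scaleR [intro]:
  fixes f :: "'y \<Rightarrow> 'b :: {banach, second_countable_topology}"
  assumes "f \<in> bdd_meas M" shows "(\<lambda>x. c *\<^sub>R f x) \<in> bdd_meas M"
proof -
  note [measurable] = bdd_measD[OF assms(1)]
  obtain C where C: "\<And>x. x \<in> space M \<Longrightarrow> norm (f x) \<le> C" using assms(1) by (rule bdd_measE) blast
  show ?thesis
    by (rule bdd_measI[of _ _ "\<bar>c\<bar> * C"]) (use C in \<open>auto intro: mult_left_mono\<close>)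
qed

lemma bdd_meas_mult [intro]:
  fixes f g :: "'y \<Rightarrow> 'b :: {banach, second_countable_topology, real_normed_algebra}"
  assumes "f \<in> bdd_meas M" "g \<in> bdd_meas M" shows "(\<lambda>x. f x * g x) \<in> bdd_meas M"
proof -
  note [measurable] = bdd_measD[OF assms(1)] bdd_measD[OF assms(2)]
  obtain C where C: "0 \<le> C" "\<And>x. x \<in> space M \<Longrightarrow> norm (f x) \<le> C" using assms(1) by (rule bdd_measE) blast
  obtain D where D: "0 \<le> D" "\<And>x. x \<in> space M \<Longrightarrow> norm (g x) \<le> D" using assms(2) by (rule bdd_measE) blast
  show ?thesis
    by (rule bdd_measI[of _ _ "C * D"])
       (use C D in \<open>auto intro!: order_trans[OF norm_mult_ineq] mult_mono\<close>)
qed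

lemma bdd_meas_uminus [intro]: "f \<in> bdd_meas M \<Longrightarrow> (\<lambda>x. - f x) \<in> bdd_meas M"
  using bdd_meas_scaleR[of f M "-1"] by simp

lemma bdd_meas_diff [intro]:
  "f \<in> bdd_meas M \<Longrightarrow> g \<in> bdd_meas M \<Longrightarrow> (\<lambda>x. f x - g x) \<in> bdd_meas M"
  using bdd_meas_add[of f M "\<lambda>x. - g x"] bdd_meas_uminus[of g M] by simp

lemma bdd_meas_norm [intro]: "f \<in> bdd_meas M \<Longrightarrow> (\<lambda>x. norm (f x)) \<in> bdd_meas M"
  unfolding bdd_meas_def by auto

lemma bdd_meas_abs [intro]: "f \<in> bdd_meas M \<Longrightarrow> (\<lambda>x. \<bar>f x :: real\<bar>) \<in> bdd_meas M"
  using bdd_meas_norm[of f M] by simp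

lemma bdd_meas_divide [intro]: "f \<in> bdd_meas M \<Longrightarrow> (\<lambda>x. f x / c :: real) \<in> bdd_meas M"
  using bdd_meas_scaleR[of f M "1 / c"] by simp

lemma bdd_meas_of_real [intro]: "f \<in> bdd_meas M \<Longrightarrow> (\<lambda>x. complex_of_real (f x)) \<in> bdd_meas M"
  unfolding bdd_meas_def by auto

lemma bdd_meas_sum [intro]:
  "(\<And>i. i \<in> I \<Longrightarrow> f i \<in> bdd_meas M) \<Longrightarrow> (\<lambda>x. \<Sum>i\<in>I. f i x) \<in> bdd_meas M"
  by (induction I rule: infinite_finite_induct) auto

lemma (in prob_space) integrable_bdd_meas:
  assumes "f \<in> bdd_meas N" "sets M = sets N" shows "integrable M f"
proof -
  obtain C where C: "\<And>x. x \<in> space N \<Longrightarrow> norm (f x) \<le> C" using assms(1) by (rule bdd_measE) blast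
  have "f \<in> borel_measurable M"
    using bdd_measD[OF assms(1)] measurable_cong_sets[OF assms(2) refl] by blast
  then show ?thesis
    using C sets_eq_imp_space_eq[OF assms(2)] by (intro integrable_const_bound[of _ C]) auto
qed

text \<open>A random map of \<open>M\<close>: the map \<open>act g\<close> with \<open>g\<close> drawn from the probability measure \<open>\<mu>\<close>. The index
set carries no group structure, and \<open>act\<close> is jointly measurable.\<close>

locale random_action = prob_space \<mu> for \<mu> :: "'g measure" +
  fixes M :: "'y measure" and act :: "'g \<Rightarrow> 'y \<Rightarrow> 'y"
  assumes measurable_act: "(\<lambda>(g, x). act g x) \<in> \<mu> \<Otimes>\<^sub>M M \<rightarrow>\<^sub>M M"
begin

lemma measurable_act_comp [measurable (raw)]:
  assumes "f \<in> N \<rightarrow>\<^sub>M \<mu>" "h \<in> N \<rightarrow>\<^sub>M M" shows "(\<lambda>x. act (f x) (h x)) \<in> N \<rightarrow>\<^sub>M M"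
  using measurable_compose[OF measurable_Pair[OF assms] measurable_act] by simp

lemma act_space: "g \<in> space \<mu> \<Longrightarrow> x \<in> space M \<Longrightarrow> act g x \<in> space M"
  using measurable_space[OF measurable_act, of "(g, x)"] by (simp add: space_pair_measure)

text \<open>The Markov operator, for real and for vector-valued functions alike.\<close>

definition markov :: "('y \<Rightarrow> 'b :: {banach, second_countable_topology}) \<Rightarrow> 'y \<Rightarrow> 'b" where
  "markov f x = (\<integral>g. f (act g x) \<partial>\<mu>)"

lemma integrable_act:
  assumes "f \<in> bdd_meas M" "x \<in> space M" shows "integrable \<mu> (\<lambda>g. f (act g x))"
proof -
  obtain C where C: "\<And>x. x \<in> space M \<Longrightarrow> norm (f x) \<le> C" using assms(1) by (rule bdd_measE) blast
  note [measurable] = bdd_measD[OF assms(1)]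
  have "(\<lambda>g. f (act g x)) \<in> borel_measurable \<mu>" using assms(2) by measurable
  then show ?thesis
    using C act_space assms(2) by (intro integrable_const_bound[of _ C]) auto
qed

lemma norm_integral_le:
  fixes f :: "_ \<Rightarrow> _ :: {banach, second_countable_topology}"
  assumes "integrable \<mu> f" "\<And>g. g \<in> space \<mu> \<Longrightarrow> norm (f g) \<le> C"
  shows "norm (\<integral>g. f g \<partial>\<mu>) \<le> C"
proof -
  have "norm (\<integral>g. f g \<partial>\<mu>) \<le> (\<integral>g. norm (f g) \<partial>\<mu>)"
    by (rule integral_norm_bound)
  also have "\<dots> \<le> (\<integral>g. C \<partial>\<mu>)"
    using assms by (intro integral_mono) auto
  finally show ?thesis by (simp add: prob_space)
qed

lemma norm_markov_le:
  assumes "f \<in> bdd_meas M" "\<And>x. x \<in> space M \<Longrightarrow> norm (f x) \<le> C" "x \<in> space M"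
  shows "norm (markov f x) \<le> C"
  unfolding markov_def using assms act_space by (intro norm_integral_le integrable_act) auto

lemma markov_bdd_meas [intro]:
  assumes "f \<in> bdd_meas M" shows "markov f \<in> bdd_meas M"
proof -
  obtain C where C: "\<And>x. x \<in> space M \<Longrightarrow> norm (f x) \<le> C" using assms(1) by (rule bdd_measE) blast
  note [measurable] = bdd_measD[OF assms(1)]
  have "(\<lambda>x. \<integral>g. f (act g x) \<partial>\<mu>) \<in> borel_measurable M" by measurable
  then show ?thesis
    using norm_markov_le[OF assms C] by (intro bdd_measI[of _ _ C]) (auto simp: markov_def[abs_def])
qed

lemma markov_funpow_bdd_meas [intro]: "f \<in> bdd_meas M \<Longrightarrow> (markov ^^ n) f \<in> bdd_meas M"
  by (induction n) auto

lemma norm_markov_funpow_le: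
  assumes "f \<in> bdd_meas M" "\<And>x. x \<in> space M \<Longrightarrow> norm (f x) \<le> C" "x \<in> space M"
  shows "norm ((markov ^^ n) f x) \<le> C"
  using assms(3)
  by (induction n arbitrary: x) (auto intro!: norm_markov_le assms)

lemma prob_space_\<mu> [simp]: "prob (space \<mu>) = 1"
  by (rule prob_space)

lemma markov_add:
  "f \<in> bdd_meas M \<Longrightarrow> g \<in> bdd_meas M \<Longrightarrow> x \<in> space M \<Longrightarrow>
    markov (\<lambda>x. f x + g x) x = markov f x + markov g x"
  by (simp add: markov_def integrable_act)

lemma markov_diff:
  "f \<in> bdd_meas M \<Longrightarrow> g \<in> bdd_meas M \<Longrightarrow> x \<in> space M \<Longrightarrow>
    markov (\<lambda>x. f x - g x) x = markov f x - markov g x"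
  by (simp add: markov_def integrable_act)

lemma markov_sum:
  "(\<And>i. i \<in> I \<Longrightarrow> f i \<in> bdd_meas M) \<Longrightarrow> x \<in> space M \<Longrightarrow>
    markov (\<lambda>x. \<Sum>i\<in>I. f i x) x = (\<Sum>i\<in>I. markov (f i) x)"
  by (simp add: markov_def integrable_act)

lemma markov_divide: "markov (\<lambda>x. f x / c :: real) x = markov f x / c"
  by (simp add: markov_def)

lemma markov_const: "markov (\<lambda>x. c) x = c"
  by (simp add: markov_def prob_space)

lemma markov_mono:
  fixes f g :: "'y \<Rightarrow> real"
  assumes "f \<in> bdd_meas M" "g \<in> bdd_meas M" "\<And>x. x \<in> space M \<Longrightarrow> f x \<le> g x" "x \<in> space M"
  shows "markov f x \<le> markov g x"
  unfolding markov_def using assms act_space by (intro integral_mono integrable_act) auto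

lemma markov_cong:
  "(\<And>x. x \<in> space M \<Longrightarrow> f x = g x) \<Longrightarrow> x \<in> space M \<Longrightarrow> markov f x = markov g x"
  unfolding markov_def using act_space by (intro Bochner_Integration.integral_cong) auto

section \<open>Stationary measures\<close>

text \<open>The right-hand side of the stationarity equation is the law of \<open>act g x\<close> for independent \<open>g\<close> and
\<open>x\<close>. Hence stationarity is an equation between a measure and an image measure.\<close>

lemma emeasure_distr_act:
  assumes \<nu>: "prob_space \<nu>" "sets \<nu> = sets M" and A: "A \<in> sets M"
  shows "(\<integral>\<^sup>+g. emeasure (distr \<nu> M (act g)) A \<partial>\<mu>)
    = emeasure (distr (\<mu> \<Otimes>\<^sub>M \<nu>) M (\<lambda>(g, x). act g x)) A"
proof -
  interpret \<nu>: prob_space \<nu> by fact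
  note [measurable_cong] = \<nu>(2)
  note [measurable] = A
  have sp: "space \<nu> = space M" by (rule sets_eq_imp_space_eq) fact
  have "emeasure (distr (\<mu> \<Otimes>\<^sub>M \<nu>) M (\<lambda>(g, x). act g x)) A
      = emeasure (\<mu> \<Otimes>\<^sub>M \<nu>) ((\<lambda>(g, x). act g x) -` A \<inter> space (\<mu> \<Otimes>\<^sub>M \<nu>))"
    by (subst emeasure_distr) (simp_all, measurable)
  also have "\<dots> = (\<integral>\<^sup>+g. emeasure \<nu> (Pair g -` ((\<lambda>(g, x). act g x) -` A \<inter> space (\<mu> \<Otimes>\<^sub>M \<nu>))) \<partial>\<mu>)"
    by (rule \<nu>.emeasure_pair_measure_alt) measurable
  also have "\<dots> = (\<integral>\<^sup>+g. emeasure (distr \<nu> M (act g)) A \<partial>\<mu>)"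
  proof (rule nn_integral_cong)
    fix g assume g: "g \<in> space \<mu>"
    then have "act g \<in> \<nu> \<rightarrow>\<^sub>M M" by measurable
    then have "emeasure (distr \<nu> M (act g)) A = emeasure \<nu> (act g -` A \<inter> space \<nu>)"
      by (simp add: emeasure_distr A)
    also have "act g -` A \<inter> space \<nu> = Pair g -` ((\<lambda>(g, x). act g x) -` A \<inter> space (\<mu> \<Otimes>\<^sub>M \<nu>))"
      using g by (auto simp: space_pair_measure)
    finally show "emeasure \<nu> (Pair g -` ((\<lambda>(g, x). act g x) -` A \<inter> space (\<mu> \<Otimes>\<^sub>M \<nu>)))
        = emeasure (distr \<nu> M (act g)) A" by simp
  qed
  finally show ?thesis by simp
qed

lemma stationary_iff_distr:
  "stationary \<mu> act M \<nu> \<longleftrightarrow> prob_space \<nu> \<and> sets \<nu> = sets M \<and>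
     distr (\<mu> \<Otimes>\<^sub>M \<nu>) M (\<lambda>(g, x). act g x) = \<nu>"
proof -
  have "distr (\<mu> \<Otimes>\<^sub>M \<nu>) M (\<lambda>(g, x). act g x) = \<nu>"
    if "prob_space \<nu>" "sets \<nu> = sets M"
      "\<forall>A\<in>sets M. emeasure \<nu> A = (\<integral>\<^sup>+g. emeasure (distr \<nu> M (act g)) A \<partial>\<mu>)"
    using that by (intro measure_eqI) (simp_all add: emeasure_distr_act)
  moreover have "emeasure \<nu> A = (\<integral>\<^sup>+g. emeasure (distr \<nu> M (act g)) A \<partial>\<mu>)"
    if "prob_space \<nu>" "sets \<nu> = sets M" "distr (\<mu> \<Otimes>\<^sub>M \<nu>) M (\<lambda>(g, x). act g x) = \<nu>"
      "A \<in> sets M" for A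
    using that by (simp add: emeasure_distr_act)
  ultimately show ?thesis
    unfolding stationary_def by blast
qed

end

locale stationary_action = random_action +
  fixes \<nu> :: "'b measure"
  assumes stationary: "stationary \<mu> act M \<nu>"

sublocale stationary_action \<subseteq> \<nu>: prob_space \<nu>
  using stationary by (simp add: stationary_iff_distr)

sublocale stationary_action \<subseteq> pair_prob_space \<mu> \<nu> ..

context stationary_action
begin

lemma sets_\<nu> [measurable_cong, simp]: "sets \<nu> = sets M"
  using stationary by (simp add: stationary_iff_distr)

lemma space_\<nu> [simp]: "space \<nu> = space M"
  by (rule sets_eq_imp_space_eq) simp

lemma prob_space_M [simp]: "\<nu>.prob (space M) = 1"
  using \<nu>.prob_space by simp

lemma distr_act: "distr (\<mu> \<Otimes>\<^sub>M \<nu>) M (\<lambda>(g, x). act g x) = \<nu>"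
  using stationary by (simp add: stationary_iff_distr)

lemma integrable_\<nu>: "f \<in> bdd_meas M \<Longrightarrow> integrable \<nu> f"
  by (rule \<nu>.integrable_bdd_meas) auto

lemma measurable_act' [measurable]: "(\<lambda>(g, x). act g x) \<in> \<mu> \<Otimes>\<^sub>M \<nu> \<rightarrow>\<^sub>M M"
  by measurable

lemma integrable_distr_act:
  fixes f :: "_ \<Rightarrow> _ :: {banach, second_countable_topology}"
  assumes "integrable \<nu> f" shows "integrable (\<mu> \<Otimes>\<^sub>M \<nu>) (\<lambda>(g, x). f (act g x))"
proof -
  have "integrable (distr (\<mu> \<Otimes>\<^sub>M \<nu>) M (\<lambda>(g, x). act g x)) f"
    using assms by (simp add: distr_act)
  from integrable_distr[OF measurable_act' this] show ?thesis
    by (simp add: split_beta')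
qed

lemma integral_distr_act:
  fixes f :: "_ \<Rightarrow> _ :: {banach, second_countable_topology}"
  assumes "f \<in> borel_measurable M"
  shows "(\<integral>(g, x). f (act g x) \<partial>(\<mu> \<Otimes>\<^sub>M \<nu>)) = (\<integral>x. f x \<partial>\<nu>)"
proof -
  have "(\<integral>x. f x \<partial>(distr (\<mu> \<Otimes>\<^sub>M \<nu>) M (\<lambda>(g, x). act g x))) = (\<integral>(g, x). f (act g x) \<partial>(\<mu> \<Otimes>\<^sub>M \<nu>))"
    by (subst integral_distr[OF measurable_act' assms]) (simp add: split_beta')
  then show ?thesis by (simp add: distr_act)
qed

lemma integral_markov:
  assumes "f \<in> bdd_meas M" shows "(\<integral>x. markov f x \<partial>\<nu>) = (\<integral>x. f x \<partial>\<nu>)"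
proof -
  have "(\<integral>x. markov f x \<partial>\<nu>) = (\<integral>(g, x). f (act g x) \<partial>(\<mu> \<Otimes>\<^sub>M \<nu>))"
    unfolding markov_def
    by (rule integral_snd[OF integrable_distr_act[OF integrable_\<nu>[OF assms]]])
  with integral_distr_act[OF bdd_measD[OF assms]] show ?thesis by simp
qed

end

section \<open>Ergodicity and harmonic functions\<close>

locale ergodic_action = random_action +
  fixes \<nu> :: "'b measure"
  assumes ergodic: "ergodic_stationary \<mu> act M \<nu>"

sublocale ergodic_action \<subseteq> stationary_action
  by standard (use ergodic in \<open>simp add: ergodic_stationary_def\<close>)

context stationary_action
begin

text \<open>Conditioning a stationary measure on an almost surely invariant set of positive mass gives a
stationary measure.\<close>

lemma stationary_uniform_measure:
  assumes A[measurable]: "A \<in> sets M" and pos: "emeasure \<nu> A \<noteq> 0"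
    and inv: "AE (g, x) in \<mu> \<Otimes>\<^sub>M \<nu>. act g x \<in> A \<longleftrightarrow> x \<in> A"
  shows "stationary \<mu> act M (uniform_measure \<nu> A)"
  unfolding stationary_def
proof (intro conjI ballI)
  have fin: "emeasure \<nu> A \<noteq> \<infinity>" by simp
  show "prob_space (uniform_measure \<nu> A)"
    by (rule prob_space_uniform_measure) fact+
  show "sets (uniform_measure \<nu> A) = sets M" by simp
  fix B assume B[measurable]: "B \<in> sets M"
  let ?E = "{p \<in> space (\<mu> \<Otimes>\<^sub>M \<nu>). snd p \<in> A \<and> act (fst p) (snd p) \<in> B}"
  have "?E = (snd -` A \<inter> space (\<mu> \<Otimes>\<^sub>M \<nu>)) \<inter> ((\<lambda>(g, x). act g x) -` B \<inter> space (\<mu> \<Otimes>\<^sub>M \<nu>))"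
    by auto
  also have "\<dots> \<in> sets (\<mu> \<Otimes>\<^sub>M \<nu>)"
    by (intro sets.Int measurable_sets[OF measurable_act' B] measurable_sets[OF measurable_snd]) auto
  finally have E: "?E \<in> sets (\<mu> \<Otimes>\<^sub>M \<nu>)" .
  have *: "emeasure (distr (uniform_measure \<nu> A) M (act g)) B
      = emeasure \<nu> (Pair g -` ?E) / emeasure \<nu> A"
    if g: "g \<in> space \<mu>" for g
  proof -
    have "act g \<in> M \<rightarrow>\<^sub>M M" using g by measurable
    then have [measurable]: "act g \<in> uniform_measure \<nu> A \<rightarrow>\<^sub>M M"
      by (simp cong: measurable_cong_sets)
    have "emeasure (distr (uniform_measure \<nu> A) M (act g)) B
        = emeasure (uniform_measure \<nu> A) (act g -` B \<inter> space M)"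
      by (simp add: emeasure_distr)
    also have "\<dots> = emeasure \<nu> (A \<inter> (act g -` B \<inter> space M)) / emeasure \<nu> A"
      by (rule emeasure_uniform_measure) measurable
    also have "A \<inter> (act g -` B \<inter> space M)
        = Pair g -` ?E"
      using g by (auto simp: space_pair_measure)
    finally show ?thesis .
  qed
  have "(\<integral>\<^sup>+g. emeasure (distr (uniform_measure \<nu> A) M (act g)) B \<partial>\<mu>)
    = (\<integral>\<^sup>+g. emeasure \<nu> (Pair g -` ?E) / emeasure \<nu> A \<partial>\<mu>)"
    by (rule nn_integral_cong) (rule *)
  also have "\<dots> = (\<integral>\<^sup>+g. emeasure \<nu> (Pair g -` ?E) \<partial>\<mu>) / emeasure \<nu> A"
    by (intro nn_integral_divide \<nu>.measurable_emeasure_Pair E)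
  also have "\<dots> = emeasure (\<mu> \<Otimes>\<^sub>M \<nu>) ?E / emeasure \<nu> A"
    by (simp only: \<nu>.emeasure_pair_measure_alt[OF E])
  also have "emeasure (\<mu> \<Otimes>\<^sub>M \<nu>) ?E
      = emeasure (\<mu> \<Otimes>\<^sub>M \<nu>) ((\<lambda>(g, x). act g x) -` (A \<inter> B) \<inter> space (\<mu> \<Otimes>\<^sub>M \<nu>))"
    using inv
    by (intro emeasure_eq_AE E measurable_sets[OF measurable_act'] sets.Int A B)
       (auto simp: split_beta')
  also have "\<dots> = emeasure (distr (\<mu> \<Otimes>\<^sub>M \<nu>) M (\<lambda>(g, x). act g x)) (A \<inter> B)"
    by (subst emeasure_distr) (simp_all, measurable)
  also have "\<dots> = emeasure \<nu> (A \<inter> B)" by (simp add: distr_act)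
  also have "\<dots> / emeasure \<nu> A = emeasure (uniform_measure \<nu> A) B"
    by (rule emeasure_uniform_measure[symmetric]) auto
  finally show "emeasure (uniform_measure \<nu> A) B
      = (\<integral>\<^sup>+g. emeasure (distr (uniform_measure \<nu> A) M (act g)) B \<partial>\<mu>)" by simp
qed

text \<open>The square of \<open>w (act g x) - w x\<close> has integral \<open>0\<close>: both squares integrate to \<open>\<integral> w\<^sup>2 d\<nu>\<close> by
stationarity, and so does the mixed term because \<open>w\<close> is harmonic.\<close>

lemma harmonic_imp_invariant:
  fixes w :: "'b \<Rightarrow> real"
  assumes w: "w \<in> bdd_meas M" and harm: "AE x in \<nu>. markov w x = w x"
  shows "AE (g, x) in \<mu> \<Otimes>\<^sub>M \<nu>. w (act g x) = w x"
proof -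
  note [measurable] = bdd_measD[OF w]
  obtain C where C: "0 \<le> C" "\<And>x. x \<in> space M \<Longrightarrow> \<bar>w x\<bar> \<le> C"
    using w by (rule bdd_measE) (auto simp: real_norm_def)
  have CC: "\<bar>w x * w y\<bar> \<le> C * C" if "x \<in> space M" "y \<in> space M" for x y
    using C that by (auto simp: abs_mult intro!: mult_mono)
  have i1: "integrable (\<mu> \<Otimes>\<^sub>M \<nu>) (\<lambda>(g, x). w (act g x) * w (act g x))"
    by (rule P.integrable_const_bound[of _ "C * C"])
       (use abs_le_D1[OF CC] CC act_space in \<open>auto intro!: AE_I2 simp: space_pair_measure\<close>)
  have i2: "integrable (\<mu> \<Otimes>\<^sub>M \<nu>) (\<lambda>(g, x). w (act g x) * w x)"
    by (rule P.integrable_const_bound[of _ "C * C"])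
       (use abs_le_D1[OF CC] CC act_space in \<open>auto intro!: AE_I2 simp: space_pair_measure\<close>)
  have i3: "integrable (\<mu> \<Otimes>\<^sub>M \<nu>) (\<lambda>(g, x). w x * w x)"
    by (rule P.integrable_const_bound[of _ "C * C"])
       (use abs_le_D1[OF CC] CC act_space in \<open>auto intro!: AE_I2 simp: space_pair_measure\<close>)
  have e1: "(\<integral>(g, x). w (act g x) * w (act g x) \<partial>(\<mu> \<Otimes>\<^sub>M \<nu>)) = (\<integral>x. w x * w x \<partial>\<nu>)"
    by (rule integral_distr_act) measurable
  have "(\<integral>(g, x). w (act g x) * w x \<partial>(\<mu> \<Otimes>\<^sub>M \<nu>)) = (\<integral>x. markov w x * w x \<partial>\<nu>)"
    using integral_snd[OF i2] by (simp add: markov_def)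
  also have "\<dots> = (\<integral>x. w x * w x \<partial>\<nu>)"
    by (rule integral_cong_AE) (use harm markov_bdd_meas[OF w] in \<open>auto dest: bdd_measD\<close>)
  finally have e2: "(\<integral>(g, x). w (act g x) * w x \<partial>(\<mu> \<Otimes>\<^sub>M \<nu>)) = (\<integral>x. w x * w x \<partial>\<nu>)" .
  have e3: "(\<integral>(g, x). w x * w x \<partial>(\<mu> \<Otimes>\<^sub>M \<nu>)) = (\<integral>x. w x * w x \<partial>\<nu>)"
    using integral_snd[OF i3] by simp
  have eq: "(\<lambda>(g, x). (w (act g x) - w x)\<^sup>2) = (\<lambda>p.
      ((\<lambda>(g, x). w (act g x) * w (act g x)) p - 2 * (\<lambda>(g, x). w (act g x) * w x) p)
        + (\<lambda>(g, x). w x * w x) p)"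
    by (auto simp: power2_eq_square algebra_simps)
  have i: "integrable (\<mu> \<Otimes>\<^sub>M \<nu>) (\<lambda>(g, x). (w (act g x) - w x)\<^sup>2)"
    unfolding eq using i1 i2 i3 by auto
  have "(\<integral>(g, x). (w (act g x) - w x)\<^sup>2 \<partial>(\<mu> \<Otimes>\<^sub>M \<nu>)) = 0"
    unfolding eq using i1 i2 i3 e1 e2 e3 by simp
  then have "AE p in \<mu> \<Otimes>\<^sub>M \<nu>. (\<lambda>(g, x). (w (act g x) - w x)\<^sup>2) p = 0"
    by (subst (asm) integral_nonneg_eq_0_iff_AE[OF i]) auto
  then show ?thesis by auto
qed

end

text \<open>Otherwise \<open>\<nu>\<close> is a proper convex combination of its conditionings on \<open>A\<close> and on the complement of
\<open>A\<close>, against extremality.\<close>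

lemma (in ergodic_action) invariant_set_trivial:
  assumes A[measurable]: "A \<in> sets M"
    and inv: "AE (g, x) in \<mu> \<Otimes>\<^sub>M \<nu>. act g x \<in> A \<longleftrightarrow> x \<in> A"
  shows "\<nu>.prob A = 0 \<or> \<nu>.prob A = 1"
proof (rule ccontr)
  assume "\<not> ?thesis"
  then have p: "0 < \<nu>.prob A" "\<nu>.prob A < 1"
    using \<nu>.prob_le_1[of A] measure_nonneg[of \<nu> A] by linarith+
  let ?B = "space M - A"
  have B[measurable]: "?B \<in> sets M" by measurable
  have pB: "\<nu>.prob ?B = 1 - \<nu>.prob A"
    using \<nu>.prob_compl[of A] by simp
  have "stationary \<mu> act M (uniform_measure \<nu> A)"
    by (rule stationary_uniform_measure) (use p inv in \<open>auto simp: \<nu>.emeasure_eq_measure\<close>)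
  moreover have "stationary \<mu> act M (uniform_measure \<nu> ?B)"
  proof (rule stationary_uniform_measure)
    have "AE p in \<mu> \<Otimes>\<^sub>M \<nu>. fst p \<in> space \<mu> \<and> snd p \<in> space M"
      using AE_space by eventually_elim (auto simp: space_pair_measure)
    with inv show "AE (g, x) in \<mu> \<Otimes>\<^sub>M \<nu>. act g x \<in> ?B \<longleftrightarrow> x \<in> ?B"
      by eventually_elim (auto simp: act_space)
  qed (use p pB in \<open>auto simp: \<nu>.emeasure_eq_measure\<close>)
  moreover have "measure \<nu> E = \<nu>.prob A * measure (uniform_measure \<nu> A) E
      + (1 - \<nu>.prob A) * measure (uniform_measure \<nu> ?B) E" if [measurable]: "E \<in> sets M" for E
  proof -
    have "measure (uniform_measure \<nu> A) E = \<nu>.prob (A \<inter> E) / \<nu>.prob A"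
      by (rule measure_uniform_measure) (use p in \<open>auto simp: \<nu>.emeasure_eq_measure\<close>)
    moreover have "measure (uniform_measure \<nu> ?B) E = \<nu>.prob (?B \<inter> E) / \<nu>.prob ?B"
      by (rule measure_uniform_measure) (use p pB in \<open>auto simp: \<nu>.emeasure_eq_measure\<close>)
    moreover have "\<nu>.prob E = \<nu>.prob (A \<inter> E) + \<nu>.prob (?B \<inter> E)"
    proof -
      have "E = (A \<inter> E) \<union> (?B \<inter> E)" using sets.sets_into_space[OF that] by auto
      then have "\<nu>.prob E = \<nu>.prob ((A \<inter> E) \<union> (?B \<inter> E))" by simp
      also have "\<dots> = \<nu>.prob (A \<inter> E) + \<nu>.prob (?B \<inter> E)"
        by (rule \<nu>.finite_measure_Union) auto
      finally show ?thesis .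
    qed
    ultimately show ?thesis using p pB by simp
  qed
  ultimately have "uniform_measure \<nu> A = \<nu>"
    using ergodic p unfolding ergodic_stationary_def by blast
  then have "\<nu>.prob A = measure (uniform_measure \<nu> A) A" by simp
  also have "\<dots> = 1"
    by (subst measure_uniform_measure) (use p in \<open>auto simp: \<nu>.emeasure_eq_measure\<close>)
  finally show False using p by simp
qed

lemma (in ergodic_action) harmonic_imp_const:
  fixes w :: "'b \<Rightarrow> real"
  assumes w: "w \<in> bdd_meas M" and harm: "AE x in \<nu>. markov w x = w x"
  shows "AE x in \<nu>. w x = (\<integral>x. w x \<partial>\<nu>)"
proof -
  note [measurable] = bdd_measD[OF w]
  define c where "c = (\<integral>x. w x \<partial>\<nu>)"
  \<comment> \<open>One level set is enough: if \<open>w > c\<close> almost surely, or \<open>w \<le> c\<close> almost surely, with \<open>c\<close> the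
    mean of \<open>w\<close>, then \<open>w = c\<close> almost surely.\<close>
  define A where "A = {x \<in> space M. c < w x}"
  have A[measurable]: "A \<in> sets M" unfolding A_def by measurable
  have iw: "integrable \<nu> w" by (rule integrable_\<nu>[OF w])
  have "AE p in \<mu> \<Otimes>\<^sub>M \<nu>. fst p \<in> space \<mu> \<and> snd p \<in> space M"
    using AE_space by eventually_elim (auto simp: space_pair_measure)
  with harmonic_imp_invariant[OF w harm] have "AE (g, x) in \<mu> \<Otimes>\<^sub>M \<nu>. act g x \<in> A \<longleftrightarrow> x \<in> A"
    by eventually_elim (auto simp: A_def act_space)
  from invariant_set_trivial[OF A this] have "\<nu>.prob A \<noteq> 1 \<longrightarrow> \<nu>.prob A = 0" by auto
  moreover have "\<nu>.prob A \<noteq> 1"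
  proof
    assume "\<nu>.prob A = 1"
    then have ae: "AE x in \<nu>. x \<in> A" by (subst (asm) \<nu>.prob_eq_1) auto
    have "(\<integral>x. w x - c \<partial>\<nu>) = 0" using iw by (simp add: c_def \<nu>.prob_space)
    moreover have "AE x in \<nu>. 0 \<le> w x - c" using ae by eventually_elim (auto simp: A_def)
    ultimately have "AE x in \<nu>. w x - c = 0"
      using iw by (subst (asm) integral_nonneg_eq_0_iff_AE) auto
    with ae have "AE x in \<nu>. False" by eventually_elim (auto simp: A_def)
    then show False by simp
  qed
  ultimately have "AE x in \<nu>. x \<notin> A" using \<nu>.prob_eq_0[of A] by simp
  then have ae: "AE x in \<nu>. 0 \<le> c - w x"
    using AE_space by eventually_elim (auto simp: A_def)
  moreover have "(\<integral>x. c - w x \<partial>\<nu>) = 0" using iw by (simp add: c_def \<nu>.prob_space)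
  ultimately have "AE x in \<nu>. c - w x = 0"
    using iw by (subst (asm) integral_nonneg_eq_0_iff_AE) auto
  then show ?thesis by (auto simp: c_def)
qed

section \<open>The maximal inequality\<close>

context random_action
begin

text \<open>\<open>max_sum f n\<close> dominates \<open>0\<close> and the sums \<open>f + P f + \<dots> + P\<^sup>k\<^sup>-\<^sup>1 f\<close> for \<open>k \<le> n\<close>. For an operator \<open>P\<close>
that is not composition with a map, it is in general not their maximum; the recursion is all that the maximal
inequality needs.\<close>

primrec max_sum :: "('y \<Rightarrow> real) \<Rightarrow> nat \<Rightarrow> 'y \<Rightarrow> real" where
  "max_sum f 0 = (\<lambda>x. 0)"
| "max_sum f (Suc n) = (\<lambda>x. max 0 (f x + markov (max_sum f n) x))"

text \<open>The sum of the first \<open>n\<close> iterates, from \<open>P\<^sup>0 f = f\<close> to \<open>P\<^sup>n\<^sup>-\<^sup>1 f\<close>.\<close>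

definition ergodic_sum :: "('y \<Rightarrow> real) \<Rightarrow> nat \<Rightarrow> 'y \<Rightarrow> real" where
  "ergodic_sum f n x = (\<Sum>k<n. (markov ^^ k) f x)"

lemma bdd_meas_max0:
  assumes "f \<in> bdd_meas M" shows "(\<lambda>x. max 0 (f x :: real)) \<in> bdd_meas M"
proof -
  have "(\<lambda>x. (f x + \<bar>f x\<bar>) / 2) \<in> bdd_meas M"
    using assms by (intro bdd_meas_divide bdd_meas_add bdd_meas_abs)
  moreover have "(\<lambda>x. (f x + \<bar>f x\<bar>) / 2) = (\<lambda>x. max 0 (f x))" by (auto simp: max_def)
  ultimately show ?thesis by simp
qed

lemma max_sum_bdd_meas: "f \<in> bdd_meas M \<Longrightarrow> max_sum f n \<in> bdd_meas M"
  by (induction n) (auto intro!: bdd_meas_max0)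

lemma max_sum_mono:
  assumes f: "f \<in> bdd_meas M" and x: "x \<in> space M"
  shows "max_sum f n x \<le> max_sum f (Suc n) x"
  using x
proof (induction n arbitrary: x)
  case (Suc n)
  have "markov (max_sum f n) x \<le> markov (max_sum f (Suc n)) x"
    by (intro markov_mono max_sum_bdd_meas f Suc)
  then show ?case by auto
qed simp

lemma max_sum_nonneg: "0 \<le> max_sum f n x"
  by (induction n) auto

lemma ergodic_sum_bdd_meas: "f \<in> bdd_meas M \<Longrightarrow> ergodic_sum f n \<in> bdd_meas M"
  unfolding ergodic_sum_def[abs_def] by (rule bdd_meas_sum) auto

lemma markov_ergodic_sum:
  assumes f: "f \<in> bdd_meas M" and x: "x \<in> space M"
  shows "f x + markov (ergodic_sum f n) x = ergodic_sum f (Suc n) x"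
proof -
  have "markov (ergodic_sum f n) x = (\<Sum>k<n. markov ((markov ^^ k) f) x)"
    unfolding ergodic_sum_def[abs_def] by (rule markov_sum) (use f x in auto)
  then show ?thesis
    unfolding ergodic_sum_def sum.lessThan_Suc_shift by simp
qed

lemma ergodic_sum_le_max_sum:
  assumes f: "f \<in> bdd_meas M" and x: "x \<in> space M"
  shows "ergodic_sum f n x \<le> max_sum f n x"
  using x
proof (induction n arbitrary: x)
  case (Suc n)
  have "markov (ergodic_sum f n) x \<le> markov (max_sum f n) x"
    by (intro markov_mono max_sum_bdd_meas ergodic_sum_bdd_meas f Suc)
  then show ?case
    using markov_ergodic_sum[OF f Suc.prems, of n] by auto
qed (simp add: ergodic_sum_def)

end

text \<open>Where \<open>R = max_sum f n\<close> is positive, the recursion and monotonicity give \<open>f \<ge> R - P R\<close>; elsewhere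
\<open>R - P R \<le> 0\<close>. The integral of \<open>R - P R\<close> vanishes by stationarity.\<close>

lemma (in stationary_action) maximal_inequality:
  assumes f: "f \<in> bdd_meas M"
  shows "0 \<le> (\<integral>x. indicator {x \<in> space M. 0 < max_sum f n x} x * f x \<partial>\<nu>)"
proof (cases n)
  case 0 then show ?thesis by simp
next
  case (Suc m)
  let ?R = "max_sum f n"
  let ?A = "{x \<in> space M. 0 < ?R x}"
  note R = max_sum_bdd_meas[OF f, of n]
  note [measurable] = bdd_measD[OF f] bdd_measD[OF R]
  have "?R x - markov ?R x \<le> indicator ?A x * f x" if x: "x \<in> space M" for x
  proof (cases "0 < ?R x")
    case True
    have "markov (max_sum f m) x \<le> markov ?R x"
      unfolding Suc by (intro markov_mono max_sum_bdd_meas max_sum_mono f x)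
    with True x show ?thesis by (auto simp: Suc max_def split: if_splits)
  next
    case False
    have "markov (\<lambda>x. 0) x \<le> markov ?R x"
      using R x by (intro markov_mono) (auto simp: max_sum_nonneg)
    with False x show ?thesis by (auto simp: markov_const)
  qed
  moreover have "(\<lambda>x. indicator ?A x * f x) \<in> bdd_meas M"
    by (intro bdd_meas_mult f bdd_measI[of "indicator ?A" _ 1]) (auto simp: indicator_def)
  ultimately have "(\<integral>x. ?R x - markov ?R x \<partial>\<nu>) \<le> (\<integral>x. indicator ?A x * f x \<partial>\<nu>)"
    using R by (intro integral_mono integrable_\<nu>) auto
  moreover have "(\<integral>x. ?R x - markov ?R x \<partial>\<nu>) = 0"
    using R markov_bdd_meas[OF R] by (simp add: integrable_\<nu> integral_markov)
  ultimately show ?thesis by simp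
qed

lemma (in stationary_action) integral_nonneg_if_sum_pos:
  assumes f: "f \<in> bdd_meas M" and pos: "AE x in \<nu>. \<exists>n. 0 < ergodic_sum f n x"
  shows "0 \<le> (\<integral>x. f x \<partial>\<nu>)"
proof -
  note [measurable] = bdd_measD[OF f] bdd_measD[OF max_sum_bdd_meas[OF f]]
  have "(\<lambda>n. \<integral>x. indicator {x \<in> space M. 0 < max_sum f n x} x * f x \<partial>\<nu>) \<longlonglongrightarrow> (\<integral>x. f x \<partial>\<nu>)"
  proof (rule integral_dominated_convergence)
    show "integrable \<nu> (\<lambda>x. \<bar>f x\<bar>)" using f by (intro integrable_\<nu>) auto
    show "AE x in \<nu>. (\<lambda>n. indicator {x \<in> space M. 0 < max_sum f n x} x * f x) \<longlonglongrightarrow> f x"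
      using pos AE_space
    proof eventually_elim
      fix x assume "\<exists>n. 0 < ergodic_sum f n x" and x: "x \<in> space \<nu>"
      then obtain m where m: "0 < ergodic_sum f m x" by blast
      have "incseq (\<lambda>n. max_sum f n x)"
        using max_sum_mono[OF f] x by (intro incseq_SucI) auto
      then have "0 < max_sum f n x" if "n \<ge> m" for n
        using ergodic_sum_le_max_sum[OF f, of x m] m x incseqD[OF _ that, of "\<lambda>n. max_sum f n x"]
        by fastforce
      then have "eventually (\<lambda>n. indicator {x \<in> space M. 0 < max_sum f n x} x * f x = f x) sequentially"
        using x by (auto simp: eventually_sequentially intro!: exI[of _ m])
      then show "(\<lambda>n. indicator {x \<in> space M. 0 < max_sum f n x} x * f x) \<longlonglongrightarrow> f x"
        by (rule tendsto_eventually)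
    qed
    show "AE x in \<nu>. norm (indicator {x \<in> space M. 0 < max_sum f n x} x * f x) \<le> \<bar>f x\<bar>" for n
      by (auto simp: indicator_def)
  qed measurable
  then show ?thesis
    by (rule LIMSEQ_le_const) (use maximal_inequality[OF f] in auto)
qed

section \<open>The pointwise ergodic theorem\<close>

lemma (in random_action) markov_average:
  assumes f: "f \<in> bdd_meas M" and x: "x \<in> space M"
  shows "markov (\<lambda>x. ergodic_sum f n x / c) x = (ergodic_sum f n x + (markov ^^ n) f x - f x) / c"
  using markov_ergodic_sum[OF f x, of n] by (simp add: markov_divide) (simp add: ergodic_sum_def)

lemma (in random_action) ergodic_sum_bound:
  assumes f: "f \<in> bdd_meas M" "\<And>x. x \<in> space M \<Longrightarrow> \<bar>f x\<bar> \<le> C" and x: "x \<in> space M"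
  shows "\<bar>ergodic_sum f n x\<bar> \<le> n * C"
proof -
  have "\<bar>ergodic_sum f n x\<bar> \<le> (\<Sum>k<n. \<bar>(markov ^^ k) f x\<bar>)"
    unfolding ergodic_sum_def by (rule sum_abs)
  also have "\<dots> \<le> (\<Sum>k<n. C)"
    using norm_markov_funpow_le[OF f(1) _ x, of C] f(2) by (intro sum_mono) auto
  finally show ?thesis by simp
qed

text \<open>The upper half of the ergodic theorem. Below, \<open>l\<close> is the upper limit of the averages, written as
the limit of the decreasing sequence of suprema \<open>s N\<close>.\<close>

lemma (in ergodic_action) ergodic_upper:
  assumes f: "f \<in> bdd_meas M"
  shows "AE x in \<nu>. \<forall>e>0. \<forall>\<^sub>F n in sequentially. ergodic_sum f n x / n < (\<integral>x. f x \<partial>\<nu>) + e"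
proof -
  obtain C where C: "0 \<le> C" "\<And>x. x \<in> space M \<Longrightarrow> \<bar>f x\<bar> \<le> C"
    using f by (rule bdd_measE) (auto simp: real_norm_def)
  define a where "a n x = ergodic_sum f n x / n" for n x
  have a_meas[measurable]: "a n \<in> borel_measurable M" for n
    unfolding a_def[abs_def] using bdd_measD[OF ergodic_sum_bdd_meas[OF f]] by measurable
  have a_bound: "\<bar>a n x\<bar> \<le> C" if "x \<in> space M" for n x
    using ergodic_sum_bound[OF f C(2) that, of n] C(1) by (cases "n = 0") (auto simp: a_def divide_simps mult.commute)
  have a_bounds: "a n x \<le> C" "- C \<le> a n x" if "x \<in> space M" for n x
    using a_bound[OF that, of n] by auto
  have a_bdd: "a n \<in> bdd_meas M" for n
    using a_bound by (intro bdd_measI[of _ _ C]) auto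
  define s where "s N x = (SUP n\<in>{N..}. a n x)" for N x
  define l where "l x = (INF N. s N x)" for x
  have bdd: "bdd_above ((\<lambda>n. a n x) ` {N..})" if "x \<in> space M" for x N
    using a_bounds(1)[OF that] by (auto intro!: bdd_aboveI)
  have s_meas[measurable]: "s N \<in> borel_measurable M" for N
    unfolding s_def[abs_def] by (rule borel_measurable_cSUP) (auto intro: bdd)
  have s_up: "a n x \<le> s N x" if "x \<in> space M" "n \<ge> N" for x n N
    unfolding s_def by (rule cSUP_upper) (use that bdd in auto)
  have s_bounds: "s N x \<le> C" "- C \<le> s N x" if "x \<in> space M" for x N
    using a_bounds[OF that] s_up[OF that, of N N] unfolding s_def
    by (auto intro!: cSUP_least order_trans[OF a_bounds(2)[OF that, of N]])
  have s_bdd: "s N \<in> bdd_meas M" for N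
    using s_bounds by (intro bdd_measI[of _ _ C] s_meas) (auto simp: abs_le_iff, smt (verit))
  have s_dec: "decseq (\<lambda>N. s N x)" if "x \<in> space M" for x
    unfolding s_def decseq_def by (auto intro!: cSUP_subset_mono bdd that)
  have sb: "bdd_below (range (\<lambda>N. s N x))" if "x \<in> space M" for x
    using s_bounds(2)[OF that] by (auto intro!: bdd_belowI)
  have s_lim: "(\<lambda>N. s N x) \<longlonglongrightarrow> l x" if "x \<in> space M" for x
    unfolding l_def by (rule LIMSEQ_decseq_INF) (use sb s_dec that in auto)
  have l_meas[measurable]: "l \<in> borel_measurable M"
    by (rule borel_measurable_LIMSEQ_metric[OF s_meas s_lim])
  have l_bdd: "l \<in> bdd_meas M"
  proof (rule bdd_measI[OF l_meas])
    fix x assume x: "x \<in> space M"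
    have "l x \<le> C" by (rule LIMSEQ_le_const2[OF s_lim[OF x]]) (use s_bounds x in auto)
    moreover have "- C \<le> l x" by (rule LIMSEQ_le_const[OF s_lim[OF x]]) (use s_bounds x in auto)
    ultimately show "norm (l x) \<le> C" by auto
  qed
  \<comment> \<open>Averages are almost invariant, with an error of at most \<open>2 C / n\<close>, so \<open>l\<close> is subharmonic.\<close>
  have sub: "l x \<le> markov l x" if x: "x \<in> space M" for x
  proof -
    have step: "s N x - 2 * C / N \<le> markov (s N) x" if N: "N > 0" for N
    proof -
      have "a n x \<le> markov (s N) x + 2 * C / N" if n: "n \<ge> N" for n
      proof -
        have 1: "\<bar>(markov ^^ n) f x\<bar> \<le> C"
          using norm_markov_funpow_le[OF f _ x, of C n] C(2) by auto
        have "a n x - 2 * C / n \<le> (ergodic_sum f n x + (markov ^^ n) f x - f x) / n"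
          using 1 C(2)[OF x] n N by (auto simp: a_def divide_simps)
        also have "\<dots> = markov (a n) x"
          unfolding a_def[abs_def] by (rule markov_average[OF f x, symmetric])
        also have "\<dots> \<le> markov (s N) x"
          by (intro markov_mono a_bdd s_bdd x s_up n)
        also have "2 * C / n \<le> 2 * C / N"
          using n N C(1) by (intro divide_left_mono) auto
        ultimately show ?thesis by linarith
      qed
      then have "s N x \<le> markov (s N) x + 2 * C / N"
        unfolding s_def by (intro cSUP_least) auto
      then show ?thesis by simp
    qed
    have "(\<lambda>N. markov (s N) x) \<longlonglongrightarrow> markov l x"
      unfolding markov_def
    proof (rule integral_dominated_convergence[where w="\<lambda>_. C"])
      show "AE g in \<mu>. (\<lambda>N. s N (act g x)) \<longlonglongrightarrow> l (act g x)"
        by (intro AE_I2 s_lim act_space x)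
      show "AE g in \<mu>. norm (s N (act g x)) \<le> C" for N
      proof (rule AE_I2)
        fix g assume "g \<in> space \<mu>"
        with s_bounds[of "act g x" N] act_space[OF _ x] show "norm (s N (act g x)) \<le> C" by auto
      qed
    qed (use x in \<open>auto\<close>)
    moreover have "(\<lambda>N. s N x - 2 * C / real N) \<longlonglongrightarrow> l x - 0"
      by (intro tendsto_diff s_lim x lim_const_over_n)
    ultimately show ?thesis
      using step by (intro LIMSEQ_le[of "\<lambda>N. s N x - 2 * C / real N" _ "\<lambda>N. markov (s N) x"])
        (auto intro!: exI[of _ 1])
  qed
  \<comment> \<open>A bounded subharmonic function is harmonic almost everywhere, as \<open>\<nu>\<close> is stationary.\<close>
  have "(\<integral>x. markov l x - l x \<partial>\<nu>) = 0"
    using l_bdd markov_bdd_meas[OF l_bdd] by (simp add: integrable_\<nu> integral_markov)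
  then have "AE x in \<nu>. markov l x - l x = 0"
    using sub l_bdd markov_bdd_meas[OF l_bdd]
    by (subst (asm) integral_nonneg_eq_0_iff_AE) (auto intro!: integrable_\<nu>)
  then have "AE x in \<nu>. markov l x = l x" by simp
  from harmonic_imp_const[OF l_bdd this] obtain c where c: "AE x in \<nu>. l x = c" by blast
  have le: "c \<le> (\<integral>x. f x \<partial>\<nu>)"
  proof (rule field_le_epsilon)
    fix e :: real assume e: "e > 0"
    let ?b = "c - e"
    have fb: "(\<lambda>x. f x - ?b) \<in> bdd_meas M" using f by auto
    have "AE x in \<nu>. \<exists>n. 0 < ergodic_sum (\<lambda>x. f x - ?b) n x"
      using c AE_space
    proof eventually_elim
      fix x assume lx: "l x = c" and "x \<in> space \<nu>"
      then have x: "x \<in> space M" by simp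
      have "c \<le> s 1 x"
        unfolding lx[symmetric] l_def by (rule cINF_lower) (use sb[OF x] in auto)
      then have "?b < s 1 x" using e by simp
      then obtain n where n: "n \<ge> 1" "?b < a n x"
        unfolding s_def by (subst (asm) less_cSUP_iff) (use bdd[OF x] in auto)
      have "(markov ^^ k) (\<lambda>x. f x - ?b) y = (markov ^^ k) f y - ?b" if "y \<in> space M" for k y
        using that
      proof (induction k arbitrary: y)
        case (Suc k)
        have "markov ((markov ^^ k) (\<lambda>x. f x - ?b)) y = markov (\<lambda>x. (markov ^^ k) f x - ?b) y"
          by (rule markov_cong) (use Suc in auto)
        also have "\<dots> = markov ((markov ^^ k) f) y - ?b"
          by (subst markov_diff) (use f Suc in \<open>auto simp: markov_const\<close>)
        finally show ?case by simp
      qed simp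
      then have "ergodic_sum (\<lambda>x. f x - ?b) n x = ergodic_sum f n x - n * ?b"
        using x by (simp add: ergodic_sum_def sum_subtractf)
      also have "\<dots> > 0" using n by (simp add: a_def field_simps)
      finally show "\<exists>n. 0 < ergodic_sum (\<lambda>x. f x - ?b) n x" by blast
    qed
    from integral_nonneg_if_sum_pos[OF fb this] have "0 \<le> (\<integral>x. f x - ?b \<partial>\<nu>)" .
    also have "\<dots> = (\<integral>x. f x \<partial>\<nu>) - ?b" using f by (simp add: integrable_\<nu>)
    finally show "c \<le> (\<integral>x. f x \<partial>\<nu>) + e" by simp
  qed
  from c AE_space show ?thesis
  proof eventually_elim
    case (elim x)
    then have x: "x \<in> space M" by simp
    show ?case
    proof (intro allI impI)
      fix e :: real assume "e > 0"
      then have "l x < (\<integral>x. f x \<partial>\<nu>) + e" using elim le by simp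
      then have "\<forall>\<^sub>F N in sequentially. s N x < (\<integral>x. f x \<partial>\<nu>) + e"
        by (rule order_tendstoD(2)[OF s_lim[OF x]])
      then show "\<forall>\<^sub>F n in sequentially. ergodic_sum f n x / n < (\<integral>x. f x \<partial>\<nu>) + e"
        by eventually_elim (use s_up[OF x] in \<open>auto simp: a_def intro: le_less_trans\<close>)
    qed
  qed
qed

theorem (in ergodic_action) pointwise_ergodic:
  assumes f: "f \<in> bdd_meas M"
  shows "AE x in \<nu>. (\<lambda>n. ergodic_sum f n x / n) \<longlonglongrightarrow> (\<integral>x. f x \<partial>\<nu>)"
proof -
  have mf: "(\<lambda>x. - f x) \<in> bdd_meas M" using f by auto
  have "ergodic_sum (\<lambda>x. - f x) n x = - ergodic_sum f n x" for n x
  proof -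
    have "(markov ^^ k) (\<lambda>x. - f x) = (\<lambda>x. - (markov ^^ k) f x)" for k
      by (induction k) (auto simp: markov_def)
    then show ?thesis by (simp add: ergodic_sum_def sum_negf)
  qed
  then have "AE x in \<nu>. \<forall>e>0. \<forall>\<^sub>F n in sequentially. (\<integral>x. f x \<partial>\<nu>) - e < ergodic_sum f n x / n"
    using ergodic_upper[OF mf] by simp (simp add: less_diff_eq diff_less_eq add.commute algebra_simps)
  with ergodic_upper[OF f] show ?thesis
  proof eventually_elim
    case (elim x)
    show ?case
    proof (rule order_tendstoI)
      fix b assume "b < (\<integral>x. f x \<partial>\<nu>)"
      then show "\<forall>\<^sub>F n in sequentially. b < ergodic_sum f n x / n"
        using elim(2)[rule_format, of "(\<integral>x. f x \<partial>\<nu>) - b"] by simp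
    next
      fix b assume "(\<integral>x. f x \<partial>\<nu>) < b"
      then show "\<forall>\<^sub>F n in sequentially. ergodic_sum f n x / n < b"
        using elim(1)[rule_format, of "b - (\<integral>x. f x \<partial>\<nu>)"] by simp
    qed
  qed
qed

section \<open>Random walks on a countable group\<close>

text \<open>Every function on a discrete space is measurable.\<close>

lemma borel_measurable_discrete:
  fixes f :: "'a \<Rightarrow> 'b :: topological_space"
  assumes "sets N = sets (count_space A)" shows "f \<in> borel_measurable N"
  by (subst measurable_cong_sets[OF assms refl]) simp

text \<open>A random walk on a countable group acting measurably on \<open>M\<close>. The action is required to be an
action on \<open>space M\<close> only.\<close>

locale group_walk = group G for G (structure) +
  fixes \<mu> :: "'a measure" and M :: "'y measure" and act :: "'a \<Rightarrow> 'y \<Rightarrow> 'y"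
  assumes countable_G: "countable (carrier G)"
    and group_prob: "group_prob G \<mu>"
    and act_measurable: "g \<in> carrier G \<Longrightarrow> act g \<in> M \<rightarrow>\<^sub>M M"
    and act_mult: "g \<in> carrier G \<Longrightarrow> h \<in> carrier G \<Longrightarrow> x \<in> space M \<Longrightarrow>
      act (g \<otimes> h) x = act g (act h x)"
    and act_one: "x \<in> space M \<Longrightarrow> act \<one> x = x"
begin

lemma sets_\<mu> [measurable_cong]: "sets \<mu> = sets (count_space (carrier G))"
  using group_prob by (simp add: group_prob_def)

lemma space_\<mu> [simp]: "space \<mu> = carrier G"
  using sets_eq_imp_space_eq[OF sets_\<mu>] by simp

lemma measurable_countable_pair:
  assumes "\<And>g. g \<in> carrier G \<Longrightarrow> f g \<in> M' \<rightarrow>\<^sub>M N"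
  shows "(\<lambda>(g, x). f g x) \<in> count_space (carrier G) \<Otimes>\<^sub>M M' \<rightarrow>\<^sub>M N"
  by (rule measurable_pair_measure_countable1[OF countable_G]) (use assms in simp)

end

sublocale group_walk \<subseteq> random_action \<mu> M act
proof -
  have "prob_space \<mu>" using group_prob by (simp add: group_prob_def)
  moreover have "(\<lambda>(g, x). act g x) \<in> \<mu> \<Otimes>\<^sub>M M \<rightarrow>\<^sub>M M"
    using measurable_countable_pair[of act M M] act_measurable
      measurable_cong_sets[OF sets_pair_measure_cong[OF sets_\<mu> refl] refl] by blast
  ultimately show "random_action \<mu> M act"
    by (simp add: random_action_def random_action_axioms_def)
qed

context group_walk
begin

lemma prob_carrier [simp]: "prob (carrier G) = 1"
  using prob_space by simp

lemma sets_conv_power: "sets (conv_power G \<mu> n) = sets (count_space (carrier G))"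
  by (cases n) auto

lemma space_conv_power [simp]: "space (conv_power G \<mu> n) = carrier G"
  using sets_eq_imp_space_eq[OF sets_conv_power] by simp

lemma sets_pair_conv:
  "sets (\<mu> \<Otimes>\<^sub>M conv_power G \<mu> n) = sets (count_space (carrier G \<times> carrier G))"
  by (subst sets_pair_measure_cong[OF sets_\<mu> sets_conv_power],
      subst pair_measure_countable) (auto simp: countable_G)

lemma mult_measurable:
  "(\<lambda>(g, h). g \<otimes> h) \<in> \<mu> \<Otimes>\<^sub>M conv_power G \<mu> n \<rightarrow>\<^sub>M count_space (carrier G)"
  by (subst measurable_cong_sets[OF sets_pair_conv refl]) auto

lemma prob_space_conv_power: "prob_space (conv_power G \<mu> n)"
proof (induction n)
  case 0 show ?case by (auto intro!: prob_space_return)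
next
  case (Suc n)
  interpret c: prob_space "conv_power G \<mu> n" by fact
  interpret pair_prob_space \<mu> "conv_power G \<mu> n" ..
  show ?case using P.prob_space_distr[OF mult_measurable] by simp
qed

lemma integrable_conv_power:
  fixes F :: "'a \<Rightarrow> 'c :: {banach, second_countable_topology}"
  assumes "\<And>g. g \<in> carrier G \<Longrightarrow> norm (F g) \<le> C"
  shows "integrable (conv_power G \<mu> n) F"
proof -
  interpret c: prob_space "conv_power G \<mu> n" by (rule prob_space_conv_power)
  show ?thesis
    using assms borel_measurable_discrete[OF sets_conv_power]
    by (intro c.integrable_const_bound[of _ C]) auto
qed

lemma integral_conv_power_0:
  fixes F :: "'a \<Rightarrow> 'c :: {banach, second_countable_topology}"
  shows "(\<integral>g. F g \<partial>conv_power G \<mu> 0) = F \<one>"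
  by (simp add: integral_return)

text \<open>In \<open>g \<otimes> h\<close> the new factor \<open>g\<close> stands on the left, so it acts last.\<close>

lemma integral_conv_power_Suc:
  fixes F :: "'a \<Rightarrow> 'c :: {banach, second_countable_topology}"
  assumes F: "\<And>g. g \<in> carrier G \<Longrightarrow> norm (F g) \<le> C"
  shows "(\<integral>g. F g \<partial>conv_power G \<mu> (Suc n)) = (\<integral>h. (\<integral>g. F (g \<otimes> h) \<partial>\<mu>) \<partial>conv_power G \<mu> n)"
proof -
  interpret c: prob_space "conv_power G \<mu> n" by (rule prob_space_conv_power)
  interpret pair_prob_space \<mu> "conv_power G \<mu> n" ..
  have "integrable (\<mu> \<Otimes>\<^sub>M conv_power G \<mu> n) (\<lambda>(g, h). F (g \<otimes> h))"
    using borel_measurable_discrete[OF sets_pair_conv]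
    by (intro P.integrable_const_bound[of _ C]) (auto intro!: AE_I2 F simp: space_pair_measure)
  from integral_snd[OF this]
  have "(\<integral>h. (\<integral>g. F (g \<otimes> h) \<partial>\<mu>) \<partial>conv_power G \<mu> n)
      = (\<integral>p. F ((\<lambda>(g, h). g \<otimes> h) p) \<partial>(\<mu> \<Otimes>\<^sub>M conv_power G \<mu> n))"
    by (simp add: split_beta')
  also have "\<dots> = (\<integral>g. F g \<partial>conv_power G \<mu> (Suc n))"
    unfolding conv_power.simps by (rule integral_distr[OF mult_measurable, symmetric]) simp
  finally show ?thesis by simp
qed

lemma markov_funpow_eq:
  fixes f :: "'y \<Rightarrow> 'c :: {banach, second_countable_topology}"
  assumes "f \<in> bdd_meas M" and x: "x \<in> space M"
  shows "(markov ^^ n) f x = (\<integral>g. f (act g x) \<partial>conv_power G \<mu> n)"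
  using assms(1)
proof (induction n arbitrary: f)
  case 0 then show ?case using x by (simp add: integral_conv_power_0 act_one del: conv_power.simps)
next
  case (Suc n)
  obtain C where C: "\<And>x. x \<in> space M \<Longrightarrow> norm (f x) \<le> C" using Suc.prems by (rule bdd_measE) blast
  have "(markov ^^ Suc n) f x = (markov ^^ n) (markov f) x" by (simp add: funpow_swap1)
  also have "\<dots> = (\<integral>h. markov f (act h x) \<partial>conv_power G \<mu> n)"
    using Suc by blast
  also have "\<dots> = (\<integral>h. (\<integral>g. f (act (g \<otimes> h) x) \<partial>\<mu>) \<partial>conv_power G \<mu> n)"
    unfolding markov_def using x act_mult
    by (intro Bochner_Integration.integral_cong refl) auto
  also have "\<dots> = (\<integral>g. f (act g x) \<partial>conv_power G \<mu> (Suc n))"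
    by (rule integral_conv_power_Suc[symmetric, of _ C]) (use C act_space x in auto)
  finally show ?case .
qed

lemma markov_funpow_le_affine:
  fixes f g :: "'y \<Rightarrow> real"
  assumes "f \<in> bdd_meas M" "g \<in> bdd_meas M" "\<And>x. x \<in> space M \<Longrightarrow> f x \<le> a * g x + b" "x \<in> space M"
  shows "(markov ^^ n) f x \<le> a * (markov ^^ n) g x + b"
  using assms(4)
proof (induction n arbitrary: x)
  case 0 then show ?case using assms(3) by simp
next
  case (Suc n)
  have g: "(\<lambda>x. a * (markov ^^ n) g x) \<in> bdd_meas M"
    using assms(2) by (intro bdd_meas_mult) auto
  have "(markov ^^ Suc n) f x \<le> markov (\<lambda>x. a * (markov ^^ n) g x + b) x"
    unfolding funpow.simps comp_def
    by (intro markov_mono bdd_meas_add g Suc) (use assms in auto)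
  also have "\<dots> = markov (\<lambda>x. a * (markov ^^ n) g x) x + b"
    by (subst markov_add) (use g Suc.prems in \<open>auto simp: markov_const\<close>)
  also have "\<dots> = a * (markov ^^ Suc n) g x + b"
    by (simp add: markov_def)
  finally show ?case .
qed

end

section \<open>The characteristic function of a cocycle with constant drift\<close>

text \<open>A cocycle with constant drift \<open>lam\<close> whose increments are dominated, uniformly in \<open>x\<close>, by a
square integrable function \<open>H\<close> of the group element.\<close>

locale drift_cocycle = group_walk +
  fixes \<sigma> :: "'a \<Rightarrow> 'c \<Rightarrow> real" and lam :: real and H :: "'a \<Rightarrow> real"
  assumes cocycle: "measurable_cocycle G act M \<sigma>"
    and drift: "constant_drift \<mu> M \<sigma> lam"
    and H_bound: "g \<in> carrier G \<Longrightarrow> x \<in> space M \<Longrightarrow> \<bar>\<sigma> g x - lam\<bar> \<le> H g"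
    and H_nonneg: "0 \<le> H g"
    and H_sq: "integrable \<mu> (\<lambda>g. (H g)\<^sup>2)"
begin

text \<open>The conditional variance of one step of the walk that starts at \<open>x\<close>.\<close>

definition step_var :: "'c \<Rightarrow> real" where
  "step_var x = (\<integral>g. (\<sigma> g x - lam)\<^sup>2 \<partial>\<mu>)"

text \<open>The Markov operator twisted by the centered cocycle at frequency \<open>s\<close>.\<close>

definition twist :: "real \<Rightarrow> ('c \<Rightarrow> complex) \<Rightarrow> 'c \<Rightarrow> complex" where
  "twist s f x = (\<integral>g. iexp (s * (\<sigma> g x - lam)) * f (act g x) \<partial>\<mu>)"

text \<open>The \<open>n\<close>-th power of the twisted operator, written with the convolution power. For \<open>f = 1\<close> it is the
characteristic function of the cocycle after \<open>n\<close> steps, centered by \<open>n * lam\<close>.\<close>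

definition twist_pow :: "real \<Rightarrow> nat \<Rightarrow> ('c \<Rightarrow> complex) \<Rightarrow> 'c \<Rightarrow> complex" where
  "twist_pow s n f x =
     (\<integral>g. iexp (s * (\<sigma> g x - n * lam)) * f (act g x) \<partial>conv_power G \<mu> n)"

text \<open>A bound for the error of the second-order expansion of \<open>twist s 1\<close>, divided by \<open>s\<^sup>2\<close>. It tends to \<open>0\<close> with \<open>s\<close>,
by dominated convergence; no third moment is needed.\<close>

definition taylor_rem :: "real \<Rightarrow> real" where
  "taylor_rem s = (\<integral>g. min ((H g)\<^sup>2) (\<bar>s\<bar> * (H g) ^ 3 / 6) \<partial>\<mu>)"

lemma borel_\<mu> [measurable]: "f \<in> borel_measurable \<mu>"
  by (rule borel_measurable_discrete[OF sets_\<mu>])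

lemma measurable_\<sigma> [measurable]: "(\<lambda>(g, x). \<sigma> g x) \<in> borel_measurable (\<mu> \<Otimes>\<^sub>M M)"
  using cocycle measurable_cong_sets[OF sets_pair_measure_cong[OF sets_\<mu> refl] refl]
  unfolding measurable_cocycle_def by blast

lemma \<sigma>_mult:
  "g \<in> carrier G \<Longrightarrow> h \<in> carrier G \<Longrightarrow> x \<in> space M \<Longrightarrow> \<sigma> (g \<otimes> h) x = \<sigma> g (act h x) + \<sigma> h x"
  using cocycle unfolding measurable_cocycle_def by blast

lemma \<sigma>_one: "x \<in> space M \<Longrightarrow> \<sigma> \<one> x = 0"
  using \<sigma>_mult[of \<one> \<one> x] by (simp add: act_one)

lemma H_int: "integrable \<mu> H"
  by (rule square_integrable_imp_integrable) (use H_sq in auto)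

lemma integrable_\<sigma>: "x \<in> space M \<Longrightarrow> integrable \<mu> (\<lambda>g. \<sigma> g x)"
  using drift by (auto simp: constant_drift_def has_bochner_integral_iff)

lemma integral_\<sigma>: "x \<in> space M \<Longrightarrow> (\<integral>g. \<sigma> g x - lam \<partial>\<mu>) = 0"
  using drift by (auto simp: constant_drift_def has_bochner_integral_iff)

lemma \<sigma>_sq_le: "g \<in> carrier G \<Longrightarrow> x \<in> space M \<Longrightarrow> (\<sigma> g x - lam)\<^sup>2 \<le> (H g)\<^sup>2"
  using power_mono[OF H_bound[of g x], of 2] by simp

lemma integrable_\<sigma>_sq: "x \<in> space M \<Longrightarrow> integrable \<mu> (\<lambda>g. (\<sigma> g x - lam)\<^sup>2)"
  by (rule Bochner_Integration.integrable_bound[OF H_sq]) (auto intro!: AE_I2 \<sigma>_sq_le)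

lemma step_var_bdd: "step_var \<in> bdd_meas M"
proof (rule bdd_measI[of _ _ "\<integral>g. (H g)\<^sup>2 \<partial>\<mu>"])
  have "(\<lambda>x. \<integral>g. (\<sigma> g x - lam)\<^sup>2 \<partial>\<mu>) \<in> borel_measurable M" by measurable
  then show "step_var \<in> borel_measurable M" by (simp add: step_var_def[abs_def])
  show "norm (step_var x) \<le> (\<integral>g. (H g)\<^sup>2 \<partial>\<mu>)" if "x \<in> space M" for x
  proof -
    have "step_var x \<le> (\<integral>g. (H g)\<^sup>2 \<partial>\<mu>)"
      unfolding step_var_def using that by (intro integral_mono integrable_\<sigma>_sq H_sq \<sigma>_sq_le) auto
    moreover have "0 \<le> step_var x" unfolding step_var_def by simp
    ultimately show ?thesis by simp
  qed
qed

lemma taylor_rem_integrable: "integrable \<mu> (\<lambda>g. min ((H g)\<^sup>2) (\<bar>s\<bar> * (H g) ^ 3 / 6))"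
  by (rule Bochner_Integration.integrable_bound[OF H_sq]) (auto simp: H_nonneg)

lemma taylor_rem_tendsto_0:
  assumes "s \<longlonglongrightarrow> 0" shows "(\<lambda>n. taylor_rem (s n)) \<longlonglongrightarrow> 0"
proof -
  have "(\<lambda>n. taylor_rem (s n)) \<longlonglongrightarrow> (\<integral>g. 0 \<partial>\<mu>)"
    unfolding taylor_rem_def
  proof (rule integral_dominated_convergence[OF _ _ H_sq])
    show "AE g in \<mu>. (\<lambda>n. min ((H g)\<^sup>2) (\<bar>s n\<bar> * (H g) ^ 3 / 6)) \<longlonglongrightarrow> 0"
    proof (rule AE_I2)
      fix g
      have "(\<lambda>n. min ((H g)\<^sup>2) (\<bar>s n\<bar> * (H g) ^ 3 / 6)) \<longlonglongrightarrow> min ((H g)\<^sup>2) (\<bar>0\<bar> * (H g) ^ 3 / 6)"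
        by (intro tendsto_intros assms) auto
      also have "min ((H g)\<^sup>2) (\<bar>0\<bar> * (H g) ^ 3 / 6) = 0" by simp
      finally show "(\<lambda>n. min ((H g)\<^sup>2) (\<bar>s n\<bar> * (H g) ^ 3 / 6)) \<longlonglongrightarrow> 0" .
    qed
  qed (auto simp: H_nonneg)
  then show ?thesis by simp
qed

lemma iexp_second_order:
  "cmod (iexp y - (1 + \<i> * y - y\<^sup>2 / 2)) \<le> min (y\<^sup>2) (\<bar>y\<bar> ^ 3 / 6)"
proof -
  have "(\<Sum>k\<le>2. (\<i> * y) ^ k / fact k) = 1 + \<i> * y - y\<^sup>2 / 2"
    by (simp add: eval_nat_numeral power_mult_distrib)
  then show ?thesis
    using iexp_approx1[of y 2] iexp_approx2[of y 2] by (simp add: eval_nat_numeral)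
qed

lemma norm_iexp_sub_1: "cmod (iexp y - 1) \<le> \<bar>y\<bar>"
  using iexp_approx1[of y 0] by simp

lemma integrable_twist:
  assumes f: "f \<in> bdd_meas M" and x: "x \<in> space M"
  shows "integrable \<mu> (\<lambda>g. iexp (s * (\<sigma> g x - lam)) * f (act g x))"
proof -
  obtain C where C: "\<And>x. x \<in> space M \<Longrightarrow> norm (f x) \<le> C" using f by (rule bdd_measE) blast
  show ?thesis
    by (rule integrable_const_bound[of _ C]) (use C x act_space in \<open>auto simp: norm_mult\<close>)
qed

lemma twist_bdd:
  assumes f: "f \<in> bdd_meas M" shows "twist s f \<in> bdd_meas M"
proof -
  obtain C where C: "\<And>x. x \<in> space M \<Longrightarrow> norm (f x) \<le> C" using f by (rule bdd_measE) blast
  note [measurable] = bdd_measD[OF f]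
  have "(\<lambda>x. \<integral>g. iexp (s * (\<sigma> g x - lam)) * f (act g x) \<partial>\<mu>) \<in> borel_measurable M"
    by measurable
  then have "twist s f \<in> borel_measurable M" by (simp add: twist_def[abs_def])
  then show ?thesis
  proof (rule bdd_measI)
    fix x assume x: "x \<in> space M"
    show "norm (twist s f x) \<le> C"
      unfolding twist_def
      by (rule norm_integral_le[OF integrable_twist[OF f x]])
         (use C x act_space in \<open>auto simp: norm_mult\<close>)
  qed
qed

lemma twist_1_approx:
  assumes x: "x \<in> space M"
  shows "cmod (twist s (\<lambda>_. 1) x - (1 - s\<^sup>2 / 2 * step_var x)) \<le> s\<^sup>2 * taylor_rem s"
proof -
  let ?a = "\<lambda>g. \<sigma> g x - lam"
  have i1: "integrable \<mu> (\<lambda>g. iexp (s * ?a g))"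
    using integrable_twist[of "\<lambda>_. 1" x s] x by simp
  have i2: "integrable \<mu> (\<lambda>g. \<i> * s * ?a g)"
    using integrable_\<sigma>[OF x] by (intro integrable_mult_right integrable_of_real) auto
  have i3: "integrable \<mu> (\<lambda>g. complex_of_real (s\<^sup>2 / 2) * complex_of_real ((?a g)\<^sup>2))"
    using integrable_\<sigma>_sq[OF x] by (intro integrable_mult_right integrable_of_real) auto
  have i4: "integrable \<mu> (\<lambda>g. iexp (s * ?a g) - (1 + \<i> * s * ?a g - complex_of_real (s\<^sup>2 / 2) * complex_of_real ((?a g)\<^sup>2)))"
    using i1 i2 i3 by (intro Bochner_Integration.integrable_diff Bochner_Integration.integrable_add) auto
  have e1: "(\<integral>g. \<i> * s * ?a g \<partial>\<mu>) = 0"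
    by (simp only: integral_mult_right_zero integral_complex_of_real integral_\<sigma>[OF x]) simp
  have e2: "(\<integral>g. complex_of_real (s\<^sup>2 / 2) * complex_of_real ((?a g)\<^sup>2) \<partial>\<mu>) = s\<^sup>2 / 2 * step_var x"
    by (simp only: integral_mult_right_zero integral_complex_of_real step_var_def) simp
  have eq: "twist s (\<lambda>_. 1) x - (1 - s\<^sup>2 / 2 * step_var x)
      = (\<integral>g. iexp (s * ?a g) - (1 + \<i> * s * ?a g - complex_of_real (s\<^sup>2 / 2) * complex_of_real ((?a g)\<^sup>2)) \<partial>\<mu>)"
    using i1 i2 i3 e1 e2
    by (simp only: Bochner_Integration.integral_diff Bochner_Integration.integral_add
        Bochner_Integration.integrable_diff Bochner_Integration.integrable_add integrable_const)
      (simp add: twist_def)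
  have "cmod (twist s (\<lambda>_. 1) x - (1 - s\<^sup>2 / 2 * step_var x))
      \<le> (\<integral>g. cmod (iexp (s * ?a g) - (1 + \<i> * s * ?a g - complex_of_real (s\<^sup>2 / 2) * complex_of_real ((?a g)\<^sup>2))) \<partial>\<mu>)"
    unfolding eq by (rule integral_norm_bound)
  also have "\<dots> \<le> (\<integral>g. s\<^sup>2 * min ((H g)\<^sup>2) (\<bar>s\<bar> * (H g) ^ 3 / 6) \<partial>\<mu>)"
  proof (rule integral_mono)
    fix g assume "g \<in> space \<mu>"
    then have g: "\<bar>?a g\<bar> \<le> H g" using H_bound x by simp
    have "cmod (iexp (s * ?a g) - (1 + \<i> * s * ?a g - complex_of_real (s\<^sup>2 / 2) * complex_of_real ((?a g)\<^sup>2)))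
        \<le> min ((s * ?a g)\<^sup>2) (\<bar>s * ?a g\<bar> ^ 3 / 6)"
      using iexp_second_order[of "s * ?a g"] by (simp add: power_mult_distrib mult.assoc)
    also have "\<dots> = s\<^sup>2 * min (\<bar>?a g\<bar>\<^sup>2) (\<bar>s\<bar> * \<bar>?a g\<bar> ^ 3 / 6)"
    proof -
      have "(s * ?a g)\<^sup>2 = s\<^sup>2 * \<bar>?a g\<bar>\<^sup>2" by (simp add: power_mult_distrib)
      moreover have "\<bar>s * ?a g\<bar> ^ 3 / 6 = s\<^sup>2 * (\<bar>s\<bar> * \<bar>?a g\<bar> ^ 3 / 6)"
        unfolding abs_mult power_mult_distrib power2_abs[of s, symmetric]
        by (simp only: power3_eq_cube power2_eq_square mult_ac times_divide_eq_right)
      ultimately show ?thesis by (simp only: min_mult_distrib_left zero_le_power2 if_True)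
    qed
    also have "\<dots> \<le> s\<^sup>2 * min ((H g)\<^sup>2) (\<bar>s\<bar> * (H g) ^ 3 / 6)"
      using g by (intro mult_left_mono min.mono power_mono divide_right_mono) auto
    finally show "cmod (iexp (s * ?a g) - (1 + \<i> * s * ?a g - complex_of_real (s\<^sup>2 / 2) * complex_of_real ((?a g)\<^sup>2)))
        \<le> s\<^sup>2 * min ((H g)\<^sup>2) (\<bar>s\<bar> * (H g) ^ 3 / 6)" .
  qed (use i4 taylor_rem_integrable in auto)
  also have "\<dots> = s\<^sup>2 * taylor_rem s" by (simp add: taylor_rem_def)
  finally show ?thesis .
qed

lemma twist_markov_approx:
  assumes u: "u \<in> bdd_meas M" "\<And>x. x \<in> space M \<Longrightarrow> \<bar>u x\<bar> \<le> C" and x: "x \<in> space M"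
  shows "cmod (twist s (\<lambda>x. of_real (u x)) x - of_real (markov u x)) \<le> \<bar>s\<bar> * C * (\<integral>g. H g \<partial>\<mu>)"
proof -
  let ?a = "\<lambda>g. \<sigma> g x - lam"
  have C: "0 \<le> C" using u(2)[OF x] by linarith
  have i1: "integrable \<mu> (\<lambda>g. iexp (s * ?a g) * of_real (u (act g x)))"
    using u x by (intro integrable_twist) auto
  have i2: "integrable \<mu> (\<lambda>g. complex_of_real (u (act g x)))"
    using integrable_act[OF u(1) x] by simp
  have "twist s (\<lambda>x. of_real (u x)) x - of_real (markov u x)
      = (\<integral>g. iexp (s * ?a g) * of_real (u (act g x)) - of_real (u (act g x)) \<partial>\<mu>)"
    using i1 i2 by (simp add: twist_def markov_def)
  also have "cmod \<dots> \<le> (\<integral>g. cmod (iexp (s * ?a g) * of_real (u (act g x)) - of_real (u (act g x))) \<partial>\<mu>)"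
    by (rule integral_norm_bound)
  also have "\<dots> \<le> (\<integral>g. \<bar>s\<bar> * C * H g \<partial>\<mu>)"
  proof (rule integral_mono)
    fix g assume g: "g \<in> space \<mu>"
    have "cmod (iexp (s * ?a g) * of_real (u (act g x)) - of_real (u (act g x)))
        = cmod ((iexp (s * ?a g) - 1) * of_real (u (act g x)))"
      by (simp add: algebra_simps)
    also have "\<dots> = cmod (iexp (s * ?a g) - 1) * \<bar>u (act g x)\<bar>"
      by (simp add: norm_mult)
    also have "\<dots> \<le> \<bar>s * ?a g\<bar> * C"
      using norm_iexp_sub_1[of "s * ?a g"] u(2)[OF act_space[OF g x]] by (intro mult_mono) auto
    also have "\<dots> \<le> (\<bar>s\<bar> * H g) * C"
      using H_bound[of g x] g x C by (intro mult_right_mono) (auto simp: abs_mult intro!: mult_left_mono)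
    finally show "cmod (iexp (s * ?a g) * of_real (u (act g x)) - of_real (u (act g x)))
        \<le> \<bar>s\<bar> * C * H g" by (simp add: mult_ac)
  qed (use i1 i2 H_int in auto)
  finally show ?thesis by simp
qed

text \<open>Second-order expansion of the twisted operator at \<open>w = 1 - s\<^sup>2 u / 2\<close>. The choice of \<open>w\<close> makes the
terms \<open>u - P u\<close> of the decomposition of the variance cancel, so that only \<open>V\<close> and \<open>r\<close> remain at
order \<open>s\<^sup>2\<close>.\<close>

lemma twist_corrector:
  fixes s V :: real
  assumes u: "u \<in> bdd_meas M" "\<And>x. x \<in> space M \<Longrightarrow> \<bar>u x\<bar> \<le> C" and x: "x \<in> space M"
    and eq: "step_var x = V + u x - markov u x + r x"
  defines "w \<equiv> \<lambda>x. complex_of_real (1 - s\<^sup>2 / 2 * u x)"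
  shows "cmod (twist s w x - of_real (1 - s\<^sup>2 / 2 * V) * w x)
    \<le> s\<^sup>2 / 2 * \<bar>r x\<bar> + s\<^sup>2 * (taylor_rem s + \<bar>s\<bar> * C * (\<integral>g. H g \<partial>\<mu>) / 2 + s\<^sup>2 * \<bar>V\<bar> * C / 4)"
proof -
  let ?e1 = "twist s (\<lambda>_. 1) x - (1 - s\<^sup>2 / 2 * step_var x)"
  let ?e2 = "twist s (\<lambda>x. of_real (u x)) x - of_real (markov u x)"
  let ?S = "complex_of_real (s\<^sup>2 / 2)"
  have i1: "integrable \<mu> (\<lambda>g. iexp (s * (\<sigma> g x - lam)) * 1)"
    using integrable_twist[of "\<lambda>_. 1" x s] x by simp
  have i2: "integrable \<mu> (\<lambda>g. iexp (s * (\<sigma> g x - lam)) * complex_of_real (u (act g x)))"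
    using u x by (intro integrable_twist) auto
  have "twist s w x = twist s (\<lambda>_. 1) x - complex_of_real (s\<^sup>2 / 2) * twist s (\<lambda>x. of_real (u x)) x"
  proof -
    have "twist s w x = (\<integral>g. iexp (s * (\<sigma> g x - lam)) * 1
        - complex_of_real (s\<^sup>2 / 2) * (iexp (s * (\<sigma> g x - lam)) * of_real (u (act g x))) \<partial>\<mu>)"
      unfolding twist_def w_def
      by (intro Bochner_Integration.integral_cong refl) (simp add: algebra_simps)
    also have "\<dots> = twist s (\<lambda>_. 1) x - complex_of_real (s\<^sup>2 / 2) * twist s (\<lambda>x. of_real (u x)) x"
      unfolding twist_def
      by (simp only: Bochner_Integration.integral_diff[OF i1 integrable_mult_right[OF i2]]
          integral_mult_right_zero)
    finally show ?thesis .
  qed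
  also have "\<dots> = (1 - ?S * of_real (step_var x) + ?e1) - ?S * (of_real (markov u x) + ?e2)"
    by simp
  finally have wx: "twist s w x = (1 - ?S * of_real (step_var x) + ?e1) - ?S * (of_real (markov u x) + ?e2)" .
  have alg: "((1 - S * a' + e1) - S * (m' + e2)) - (1 - S * V') * (1 - S * u')
      = (- (S * r') + e1) - (S * e2 + S * S * V' * u')"
    if "a' = V' + u' - m' + r'" for S V' u' a' m' r' e1 e2 :: complex
    by (simp add: that algebra_simps)
  have "of_real (step_var x) = of_real V + of_real (u x) - of_real (markov u x) + complex_of_real (r x)"
    by (simp add: eq)
  note alg[OF this, of ?S ?e1 ?e2, folded wx]
  moreover have "?S * ?S * of_real V * of_real (u x) = of_real (s\<^sup>2 * s\<^sup>2 * V * u x / 4)"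
    by simp
  moreover have "w x = 1 - ?S * of_real (u x)" by (simp add: w_def)
  ultimately have *: "twist s w x - of_real (1 - s\<^sup>2 / 2 * V) * w x
      = (- of_real (s\<^sup>2 / 2 * r x) + ?e1) - (?S * ?e2 + of_real (s\<^sup>2 * s\<^sup>2 * V * u x / 4))"
    by simp
  have tri: "cmod ((- a + b) - (c + e)) \<le> (cmod a + cmod b) + (cmod c + cmod e)" for a b c e
    using norm_triangle_ineq4[of "- a + b" "c + e"] norm_triangle_ineq[of "- a" b]
      norm_triangle_ineq[of c e] by simp
  have "cmod (twist s w x - of_real (1 - s\<^sup>2 / 2 * V) * w x)
      \<le> (cmod (of_real (s\<^sup>2 / 2 * r x)) + cmod ?e1) +
        (cmod (of_real (s\<^sup>2 / 2) * ?e2) + cmod (of_real (s\<^sup>2 * s\<^sup>2 * V * u x / 4)))"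
    unfolding * by (rule tri)
  also have "\<dots> \<le> (s\<^sup>2 / 2 * \<bar>r x\<bar> + s\<^sup>2 * taylor_rem s)
      + (s\<^sup>2 / 2 * (\<bar>s\<bar> * C * (\<integral>g. H g \<partial>\<mu>)) + s\<^sup>2 * s\<^sup>2 * \<bar>V\<bar> * C / 4)"
  proof (intro add_mono)
    show "cmod (of_real (s\<^sup>2 / 2 * r x)) \<le> s\<^sup>2 / 2 * \<bar>r x\<bar>"
      unfolding norm_of_real by (simp add: abs_mult)
    show "cmod ?e1 \<le> s\<^sup>2 * taylor_rem s" by (rule twist_1_approx[OF x])
    show "cmod (of_real (s\<^sup>2 / 2) * ?e2) \<le> s\<^sup>2 / 2 * (\<bar>s\<bar> * C * (\<integral>g. H g \<partial>\<mu>))"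
      unfolding norm_mult norm_of_real
      using twist_markov_approx[OF u x, of s] by (auto intro: mult_left_mono)
    have "\<bar>s\<^sup>2 * s\<^sup>2 * V\<bar> * \<bar>u x\<bar> \<le> (s\<^sup>2 * s\<^sup>2 * \<bar>V\<bar>) * C"
      using u(2)[OF x] by (intro mult_mono) (auto simp: abs_mult)
    then show "cmod (of_real (s\<^sup>2 * s\<^sup>2 * V * u x / 4)) \<le> s\<^sup>2 * s\<^sup>2 * \<bar>V\<bar> * C / 4"
      unfolding norm_of_real by (simp add: abs_mult)
  qed
  also have "\<dots> = s\<^sup>2 / 2 * \<bar>r x\<bar> + s\<^sup>2 * (taylor_rem s + \<bar>s\<bar> * C * (\<integral>g. H g \<partial>\<mu>) / 2 + s\<^sup>2 * \<bar>V\<bar> * C / 4)"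
    by (simp add: field_simps)
  finally show ?thesis .
qed

section \<open>Iterating the twisted operator\<close>

lemma norm_twist_pow_integrand:
  assumes "\<And>x. x \<in> space M \<Longrightarrow> norm (f x) \<le> C" "x \<in> space M" "g \<in> carrier G"
  shows "cmod (iexp (s * (\<sigma> g x - c)) * f (act g x)) \<le> C"
  using assms act_space by (simp add: norm_mult)

lemma integrable_twist_pow:
  assumes f: "f \<in> bdd_meas M" and x: "x \<in> space M"
  shows "integrable (conv_power G \<mu> n) (\<lambda>g. iexp (s * (\<sigma> g x - c)) * f (act g x))"
proof -
  obtain C where C: "\<And>x. x \<in> space M \<Longrightarrow> norm (f x) \<le> C" using f by (rule bdd_measE) blast
  show ?thesis
    by (rule integrable_conv_power[of _ C]) (rule norm_twist_pow_integrand[OF C x])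
qed

lemma twist_pow_0: "x \<in> space M \<Longrightarrow> twist_pow s 0 f x = f x"
  unfolding twist_pow_def by (subst integral_conv_power_0) (simp add: \<sigma>_one act_one)

lemma twist_pow_Suc:
  assumes f: "f \<in> bdd_meas M" and x: "x \<in> space M"
  shows "twist_pow s (Suc n) f x = twist_pow s n (twist s f) x"
proof -
  obtain C where C: "\<And>x. x \<in> space M \<Longrightarrow> norm (f x) \<le> C" using f by (rule bdd_measE) blast
  have "twist_pow s (Suc n) f x = (\<integral>h. (\<integral>g. iexp (s * (\<sigma> (g \<otimes> h) x - Suc n * lam))
      * f (act (g \<otimes> h) x) \<partial>\<mu>) \<partial>conv_power G \<mu> n)"
    unfolding twist_pow_def
    by (rule integral_conv_power_Suc[of _ C]) (rule norm_twist_pow_integrand[OF C x])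
  also have "\<dots> = twist_pow s n (twist s f) x"
    unfolding twist_pow_def
  proof (rule Bochner_Integration.integral_cong[OF refl])
    fix h assume "h \<in> space (conv_power G \<mu> n)"
    then have h: "h \<in> carrier G" by simp
    have "(\<integral>g. iexp (s * (\<sigma> (g \<otimes> h) x - Suc n * lam)) * f (act (g \<otimes> h) x) \<partial>\<mu>)
        = (\<integral>g. iexp (s * (\<sigma> h x - n * lam)) * (iexp (s * (\<sigma> g (act h x) - lam)) * f (act g (act h x))) \<partial>\<mu>)"
    proof (rule Bochner_Integration.integral_cong[OF refl])
      fix g assume "g \<in> space \<mu>"
      then have g: "g \<in> carrier G" by simp
      have "iexp (s * (\<sigma> (g \<otimes> h) x - Suc n * lam))
          = iexp (s * (\<sigma> h x - n * lam)) * iexp (s * (\<sigma> g (act h x) - lam))"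
        unfolding \<sigma>_mult[OF g h x] exp_add[symmetric] by (simp add: algebra_simps)
      then show "iexp (s * (\<sigma> (g \<otimes> h) x - Suc n * lam)) * f (act (g \<otimes> h) x)
          = iexp (s * (\<sigma> h x - n * lam)) * (iexp (s * (\<sigma> g (act h x) - lam)) * f (act g (act h x)))"
        by (simp only: act_mult[OF g h x] mult.assoc)
    qed
    also have "\<dots> = iexp (s * (\<sigma> h x - n * lam)) * twist s f (act h x)"
      unfolding twist_def by (rule integral_mult_right_zero)
    finally show "(\<integral>g. iexp (s * (\<sigma> (g \<otimes> h) x - Suc n * lam)) * f (act (g \<otimes> h) x) \<partial>\<mu>)
        = iexp (s * (\<sigma> h x - n * lam)) * twist s f (act h x)" .
  qed
  finally show ?thesis .
qed

lemma twist_pow_add: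
  "f \<in> bdd_meas M \<Longrightarrow> g \<in> bdd_meas M \<Longrightarrow> x \<in> space M \<Longrightarrow>
    twist_pow s n (\<lambda>x. f x + g x) x = twist_pow s n f x + twist_pow s n g x"
  unfolding twist_pow_def distrib_left
  by (rule Bochner_Integration.integral_add) (rule integrable_twist_pow; assumption)+

lemma twist_pow_mult: "twist_pow s n (\<lambda>x. c * f x) x = c * twist_pow s n f x"
  unfolding twist_pow_def mult.left_commute[of _ c] by (rule integral_mult_right_zero)

lemma norm_twist_pow_le:
  assumes f: "f \<in> bdd_meas M" and x: "x \<in> space M"
  shows "cmod (twist_pow s n f x) \<le> (markov ^^ n) (\<lambda>x. cmod (f x)) x"
proof -
  have "cmod (twist_pow s n f x)
      \<le> (\<integral>g. cmod (iexp (s * (\<sigma> g x - n * lam)) * f (act g x)) \<partial>conv_power G \<mu> n)"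
    unfolding twist_pow_def by (rule integral_norm_bound)
  also have "\<dots> = (\<integral>g. cmod (f (act g x)) \<partial>conv_power G \<mu> n)"
    by (simp add: norm_mult)
  also have "\<dots> = (markov ^^ n) (\<lambda>x. cmod (f x)) x"
    by (rule markov_funpow_eq[symmetric]) (use f x in auto)
  finally show ?thesis .
qed

text \<open>Telescoping. The twisted powers are dominated by the powers of the Markov operator, so the one-step
errors add up to an ergodic sum.\<close>

lemma twist_pow_almost_eigen:
  assumes w: "w \<in> bdd_meas M" and x: "x \<in> space M" and q: "cmod q \<le> 1"
  shows "cmod (twist_pow s n w x - q ^ n * w x)
    \<le> ergodic_sum (\<lambda>x. cmod (twist s w x - q * w x)) n x"
proof (induction n)
  case 0 then show ?case by (simp add: twist_pow_0 x ergodic_sum_def)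
next
  case (Suc n)
  let ?E = "\<lambda>x. twist s w x - q * w x"
  have E: "?E \<in> bdd_meas M"
    using w twist_bdd[OF w] by (intro bdd_meas_diff bdd_meas_mult) auto
  have "twist_pow s (Suc n) w x = twist_pow s n (\<lambda>x. q * w x + ?E x) x"
    by (simp add: twist_pow_Suc[OF w x])
  also have "\<dots> = twist_pow s n (\<lambda>x. q * w x) x + twist_pow s n ?E x"
    by (rule twist_pow_add[OF _ E x]) (use w in \<open>intro bdd_meas_mult; simp\<close>)
  also have "twist_pow s n (\<lambda>x. q * w x) x = q * twist_pow s n w x" by (rule twist_pow_mult)
  finally have "twist_pow s (Suc n) w x - q ^ Suc n * w x
      = q * (twist_pow s n w x - q ^ n * w x) + twist_pow s n ?E x"
    by (simp add: algebra_simps)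
  also have "cmod \<dots> \<le> cmod (q * (twist_pow s n w x - q ^ n * w x)) + cmod (twist_pow s n ?E x)"
    by (rule norm_triangle_ineq)
  also have "\<dots> \<le> cmod (twist_pow s n w x - q ^ n * w x) + (markov ^^ n) (\<lambda>x. cmod (?E x)) x"
    using q by (intro add_mono norm_twist_pow_le[OF E x])
      (auto simp: norm_mult intro!: mult_left_le_one_le)
  also have "\<dots> \<le> ergodic_sum (\<lambda>x. cmod (?E x)) n x + (markov ^^ n) (\<lambda>x. cmod (?E x)) x"
    using Suc by simp
  finally show ?case by (simp add: ergodic_sum_def)
qed

lemma twist_pow_bound:
  fixes V :: real
  assumes u: "u \<in> bdd_meas M" "\<And>x. x \<in> space M \<Longrightarrow> \<bar>u x\<bar> \<le> C" and r: "r \<in> bdd_meas M"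
    and eq: "\<And>x. x \<in> space M \<Longrightarrow> step_var x = V + u x - markov u x + r x"
    and x: "x \<in> space M" and small: "\<bar>1 - s\<^sup>2 / 2 * V\<bar> \<le> 1"
  shows "cmod (twist_pow s n (\<lambda>_. 1) x - of_real ((1 - s\<^sup>2 / 2 * V) ^ n))
    \<le> s\<^sup>2 / 2 * ergodic_sum (\<lambda>x. \<bar>r x\<bar>) n x
      + n * s\<^sup>2 * (taylor_rem s + \<bar>s\<bar> * C * (\<integral>g. H g \<partial>\<mu>) / 2 + s\<^sup>2 * \<bar>V\<bar> * C / 4) + s\<^sup>2 * C"
proof -
  define w where "w x = complex_of_real (1 - s\<^sup>2 / 2 * u x)" for x
  define q where "q = complex_of_real (1 - s\<^sup>2 / 2 * V)"
  define K where "K = s\<^sup>2 * (taylor_rem s + \<bar>s\<bar> * C * (\<integral>g. H g \<partial>\<mu>) / 2 + s\<^sup>2 * \<bar>V\<bar> * C / 4)"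
  have su: "(\<lambda>x. s\<^sup>2 / 2 * u x) \<in> bdd_meas M" using u(1) by (intro bdd_meas_mult) auto
  have w: "w \<in> bdd_meas M"
    unfolding w_def[abs_def] by (intro bdd_meas_of_real bdd_meas_diff su) auto
  have su': "(\<lambda>x. complex_of_real (s\<^sup>2 / 2 * u x)) \<in> bdd_meas M" using su by (rule bdd_meas_of_real)
  have q: "cmod q \<le> 1" using small unfolding q_def norm_of_real .
  have E: "(\<lambda>x. cmod (twist s w x - q * w x)) \<in> bdd_meas M"
    using w twist_bdd[OF w] by (intro bdd_meas_norm bdd_meas_diff bdd_meas_mult) auto
  have "cmod (twist_pow s n w x - q ^ n * w x) \<le> ergodic_sum (\<lambda>x. cmod (twist s w x - q * w x)) n x"
    by (rule twist_pow_almost_eigen[OF w x q])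
  also have "\<dots> \<le> (\<Sum>k<n. s\<^sup>2 / 2 * (markov ^^ k) (\<lambda>x. \<bar>r x\<bar>) x + K)"
    unfolding ergodic_sum_def
  proof (intro sum_mono markov_funpow_le_affine E x)
    show "cmod (twist s w y - q * w y) \<le> s\<^sup>2 / 2 * \<bar>r y\<bar> + K" if "y \<in> space M" for y
      unfolding K_def q_def w_def[abs_def] by (rule twist_corrector[where r=r, OF u that eq[OF that]])
  qed (use r in auto)
  also have "\<dots> = s\<^sup>2 / 2 * ergodic_sum (\<lambda>x. \<bar>r x\<bar>) n x + n * K"
    by (simp add: ergodic_sum_def sum.distrib sum_distrib_left)
  finally have 1: "cmod (twist_pow s n w x - q ^ n * w x)
      \<le> s\<^sup>2 / 2 * ergodic_sum (\<lambda>x. \<bar>r x\<bar>) n x + n * K" .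
  \<comment> \<open>Passing from the constant \<open>1\<close> to \<open>w\<close>, before and after applying the twisted power, costs at
    most \<open>s\<^sup>2 C\<close> in total.\<close>
  have bound: "cmod (of_real (s\<^sup>2 / 2 * u y)) \<le> s\<^sup>2 / 2 * C" if "y \<in> space M" for y
    unfolding norm_of_real using u(2)[OF that] by (auto simp: abs_mult intro: mult_left_mono)
  have "twist_pow s n (\<lambda>_. 1) x = twist_pow s n (\<lambda>x. w x + of_real (s\<^sup>2 / 2 * u x)) x"
    by (simp add: w_def)
  also have "\<dots> = twist_pow s n w x + twist_pow s n (\<lambda>x. of_real (s\<^sup>2 / 2 * u x)) x"
    by (rule twist_pow_add[OF w su' x])
  finally have 2: "twist_pow s n (\<lambda>_. 1) x - q ^ n = (twist_pow s n w x - q ^ n * w x)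
      + (twist_pow s n (\<lambda>x. of_real (s\<^sup>2 / 2 * u x)) x - q ^ n * of_real (s\<^sup>2 / 2 * u x))"
    by (simp add: w_def algebra_simps)
  have "cmod (twist_pow s n (\<lambda>x. of_real (s\<^sup>2 / 2 * u x)) x)
      \<le> (markov ^^ n) (\<lambda>x. cmod (of_real (s\<^sup>2 / 2 * u x))) x"
    by (rule norm_twist_pow_le[OF su' x])
  also have "\<dots> \<le> s\<^sup>2 / 2 * C"
  proof -
    have "norm ((markov ^^ n) (\<lambda>x. cmod (of_real (s\<^sup>2 / 2 * u x))) x) \<le> s\<^sup>2 / 2 * C"
      by (rule norm_markov_funpow_le[OF bdd_meas_norm[OF su'] _ x])
         (simp only: real_norm_def abs_norm_cancel bound)
    then show ?thesis unfolding real_norm_def by (rule abs_le_D1)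
  qed
  finally have 3: "cmod (twist_pow s n (\<lambda>x. of_real (s\<^sup>2 / 2 * u x)) x) \<le> s\<^sup>2 / 2 * C" .
  have "cmod (q ^ n * of_real (s\<^sup>2 / 2 * u x)) \<le> 1 * (s\<^sup>2 / 2 * C)"
    unfolding norm_mult[of "q ^ n"] norm_power
    by (intro mult_mono bound x power_le_one q) auto
  then have 4: "cmod (q ^ n * of_real (s\<^sup>2 / 2 * u x)) \<le> s\<^sup>2 / 2 * C" by simp
  have "cmod (twist_pow s n (\<lambda>_. 1) x - q ^ n)
      \<le> (s\<^sup>2 / 2 * ergodic_sum (\<lambda>x. \<bar>r x\<bar>) n x + n * K) + (s\<^sup>2 / 2 * C + s\<^sup>2 / 2 * C)"
    unfolding 2
    by (intro order_trans[OF norm_triangle_ineq] add_mono 1 order_trans[OF norm_triangle_ineq4] 3 4)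
  then show ?thesis by (simp add: K_def q_def algebra_simps)
qed

end

section \<open>The central limit theorem\<close>

text \<open>A drift cocycle over an ergodic stationary measure.\<close>

locale ergodic_cocycle = drift_cocycle G \<mu> M act \<sigma> lam H + ergodic_action \<mu> M act \<nu>
  for G (structure) and \<mu> M act \<sigma> lam H \<nu>
begin

text \<open>An explicit approximate solution of the Poisson equation: \<open>u - P u\<close> is the difference of
\<open>step_var\<close> and its \<open>m\<close>-th ergodic average. It holds for every constant \<open>V\<close>.\<close>

lemma poisson_decomposition:
  assumes "m > 0" "x \<in> space M"
  defines "u \<equiv> \<lambda>x. (\<Sum>k<m. ergodic_sum step_var k x) / m"
  shows "step_var x = V + u x - markov u x + (ergodic_sum step_var m x / m - V)"
proof -
  have "markov u x = (\<Sum>k<m. markov (ergodic_sum step_var k) x) / m"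
    unfolding u_def markov_divide
    by (subst markov_sum) (use assms ergodic_sum_bdd_meas[OF step_var_bdd] in auto)
  moreover have "markov (ergodic_sum step_var k) x = ergodic_sum step_var k x + (markov ^^ k) step_var x - step_var x" for k
    using markov_ergodic_sum[OF step_var_bdd assms(2), of k] by (simp add: ergodic_sum_def)
  ultimately have "markov u x = u x + ergodic_sum step_var m x / m - step_var x"
    using assms(1)
    by (simp add: u_def sum.distrib sum_subtractf ergodic_sum_def[of step_var m] add_divide_distrib diff_divide_distrib)
  then show ?thesis by simp
qed

text \<open>The exceptional null set depends neither on \<open>t\<close> nor on \<open>n\<close>: it only has to carry the ergodic theorem
for the countably many functions \<open>\<bar>r m\<bar>\<close>.\<close>

theorem char_limit:
  defines "V \<equiv> (\<integral>x. step_var x \<partial>\<nu>)"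
  shows "AE x in \<nu>. \<forall>t. (\<lambda>n. twist_pow (t / sqrt n) n (\<lambda>_. 1) x) \<longlonglongrightarrow> of_real (exp (- (t\<^sup>2 * V / 2)))"
proof -
  \<comment> \<open>The averages are taken over \<open>Suc m\<close> terms so that no division by zero occurs.\<close>
  define r where "r m x = ergodic_sum step_var (Suc m) x / Suc m - V" for m x
  define u where "u m x = (\<Sum>k<Suc m. ergodic_sum step_var k x) / Suc m" for m x
  have V: "0 \<le> V" unfolding V_def step_var_def by (intro integral_nonneg_AE AE_I2) simp
  have r_bdd: "r m \<in> bdd_meas M" for m
    unfolding r_def[abs_def]
    by (intro bdd_meas_diff bdd_meas_divide ergodic_sum_bdd_meas step_var_bdd bdd_meas_const)
  have u_bdd: "u m \<in> bdd_meas M" for m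
    unfolding u_def[abs_def]
    by (intro bdd_meas_divide bdd_meas_sum ergodic_sum_bdd_meas step_var_bdd)
  have eq: "step_var x = V + u m x - markov (u m) x + r m x" if "x \<in> space M" for m x
    unfolding u_def[abs_def] r_def by (rule poisson_decomposition[OF _ that]) simp
  have r_L1: "(\<lambda>m. \<integral>x. \<bar>r m x\<bar> \<partial>\<nu>) \<longlonglongrightarrow> 0"
  proof -
    obtain C where C: "0 \<le> C" "\<And>x. x \<in> space M \<Longrightarrow> \<bar>step_var x\<bar> \<le> C"
      using step_var_bdd by (rule bdd_measE) (auto simp: real_norm_def)
    have "(\<lambda>m. \<integral>x. \<bar>r m x\<bar> \<partial>\<nu>) \<longlonglongrightarrow> (\<integral>x. 0 \<partial>\<nu>)"
    proof (rule integral_dominated_convergence[where w="\<lambda>_. C + \<bar>V\<bar>"])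
      show "AE x in \<nu>. (\<lambda>m. \<bar>r m x\<bar>) \<longlonglongrightarrow> 0"
        using pointwise_ergodic[OF step_var_bdd]
      proof eventually_elim
        fix x assume "(\<lambda>n. ergodic_sum step_var n x / real n) \<longlonglongrightarrow> (\<integral>x. step_var x \<partial>\<nu>)"
        then have "(\<lambda>n. ergodic_sum step_var (Suc n) x / real (Suc n)) \<longlonglongrightarrow> V"
          unfolding V_def by (rule LIMSEQ_Suc)
        then have "(\<lambda>m. r m x) \<longlonglongrightarrow> V - V" unfolding r_def by (intro tendsto_diff tendsto_const)
        then show "(\<lambda>m. \<bar>r m x\<bar>) \<longlonglongrightarrow> 0" by (intro tendsto_rabs_zero) simp
      qed
      show "AE x in \<nu>. norm \<bar>r m x\<bar> \<le> C + \<bar>V\<bar>" for m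
      proof (rule AE_I2)
        fix x assume "x \<in> space \<nu>"
        then have "\<bar>ergodic_sum step_var (Suc m) x\<bar> \<le> Suc m * C"
          by (intro ergodic_sum_bound step_var_bdd C) auto
        then have "\<bar>ergodic_sum step_var (Suc m) x / Suc m\<bar> \<le> C"
          unfolding abs_divide by (simp add: divide_le_eq mult.commute)
        then show "norm \<bar>r m x\<bar> \<le> C + \<bar>V\<bar>"
          unfolding r_def real_norm_def abs_abs by linarith
      qed
    qed (use r_bdd bdd_measD in auto)
    then show ?thesis by simp
  qed
  have "AE x in \<nu>. \<forall>m. (\<lambda>n. ergodic_sum (\<lambda>x. \<bar>r m x\<bar>) n x / n) \<longlonglongrightarrow> (\<integral>x. \<bar>r m x\<bar> \<partial>\<nu>)"
    unfolding AE_all_countable by (intro allI pointwise_ergodic bdd_meas_abs r_bdd)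
  then show ?thesis
    using AE_space
  proof eventually_elim
    case (elim x)
    then have x: "x \<in> space M" by simp
    show ?case
    proof
      fix t :: real
      define s where "s n = t / sqrt (real n)" for n :: nat
      have s0: "s \<longlonglongrightarrow> 0"
        unfolding s_def by real_asymp
      have s2: "real n * (s n)\<^sup>2 = t\<^sup>2" if "n > 0" for n
        using that by (simp add: s_def power_divide)
      have qn: "(1 - (s n)\<^sup>2 / 2 * V) = 1 + (- (t\<^sup>2 * V / 2)) / real n" for n
        by (cases "n = 0") (simp_all add: s_def power_divide)
      have small: "\<forall>\<^sub>F n in sequentially. \<bar>1 - (s n)\<^sup>2 / 2 * V\<bar> \<le> 1"
      proof -
        have "(\<lambda>n. (s n)\<^sup>2 / 2 * V) \<longlonglongrightarrow> 0\<^sup>2 / 2 * V" by (intro tendsto_intros s0) auto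
        then have "\<forall>\<^sub>F n in sequentially. (s n)\<^sup>2 / 2 * V < 1"
          by (rule order_tendstoD) auto
        then show ?thesis
        proof eventually_elim
          case (elim n)
          have "0 \<le> (s n)\<^sup>2 / 2 * V" using V by simp
          with elim show ?case by linarith
        qed
      qed
      let ?d = "\<lambda>n. cmod (twist_pow (s n) n (\<lambda>_. 1) x - of_real ((1 - (s n)\<^sup>2 / 2 * V) ^ n))"
      have "?d \<longlonglongrightarrow> 0"
      proof (rule order_tendstoI)
        fix e :: real assume e: "0 < e"
        have "(\<lambda>m. t\<^sup>2 / 2 * (\<integral>x. \<bar>r m x\<bar> \<partial>\<nu>)) \<longlonglongrightarrow> t\<^sup>2 / 2 * 0"
          by (intro tendsto_intros r_L1)
        then have "\<forall>\<^sub>F m in sequentially. t\<^sup>2 / 2 * (\<integral>x. \<bar>r m x\<bar> \<partial>\<nu>) < e"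
          using e by (intro order_tendstoD) auto
        then obtain m where m: "t\<^sup>2 / 2 * (\<integral>x. \<bar>r m x\<bar> \<partial>\<nu>) < e"
          by (auto simp: eventually_sequentially)
        obtain C where C: "0 \<le> C" "\<And>x. x \<in> space M \<Longrightarrow> \<bar>u m x\<bar> \<le> C"
          using u_bdd by (rule bdd_measE) (auto simp: real_norm_def)
        define b where "b n = t\<^sup>2 / 2 * (ergodic_sum (\<lambda>x. \<bar>r m x\<bar>) n x / n)
          + t\<^sup>2 * (taylor_rem (s n) + \<bar>s n\<bar> * C * (\<integral>g. H g \<partial>\<mu>) / 2 + (s n)\<^sup>2 * \<bar>V\<bar> * C / 4)
          + (s n)\<^sup>2 * C" for n
        have "b \<longlonglongrightarrow> t\<^sup>2 / 2 * (\<integral>x. \<bar>r m x\<bar> \<partial>\<nu>)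
          + t\<^sup>2 * (0 + \<bar>0\<bar> * C * (\<integral>g. H g \<partial>\<mu>) / 2 + 0\<^sup>2 * \<bar>V\<bar> * C / 4) + 0\<^sup>2 * C"
          unfolding b_def using elim(1)
          by (intro tendsto_intros s0 taylor_rem_tendsto_0) auto
        then have "\<forall>\<^sub>F n in sequentially. b n < e"
          using m by (intro order_tendstoD) auto
        with small eventually_gt_at_top[of 0] show "\<forall>\<^sub>F n in sequentially. ?d n < e"
        proof eventually_elim
          case (elim n)
          have "?d n \<le> (s n)\<^sup>2 / 2 * ergodic_sum (\<lambda>x. \<bar>r m x\<bar>) n x
            + n * (s n)\<^sup>2 * (taylor_rem (s n) + \<bar>s n\<bar> * C * (\<integral>g. H g \<partial>\<mu>) / 2 + (s n)\<^sup>2 * \<bar>V\<bar> * C / 4)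
            + (s n)\<^sup>2 * C"
            by (rule twist_pow_bound[OF u_bdd C(2) r_bdd eq x elim(1)])
          also have "\<dots> = b n"
            unfolding b_def s2[OF elim(2)] using elim(2)
            by (simp add: s_def power_divide)
          finally show ?case using elim by simp
        qed
      qed (auto intro!: always_eventually intro: less_le_trans[OF _ norm_ge_zero])
      then have "(\<lambda>n. twist_pow (s n) n (\<lambda>_. 1) x - of_real ((1 - (s n)\<^sup>2 / 2 * V) ^ n)) \<longlonglongrightarrow> 0"
        by (rule tendsto_norm_zero_cancel)
      moreover have "(\<lambda>n. complex_of_real ((1 - (s n)\<^sup>2 / 2 * V) ^ n)) \<longlonglongrightarrow> of_real (exp (- (t\<^sup>2 * V / 2)))"
        unfolding qn by (intro tendsto_of_real tendsto_exp_limit_sequentially)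
      ultimately have "(\<lambda>n. (twist_pow (s n) n (\<lambda>_. 1) x - of_real ((1 - (s n)\<^sup>2 / 2 * V) ^ n))
          + of_real ((1 - (s n)\<^sup>2 / 2 * V) ^ n)) \<longlonglongrightarrow> 0 + of_real (exp (- (t\<^sup>2 * V / 2)))"
        by (rule tendsto_add)
      then show "(\<lambda>n. twist_pow (t / sqrt n) n (\<lambda>_. 1) x) \<longlonglongrightarrow> of_real (exp (- (t\<^sup>2 * V / 2)))"
        by (simp add: s_def)
    qed
  qed
qed

lemma integral_step_var:
  "(\<integral>x. step_var x \<partial>\<nu>) = cocycle_variance \<mu> \<nu> \<sigma> lam"
proof -
  have i: "integrable (\<mu> \<Otimes>\<^sub>M \<nu>) (\<lambda>(g, x). (\<sigma> g x - lam)\<^sup>2)"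
  proof (rule Bochner_Integration.integrable_bound)
    show "integrable (\<mu> \<Otimes>\<^sub>M \<nu>) (\<lambda>p. (H (fst p))\<^sup>2)"
      using integrable_distr[of fst "\<mu> \<Otimes>\<^sub>M \<nu>" \<mu> "\<lambda>g. (H g)\<^sup>2"] H_sq
      by (simp add: \<nu>.distr_pair_fst)
    show "AE p in \<mu> \<Otimes>\<^sub>M \<nu>. norm ((\<lambda>(g, x). (\<sigma> g x - lam)\<^sup>2) p) \<le> norm ((H (fst p))\<^sup>2)"
      by (rule AE_I2) (auto simp: space_pair_measure intro!: \<sigma>_sq_le)
  qed measurable
  show ?thesis
    unfolding step_var_def cocycle_variance_def by (rule integral_snd[OF i])
qed

end

lemma char_centered_gaussian:
  assumes V: "0 \<le> V"
  shows "real_distribution (centered_gaussian V)"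
    and "char (centered_gaussian V) t = of_real (exp (- (t\<^sup>2 * V / 2)))"
proof -
  have "real_distribution (centered_gaussian V) \<and> char (centered_gaussian V) t = of_real (exp (- (t\<^sup>2 * V / 2)))"
  proof (cases "V = 0")
    case True
    have "real_distribution (return borel 0)"
      by (simp add: real_distribution_def real_distribution_axioms_def prob_space_return)
    then show ?thesis
      using True by (simp add: centered_gaussian_def char_def integral_return)
  next
    case False
    with V have sV: "sqrt V > 0" by simp
    interpret n: prob_space std_normal_distribution by (rule prob_space_normal_density) simp
    have "distributed std_normal_distribution lborel (\<lambda>x. x) std_normal_density"
      by (simp add: distributed_def distr_id2)
    from n.normal_density_affine[OF this, of "sqrt V" 0] sV
    have "distributed std_normal_distribution lborel (\<lambda>x. sqrt V * x) (normal_density 0 (sqrt V))"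
      by simp
    then have eq: "centered_gaussian V = distr std_normal_distribution lborel (\<lambda>x. sqrt V * x)"
      using False by (simp add: centered_gaussian_def distributed_def)
    have "char (centered_gaussian V) t = char std_normal_distribution (t * sqrt V)"
      unfolding char_def eq by (subst integral_distr) (auto simp: mult_ac)
    also have "\<dots> = of_real (exp (- (t\<^sup>2 * V / 2)))"
      using V by (simp add: char_std_normal_distribution power_mult_distrib)
    finally have "char (centered_gaussian V) t = of_real (exp (- (t\<^sup>2 * V / 2)))" .
    moreover have "real_distribution (centered_gaussian V)"
      using False sV prob_space_normal_density[OF sV]
      by (simp add: centered_gaussian_def real_distribution_def real_distribution_axioms_def)
    ultimately show ?thesis by blast
  qed
  then show "real_distribution (centered_gaussian V)"
    "char (centered_gaussian V) t = of_real (exp (- (t\<^sup>2 * V / 2)))" by auto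
qed

lemma bounded_of_compact_support:
  fixes F :: "real \<Rightarrow> real"
  assumes F: "continuous_on UNIV F" and supp: "compact (closure {t. F t \<noteq> 0})"
  shows "\<exists>B. \<forall>t. \<bar>F t\<bar> \<le> B"
proof -
  have "compact (F ` closure {t. F t \<noteq> 0})"
    by (rule compact_continuous_image[OF continuous_on_subset[OF F] supp]) simp
  then have "bounded (F ` closure {t. F t \<noteq> 0})" by (rule compact_imp_bounded)
  then obtain B where B: "\<forall>y\<in>F ` closure {t. F t \<noteq> 0}. norm y \<le> B"
    unfolding bounded_iff by (rule exE)
  have "\<bar>F t\<bar> \<le> max 0 B" for t
  proof (cases "F t = 0")
    case False
    then have "t \<in> closure {t. F t \<noteq> 0}"
      by (intro subsetD[OF closure_subset]) simp
    then have "norm (F t) \<le> B" by (intro bspec[OF B] imageI)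
    then show ?thesis by simp
  qed simp
  then show ?thesis by blast
qed

text \<open>The theorem is stated for any \<open>\<beta>\<close> at bounded distance from \<open>\<sigma>\<close>; the scaling by \<open>sqrt n\<close> removes the
difference.\<close>

theorem (in ergodic_cocycle) central_limit:
  assumes close: "\<And>g x. g \<in> carrier G \<Longrightarrow> x \<in> space M \<Longrightarrow> \<bar>\<beta> g x - \<sigma> g x\<bar> \<le> D"
  shows "AE x in \<nu>. \<forall>F :: real \<Rightarrow> real.
    continuous_on UNIV F \<and> compact (closure {t. F t \<noteq> 0}) \<longrightarrow>
    (\<lambda>n. \<integral>g. F ((\<beta> g x - real n * lam) / sqrt (real n)) \<partial>conv_power G \<mu> n)
      \<longlonglongrightarrow> (\<integral>t. F t \<partial>centered_gaussian (cocycle_variance \<mu> \<nu> \<sigma> lam))"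
  using char_limit AE_space
proof eventually_elim
  case (elim x)
  define V where "V = cocycle_variance \<mu> \<nu> \<sigma> lam"
  have V0: "0 \<le> V" unfolding V_def integral_step_var[symmetric] step_var_def by (intro integral_nonneg_AE AE_I2) simp
  have x: "x \<in> space M" using elim by simp
  have lim: "(\<lambda>n. twist_pow (t / sqrt n) n (\<lambda>_. 1) x) \<longlonglongrightarrow> of_real (exp (- (t\<^sup>2 * V / 2)))" for t
    using elim(1) unfolding V_def integral_step_var by blast
  define X where "X n g = (\<beta> g x - real n * lam) / sqrt (real n)" for n g
  define N where "N n = distr (conv_power G \<mu> n) borel (X n)" for n
  have X[measurable]: "X n \<in> borel_measurable (conv_power G \<mu> k)" for n k
    by (rule borel_measurable_discrete[OF sets_conv_power])
  have N: "real_distribution (N n)" for n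
  proof -
    interpret c: prob_space "conv_power G \<mu> n" by (rule prob_space_conv_power)
    show ?thesis
      by (simp add: N_def real_distribution_def real_distribution_axioms_def c.prob_space_distr)
  qed
  have char_N: "(\<lambda>n. char (N n) t) \<longlonglongrightarrow> of_real (exp (- (t\<^sup>2 * V / 2)))" for t
  proof -
    let ?tw = "\<lambda>n. twist_pow (t / sqrt n) n (\<lambda>_. 1) x"
    have bound: "cmod (char (N n) t - ?tw n) \<le> \<bar>t\<bar> * D / sqrt n" for n
    proof -
      interpret c: prob_space "conv_power G \<mu> n" by (rule prob_space_conv_power)
      let ?s = "t / sqrt n"
      have i1: "integrable (conv_power G \<mu> n) (\<lambda>g. iexp (t * X n g))"
        by (rule integrable_conv_power[of _ 1]) simp
      have i2: "integrable (conv_power G \<mu> n) (\<lambda>g. iexp (?s * (\<sigma> g x - n * lam)) * 1)"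
        by (rule integrable_conv_power[of _ 1]) simp
      have "char (N n) t = (\<integral>g. iexp (t * X n g) \<partial>conv_power G \<mu> n)"
        unfolding N_def char_def by (subst integral_distr) auto
      then have "char (N n) t - ?tw n
          = (\<integral>g. iexp (t * X n g) - iexp (?s * (\<sigma> g x - n * lam)) * 1 \<partial>conv_power G \<mu> n)"
        unfolding twist_pow_def by (simp only: Bochner_Integration.integral_diff[OF i1 i2])
      also have "cmod \<dots> \<le> (\<integral>g. cmod (iexp (t * X n g) - iexp (?s * (\<sigma> g x - n * lam)) * 1) \<partial>conv_power G \<mu> n)"
        by (rule integral_norm_bound)
      also have "\<dots> \<le> (\<integral>g. \<bar>t\<bar> * D / sqrt n \<partial>conv_power G \<mu> n)"
      proof (rule integral_mono)
        fix g assume "g \<in> space (conv_power G \<mu> n)"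
        then have g: "\<bar>\<beta> g x - \<sigma> g x\<bar> \<le> D" using close x by simp
        have "t * X n g = ?s * ((\<sigma> g x - n * lam) + (\<beta> g x - \<sigma> g x))"
          unfolding X_def by simp
        also have "\<dots> = ?s * (\<sigma> g x - n * lam) + ?s * (\<beta> g x - \<sigma> g x)"
          by (rule distrib_left)
        finally have tX: "t * X n g = ?s * (\<sigma> g x - n * lam) + ?s * (\<beta> g x - \<sigma> g x)" .
        have iexp_add: "iexp (a + b) = iexp a * iexp b" for a b :: real
          by (simp add: distrib_left exp_add)
        have "iexp (t * X n g) - iexp (?s * (\<sigma> g x - n * lam)) * 1
            = iexp (?s * (\<sigma> g x - n * lam)) * (iexp (?s * (\<beta> g x - \<sigma> g x)) - 1)"
          unfolding tX iexp_add by (rule right_diff_distrib[symmetric])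
        then have "cmod (iexp (t * X n g) - iexp (?s * (\<sigma> g x - n * lam)) * 1)
            = cmod (iexp (?s * (\<beta> g x - \<sigma> g x)) - 1)"
          by (simp only: norm_mult norm_exp_i_times mult_1_left)
        also have "\<dots> \<le> \<bar>?s * (\<beta> g x - \<sigma> g x)\<bar>" by (rule norm_iexp_sub_1)
        also have "\<dots> \<le> \<bar>?s\<bar> * D" unfolding abs_mult using g by (intro mult_left_mono) auto
        also have "\<dots> = \<bar>t\<bar> * D / sqrt n" by simp
        finally show "cmod (iexp (t * X n g) - iexp (?s * (\<sigma> g x - n * lam)) * 1) \<le> \<bar>t\<bar> * D / sqrt n" .
      qed (use i1 i2 in auto)
      also have "\<dots> = \<bar>t\<bar> * D / sqrt n" using c.prob_space by simp
      finally show ?thesis .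
    qed
    have "(\<lambda>n. 1 / sqrt (real n)) \<longlonglongrightarrow> 0" by real_asymp
    from tendsto_mult_right_zero[OF this, of "\<bar>t\<bar> * D"]
    have "(\<lambda>n. \<bar>t\<bar> * D / sqrt (real n)) \<longlonglongrightarrow> 0" by simp
    then have "(\<lambda>n. char (N n) t - ?tw n) \<longlonglongrightarrow> 0"
      by (rule Lim_null_comparison[rotated]) (use bound in auto)
    from tendsto_add[OF this lim[of t]] show ?thesis by simp
  qed
  have weak: "weak_conv_m N (centered_gaussian V)"
    by (rule levy_continuity[OF N char_centered_gaussian(1)[OF V0]])
       (simp only: char_centered_gaussian(2)[OF V0] char_N)
  show ?case
  proof (intro allI impI, elim conjE)
    fix F :: "real \<Rightarrow> real"
    assume F: "continuous_on UNIV F" "compact (closure {t. F t \<noteq> 0})"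
    obtain B where B: "\<forall>t. \<bar>F t\<bar> \<le> B"
      using bounded_of_compact_support[OF F] by (rule exE)
    have cont: "isCont F t" for t using F(1) by (simp add: continuous_on_eq_continuous_at)
    have F_meas[measurable]: "F \<in> borel_measurable borel"
      using F(1) by (rule borel_measurable_continuous_onI)
    have "(\<lambda>n. integral\<^sup>L (N n) F) \<longlonglongrightarrow> integral\<^sup>L (centered_gaussian V) F"
      by (rule weak_conv_imp_integral_bdd_continuous_conv[OF N char_centered_gaussian(1)[OF V0] weak cont, of B])
         (simp add: B)
    moreover have "integral\<^sup>L (N n) F = (\<integral>g. F (X n g) \<partial>conv_power G \<mu> n)" for n
      unfolding N_def by (rule integral_distr) measurable
    ultimately show "(\<lambda>n. \<integral>g. F ((\<beta> g x - real n * lam) / sqrt (real n)) \<partial>conv_power G \<mu> n)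
        \<longlonglongrightarrow> (\<integral>t. F t \<partial>centered_gaussian (cocycle_variance \<mu> \<nu> \<sigma> lam))"
      by (simp add: X_def V_def)
  qed
qed

section \<open>Horofunctions\<close>

lemma asymmetric_metric_reverse:
  "asymmetric_metric d \<Longrightarrow> asymmetric_metric (reverse d)"
  unfolding asymmetric_metric_def reverse_def by (metis add.commute)

lemma cont_functions_reverse [simp]: "cont_functions (reverse d) = cont_functions d"
  by (simp add: cont_functions_def)

lemma space_borel_on [simp]: "space (borel_on d Y) = Y"
  by (simp add: borel_on_def space_measure_of_conv)

lemma sets_borel_on_openin:
  "openin (subtopology (ucc_topology d) Y) U \<Longrightarrow> U \<in> sets (borel_on d Y)"
  unfolding borel_on_def
  by (rule in_measure_of) (auto dest: openin_imp_subset)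

lemma sets_borel_on_open:
  assumes "ucc_open d U" shows "U \<inter> Y \<in> sets (borel_on d Y)"
  using assms by (intro sets_borel_on_openin) (auto simp: openin_subtopology openin_ucc_topology)

context asymmetric_metric
begin

interpretation S: Metric_space UNIV "sym_dist d" by (rule Metric_space_sym_dist)

lemma ucc_open_eval:
  assumes "open U" shows "ucc_open d {h \<in> cont_functions d. h z \<in> U}"
  unfolding ucc_open_def
proof (intro conjI ballI)
  fix f assume f: "f \<in> {h \<in> cont_functions d. h z \<in> U}"
  then obtain e where e: "e > 0" "\<And>y. \<bar>y - f z\<bar> < e \<Longrightarrow> y \<in> U"
    using assms by (auto simp: open_real)
  have "compactin (sym_topology d) {z}" by (simp add: finite_imp_compactin)
  with e show "\<exists>K \<epsilon>. compactin (sym_topology d) K \<and> \<epsilon> > 0 \<and>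
      {g \<in> cont_functions d. \<forall>x\<in>K. \<bar>g x - f x\<bar> < \<epsilon>} \<subseteq> {h \<in> cont_functions d. h z \<in> U}"
    by (intro exI[of _ "{z}"] exI[of _ e]) auto
qed auto

lemma measurable_eval:
  assumes Y: "Y \<subseteq> cont_functions d" shows "(\<lambda>h. h z) \<in> borel_measurable (borel_on d Y)"
proof (rule borel_measurableI)
  fix U :: "real set" assume "open U"
  have "(\<lambda>h. h z) -` U \<inter> space (borel_on d Y) = {h \<in> cont_functions d. h z \<in> U} \<inter> Y"
    using Y by auto
  also have "\<dots> \<in> sets (borel_on d Y)" by (rule sets_borel_on_open[OF ucc_open_eval]) fact
  finally show "(\<lambda>h. h z) -` U \<inter> space (borel_on d Y) \<in> sets (borel_on d Y)" .
qed

lemma horoclosure_subset: "horoclosure d x\<^sub>0 \<subseteq> cont_functions d"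
  unfolding horoclosure_def using closure_of_subset_topspace[of "ucc_topology d"]
  by (simp add: topspace_ucc_topology)

text \<open>Evaluation at finitely many points is continuous, so the pointwise relations between values of the
functions \<open>horofun d x\<^sub>0 z\<close> pass to the closure.\<close>

lemma horoclosure_approx:
  assumes h: "h \<in> horoclosure d x\<^sub>0" and "finite K" "e > 0"
  shows "\<exists>z. \<forall>x\<in>K. \<bar>horofun d x\<^sub>0 z x - h x\<bar> < e"
proof -
  have "{g \<in> cont_functions d. \<forall>x\<in>K. \<bar>g x - h x\<bar> < e}
      = cont_functions d \<inter> (\<Inter>x\<in>K. {g \<in> cont_functions d. g x \<in> {y. \<bar>y - h x\<bar> < e}})"
    by auto
  moreover have "openin (ucc_topology d) \<dots>"
  proof (cases "K = {}")
    case True then show ?thesis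
      using openin_topspace[of "ucc_topology d"] by (simp add: topspace_ucc_topology)
  next
    case False
    have "ucc_open d {g \<in> cont_functions d. g x \<in> {y. \<bar>y - h x\<bar> < e}}" for x
      by (intro ucc_open_eval open_Collect_less continuous_intros)
    then show ?thesis
      using False \<open>finite K\<close> openin_topspace[of "ucc_topology d"]
      by (intro openin_Int openin_INT2)
         (simp_all only: openin_ucc_topology topspace_ucc_topology not_False_eq_True)
  qed
  ultimately have op: "openin (ucc_topology d) {g \<in> cont_functions d. \<forall>x\<in>K. \<bar>g x - h x\<bar> < e}"
    by simp
  have "h \<in> {g \<in> cont_functions d. \<forall>x\<in>K. \<bar>g x - h x\<bar> < e}"
    using h horoclosure_subset \<open>e > 0\<close> by auto
  with op have "\<exists>f. f \<in> range (horofun d x\<^sub>0) \<and> f \<in> {g \<in> cont_functions d. \<forall>x\<in>K. \<bar>g x - h x\<bar> < e}"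
    using h[unfolded horoclosure_def in_closure_of, THEN conjunct2] by (auto simp only:)
  then show ?thesis by blast
qed

lemma horofun_lipschitz: "\<bar>horofun d x\<^sub>0 z x - horofun d x\<^sub>0 z y\<bar> \<le> sym_dist d x y"
  using triangle[of x z y] triangle[of y z x] by (auto simp: horofun_def sym_dist_def)

lemma horoclosure_lipschitz:
  assumes h: "h \<in> horoclosure d x\<^sub>0" shows "\<bar>h x - h y\<bar> \<le> sym_dist d x y"
proof (rule field_le_epsilon)
  fix e :: real assume "e > 0"
  then obtain z where "\<forall>w\<in>{x, y}. \<bar>horofun d x\<^sub>0 z w - h w\<bar> < e / 2"
    using horoclosure_approx[OF h, of "{x, y}" "e / 2"] by auto
  then have "\<bar>horofun d x\<^sub>0 z x - h x\<bar> < e / 2" "\<bar>horofun d x\<^sub>0 z y - h y\<bar> < e / 2" by auto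
  then show "\<bar>h x - h y\<bar> \<le> sym_dist d x y + e"
    using horofun_lipschitz[of x\<^sub>0 z x y] by linarith
qed

lemma horoclosure_base:
  assumes h: "h \<in> horoclosure d x\<^sub>0" shows "h x\<^sub>0 = 0"
proof -
  have "\<bar>h x\<^sub>0\<bar> \<le> 0 + e" if "e > 0" for e
    using horoclosure_approx[OF h, of "{x\<^sub>0}" e] that by (auto simp: horofun_def)
  then have "\<bar>h x\<^sub>0\<bar> \<le> 0" by (rule field_le_epsilon)
  then show ?thesis by simp
qed

end

section \<open>Isometric actions\<close>

text \<open>A countable group acting by isometries. The horofunctions of \<open>d\<close> and of \<open>reverse d\<close> are treated
together, as both are Lipschitz for the symmetrised metric.\<close>

locale isometric_action = asymmetric_metric d + group_action G UNIV \<phi>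
  for d :: "'x \<Rightarrow> 'x \<Rightarrow> real" and G (structure) and \<phi> +
  fixes x\<^sub>0 :: 'x
  assumes countable_carrier: "countable (carrier G)"
    and isometry: "g \<in> carrier G \<Longrightarrow> d (\<phi> g x) (\<phi> g y) = d x y"
begin

interpretation S: Metric_space UNIV "sym_dist d" by (rule Metric_space_sym_dist)

interpretation group G using group_hom group_hom.axioms(1) by auto

abbreviation act where "act \<equiv> horo_act G \<phi> x\<^sub>0"
abbreviation \<beta> where "\<beta> \<equiv> busemann G \<phi> x\<^sub>0"

lemma \<phi>_mult: "g \<in> carrier G \<Longrightarrow> h \<in> carrier G \<Longrightarrow> \<phi> (g \<otimes> h) x = \<phi> g (\<phi> h x)"
  by (rule composition_rule) auto

lemma \<phi>_one: "\<phi> \<one> x = x"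
  using id_eq_one by (metis UNIV_I restrict_apply')

lemma \<phi>_inv: "g \<in> carrier G \<Longrightarrow> \<phi> (inv g) (\<phi> g x) = x"
  using \<phi>_mult[of "inv g" g x] by (simp add: \<phi>_one)

lemma sym_isometry: "g \<in> carrier G \<Longrightarrow> sym_dist d (\<phi> g x) (\<phi> g y) = sym_dist d x y"
  by (simp add: sym_dist_def isometry)

lemma sym_dist_inv:
  assumes "g \<in> carrier G" shows "sym_dist d (\<phi> (inv g) x\<^sub>0) x\<^sub>0 = sym_dist d (\<phi> g x\<^sub>0) x\<^sub>0"
  using sym_isometry[of "inv g" x\<^sub>0 "\<phi> g x\<^sub>0"] assms by (simp add: \<phi>_inv S.commute)

lemma continuous_\<phi>:
  assumes "g \<in> carrier G" shows "continuous_map (sym_topology d) (sym_topology d) (\<phi> g)"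
  unfolding S.metric_continuous_map[OF S.Metric_space_axioms]
  using sym_isometry[OF assms] by auto

lemma act_cont: "g \<in> carrier G \<Longrightarrow> h \<in> cont_functions d \<Longrightarrow> act g h \<in> cont_functions d"
  unfolding cont_functions_def horo_act_def
  using continuous_map_compose[OF continuous_\<phi>[of "inv g"], of euclideanreal h]
  by (auto simp: comp_def intro!: continuous_map_diff)

lemma ucc_open_act:
  assumes g: "g \<in> carrier G" and U: "ucc_open d U"
  shows "ucc_open d {h \<in> cont_functions d. act g h \<in> U}"
  unfolding ucc_open_def
proof (intro conjI ballI)
  fix f assume f: "f \<in> {h \<in> cont_functions d. act g h \<in> U}"
  then obtain K e where K: "compactin (sym_topology d) K" "e > 0"
    "{k \<in> cont_functions d. \<forall>x\<in>K. \<bar>k x - act g f x\<bar> < e} \<subseteq> U"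
    using U unfolding ucc_open_def by blast
  let ?\<phi> = "\<phi> (inv g)"
  let ?L = "?\<phi> ` K \<union> {?\<phi> x\<^sub>0}"
  have "compactin (sym_topology d) ?L"
    using K(1) g by (intro compactin_Un image_compactin[OF _ continuous_\<phi>])
      (auto simp: finite_imp_compactin)
  moreover have "{h \<in> cont_functions d. \<forall>x\<in>?L. \<bar>h x - f x\<bar> < e / 2} \<subseteq> {h \<in> cont_functions d. act g h \<in> U}"
  proof safe
    fix h assume h: "h \<in> cont_functions d" "\<forall>x\<in>?L. \<bar>h x - f x\<bar> < e / 2"
    have "\<bar>act g h x - act g f x\<bar> < e" if "x \<in> K" for x
    proof -
      have "\<bar>h (?\<phi> x) - f (?\<phi> x)\<bar> < e / 2" "\<bar>h (?\<phi> x\<^sub>0) - f (?\<phi> x\<^sub>0)\<bar> < e / 2"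
        using h(2) that by auto
      then show ?thesis unfolding horo_act_def by linarith
    qed
    then show "act g h \<in> U" using K(3) act_cont[OF g h(1)] by auto
  qed
  ultimately show "\<exists>K \<epsilon>. compactin (sym_topology d) K \<and> \<epsilon> > 0 \<and>
      {h \<in> cont_functions d. \<forall>x\<in>K. \<bar>h x - f x\<bar> < \<epsilon>} \<subseteq> {h \<in> cont_functions d. act g h \<in> U}"
    using K(2) by (intro exI[of _ ?L] exI[of _ "e / 2"]) auto
qed auto

lemma act_measurable:
  assumes g: "g \<in> carrier G" and Y: "Y \<subseteq> cont_functions d" "act g ` Y \<subseteq> Y"
  shows "act g \<in> borel_on d Y \<rightarrow>\<^sub>M borel_on d Y"
  unfolding borel_on_def
proof (rule measurable_measure_of)
  show "{U. openin (subtopology (ucc_topology d) Y) U} \<subseteq> Pow Y"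
    by (auto dest: openin_imp_subset)
  show "act g \<in> space (sigma Y {U. openin (subtopology (ucc_topology d) Y) U}) \<rightarrow> Y"
    using Y by (auto simp: space_measure_of_conv)
  fix V assume "V \<in> {U. openin (subtopology (ucc_topology d) Y) U}"
  then obtain U where U: "ucc_open d U" "V = U \<inter> Y"
    by (auto simp: openin_subtopology openin_ucc_topology)
  have "act g -` V \<inter> Y = {h \<in> cont_functions d. act g h \<in> U} \<inter> Y"
    using Y U(2) by auto
  also have "\<dots> \<in> sets (borel_on d Y)"
    by (rule sets_borel_on_open[OF ucc_open_act[OF g U(1)]])
  finally show "act g -` V \<inter> space (sigma Y {U. openin (subtopology (ucc_topology d) Y) U})
      \<in> sets (sigma Y {U. openin (subtopology (ucc_topology d) Y) U})"
    by (simp add: borel_on_def space_measure_of_conv)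
qed

lemma act_mult:
  assumes "g \<in> carrier G" "h \<in> carrier G" shows "act (g \<otimes> h) x = act g (act h x)"
  using assms by (simp add: horo_act_def inv_mult_group \<phi>_mult fun_eq_iff)

lemma act_one: "x x\<^sub>0 = 0 \<Longrightarrow> act \<one> x = x"
  by (simp add: horo_act_def \<phi>_one fun_eq_iff)

lemma busemann_mult:
  assumes "g \<in> carrier G" "h \<in> carrier G" shows "\<beta> (g \<otimes> h) x = \<beta> g (act h x) + \<beta> h x"
  using assms by (simp add: horo_act_def busemann_def inv_mult_group \<phi>_mult)

text \<open>The Gromov product with the infimum taken over the orbit of the base point only. The orbit is
invariant, which keeps the transformation rule, and countable, which gives joint measurability.\<close>

definition kernel :: "('x \<Rightarrow> real) \<Rightarrow> ('x \<Rightarrow> real) \<Rightarrow> ereal" where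
  "kernel x y = (SUP h\<in>carrier G. ereal (- (x (\<phi> h x\<^sub>0) + y (\<phi> h x\<^sub>0)) / 2))"

lemma kernel_nonneg:
  assumes "x x\<^sub>0 = 0" "y x\<^sub>0 = 0" shows "0 \<le> kernel x y"
  unfolding kernel_def by (rule SUP_upper2[of \<one>]) (auto simp: \<phi>_one assms)

lemma gromov_product_eq: "gromov_product x y = ereal (- 1 / 2) * (INF z. ereal (x z + y z))"
proof -
  have "- (1 / 2) = ereal (- 1 / 2)" by (simp add: one_ereal_def)
  then show ?thesis unfolding gromov_product_def by (simp only:)
qed

lemma kernel_le_gromov: "kernel x y \<le> gromov_product x y"
  unfolding kernel_def
proof (rule SUP_least)
  fix h
  have "(INF z. ereal (x z + y z)) \<le> ereal (x (\<phi> h x\<^sub>0) + y (\<phi> h x\<^sub>0))"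
    by (rule INF_lower) simp
  then show "ereal (- (x (\<phi> h x\<^sub>0) + y (\<phi> h x\<^sub>0)) / 2) \<le> gromov_product x y"
    unfolding gromov_product_eq by (cases "INF z. ereal (x z + y z)") auto
qed

text \<open>The orbit is permuted by \<open>inv g\<close>, so the supremum only picks up the normalising constants.\<close>

lemma kernel_act:
  assumes g: "g \<in> carrier G"
  shows "kernel (act g x) (act g y) = kernel x y + ereal ((\<beta> g x + \<beta> g y) / 2)"
proof -
  let ?F = "\<lambda>h. ereal (- (x (\<phi> h x\<^sub>0) + y (\<phi> h x\<^sub>0)) / 2)"
  have "kernel (act g x) (act g y) = (SUP h\<in>carrier G. ?F (inv g \<otimes> h) + ereal ((\<beta> g x + \<beta> g y) / 2))"
    unfolding kernel_def
    using g by (intro SUP_cong refl) (simp add: horo_act_def busemann_def \<phi>_mult field_simps)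
  also have "\<dots> = (SUP h\<in>carrier G. ?F (inv g \<otimes> h)) + ereal ((\<beta> g x + \<beta> g y) / 2)"
    by (rule SUP_ereal_add_left) auto
  also have "(SUP h\<in>carrier G. ?F (inv g \<otimes> h)) = Sup (?F ` ((\<lambda>h. inv g \<otimes> h) ` carrier G))"
    by (simp add: image_image)
  also have "(\<lambda>h. inv g \<otimes> h) ` carrier G = carrier G"
  proof -
    have "x = inv g \<otimes> (g \<otimes> x)" if "x \<in> carrier G" for x
      using g that by (simp add: m_assoc[symmetric])
    then show ?thesis using g by (auto intro!: image_eqI[of _ _ "g \<otimes> _"])
  qed
  finally show ?thesis by (simp add: kernel_def)
qed

lemma kernel_measurable:
  assumes "Y \<subseteq> cont_functions d" "Y' \<subseteq> cont_functions d"
  shows "(\<lambda>(x, y). kernel x y) \<in> borel_measurable (borel_on d Y \<Otimes>\<^sub>M borel_on d Y')"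
proof -
  note [measurable] = measurable_eval[OF assms(1)] measurable_eval[OF assms(2)]
  have [measurable]: "(\<lambda>p. fst p z) \<in> borel_measurable (borel_on d Y \<Otimes>\<^sub>M borel_on d Y')" for z
    by (rule measurable_compose[OF measurable_fst]) measurable
  have [measurable]: "(\<lambda>p. snd p z) \<in> borel_measurable (borel_on d Y \<Otimes>\<^sub>M borel_on d Y')" for z
    by (rule measurable_compose[OF measurable_snd]) measurable
  show ?thesis
    unfolding kernel_def split_beta' by (rule borel_measurable_SUP[OF countable_carrier]) measurable
qed

text \<open>The Gromov product is a supremum of continuous functions, possibly uncountably many, so its upper
level sets \<open>{\<ge> c}\<close> are countable intersections of open sets. Measurability matters because
\<open>measure\<close> assigns \<open>0\<close> to sets outside the \<open>\<sigma>\<close>-algebra.\<close>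

lemma gromov_level_measurable:
  assumes Y: "Y \<subseteq> cont_functions d"
  shows "{y \<in> Y. ereal c \<le> gromov_product x y} \<in> sets (borel_on d Y)"
proof -
  let ?U = "\<lambda>n. \<Union>z. {y \<in> cont_functions d. y z \<in> {..< - x z - 2 * c + 1 / real (Suc n)}}"
  have "ereal c \<le> gromov_product x y \<longleftrightarrow> (\<forall>n. \<exists>z. y z < - x z - 2 * c + 1 / real (Suc n))" for y
  proof -
    let ?I = "INF z. ereal (x z + y z)"
    have "ereal c \<le> gromov_product x y \<longleftrightarrow> ?I \<le> ereal (- 2 * c)"
      unfolding gromov_product_eq by (cases ?I) auto
    also have "\<dots> \<longleftrightarrow> (\<forall>n. ?I < ereal (- 2 * c + 1 / real (Suc n)))"
    proof
      assume *: "?I \<le> ereal (- 2 * c)"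
      show "\<forall>n. ?I < ereal (- 2 * c + 1 / real (Suc n))"
        by (intro allI le_less_trans[OF *]) simp
    next
      assume *: "\<forall>n. ?I < ereal (- 2 * c + 1 / real (Suc n))"
      show "?I \<le> ereal (- 2 * c)"
      proof (rule ereal_le_epsilon2)
        fix e :: real assume "0 < e"
        then obtain n where "1 / real (Suc n) < e" by (rule nat_approx_posE)
        then have "ereal (- 2 * c + 1 / real (Suc n)) \<le> ereal (- 2 * c) + ereal e" by simp
        with *[rule_format, of n] show "?I \<le> ereal (- 2 * c) + ereal e"
          by (rule order_trans[OF less_imp_le])
      qed
    qed
    also have "\<dots> \<longleftrightarrow> (\<forall>n. \<exists>z. y z < - x z - 2 * c + 1 / real (Suc n))"
      unfolding INF_less_iff by (simp add: algebra_simps)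
    finally show ?thesis .
  qed
  then have eq: "{y \<in> Y. ereal c \<le> gromov_product x y} = (\<Inter>n. ?U n \<inter> Y)"
    using Y by auto
  have meas: "?U n \<inter> Y \<in> sets (borel_on d Y)" for n
  proof (rule sets_borel_on_open)
    have "openin (ucc_topology d) (?U n)"
      unfolding openin_ucc_topology[symmetric]
    proof (intro openin_Union)
      fix S assume "S \<in> range (\<lambda>z. {y \<in> cont_functions d. y z \<in> {..< - x z - 2 * c + 1 / real (Suc n)}})"
      then show "openin (ucc_topology d) S"
        unfolding openin_ucc_topology using ucc_open_eval[OF open_lessThan] by blast
    qed
    then show "ucc_open d (?U n)" by (simp add: openin_ucc_topology)
  qed
  show ?thesis
    unfolding eq by (intro sets.countable_INT image_subsetI meas) simp
qed

end

section \<open>Centering the Busemann cocycle\<close>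

text \<open>The data of the theorem on the side of \<open>\<nu>\<^sup>*\<close>, written \<open>\<nu>s\<close>. The sets \<open>Ym\<close> and \<open>Yp\<close> may be any
invariant subsets of the closures of the backward and forward horofunctions.\<close>

locale horo_walk = isometric_action d G \<phi> x\<^sub>0
  for d :: "'x \<Rightarrow> 'x \<Rightarrow> real" and G (structure) and \<phi> :: "'g \<Rightarrow> 'x \<Rightarrow> 'x" and x\<^sub>0 +
  fixes \<mu> :: "'g measure" and Ym Yp :: "('x \<Rightarrow> real) set" and \<nu>s :: "('x \<Rightarrow> real) measure"
    and lam :: real
  assumes group_prob_\<mu>: "group_prob G \<mu>"
    and second_moment: "integrable \<mu> (\<lambda>g. (sym_dist d (\<phi> g x\<^sub>0) x\<^sub>0)\<^sup>2)"
    and Ym_subset: "Ym \<subseteq> horoclosure (reverse d) x\<^sub>0"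
    and Ym_inv: "g \<in> carrier G \<Longrightarrow> act g ` Ym = Ym"
    and Yp_subset: "Yp \<subseteq> horoclosure d x\<^sub>0"
    and Yp_inv: "g \<in> carrier G \<Longrightarrow> act g ` Yp = Yp"
    and stationary_\<nu>s: "stationary (reflected G \<mu>) act (borel_on d Yp) \<nu>s"
    and mean: "(\<integral>(g, y). \<beta> g y \<partial>(reflected G \<mu> \<Otimes>\<^sub>M \<nu>s)) = lam"
    and gromov_tail: "\<exists>\<alpha> > 0. \<exists>C :: nat \<Rightarrow> real. summable (\<lambda>n. \<bar>C n\<bar>) \<and>
           (\<forall>x\<in>Ym. \<forall>n. measure \<nu>s {y \<in> Yp. gromov_product x y \<ge> ereal (\<alpha> * real n)} \<le> C n)"
begin

lemma reverse_asymmetric: "asymmetric_metric (reverse d)"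
  by (rule asymmetric_metric_reverse) unfold_locales

lemma Ym_cont: "Ym \<subseteq> cont_functions d"
  using Ym_subset asymmetric_metric.horoclosure_subset[OF reverse_asymmetric, of x\<^sub>0] by auto

lemma Yp_cont: "Yp \<subseteq> cont_functions d"
  using Yp_subset horoclosure_subset by auto

lemma base_zero: "x \<in> Ym \<union> Yp \<Longrightarrow> x x\<^sub>0 = 0"
  using Ym_subset Yp_subset horoclosure_base asymmetric_metric.horoclosure_base[OF reverse_asymmetric]
  by blast

lemma busemann_bound:
  assumes g: "g \<in> carrier G" and x: "x \<in> Ym \<union> Yp"
  shows "\<bar>\<beta> g x\<bar> \<le> sym_dist d (\<phi> g x\<^sub>0) x\<^sub>0"
proof -
  have "\<bar>x (\<phi> (inv g) x\<^sub>0) - x x\<^sub>0\<bar> \<le> sym_dist d (\<phi> (inv g) x\<^sub>0) x\<^sub>0"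
    using x Ym_subset Yp_subset horoclosure_lipschitz
      asymmetric_metric.horoclosure_lipschitz[OF reverse_asymmetric, simplified] by blast
  then show ?thesis
    using base_zero[OF x] by (simp add: busemann_def sym_dist_inv[OF g])
qed

lemma group_walk_horo:
  assumes m: "group_prob G m" and Y: "Y = Ym \<or> Y = Yp"
  shows "group_walk G m (borel_on d Y) act"
proof -
  interpret group G using group_hom group_hom.axioms(1) by auto
  show ?thesis
  proof
    show "countable (carrier G)" by (rule countable_carrier)
    show "group_prob G m" by fact
    show "act g \<in> borel_on d Y \<rightarrow>\<^sub>M borel_on d Y" if "g \<in> carrier G" for g
      using Y Ym_inv[OF that] Yp_inv[OF that] Ym_cont Yp_cont by (intro act_measurable that) auto
    show "act (g \<otimes> h) x = act g (act h x)" if "g \<in> carrier G" "h \<in> carrier G" for g h x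
      by (rule act_mult[OF that])
    show "act \<one> x = x" if "x \<in> space (borel_on d Y)" for x
      using that Y base_zero by (intro act_one) auto
  qed
qed

sublocale m: group_walk G \<mu> "borel_on d Ym" act
  by (rule group_walk_horo[OF group_prob_\<mu>]) simp

lemma inv_measurable: "(\<lambda>g. inv g) \<in> \<mu> \<rightarrow>\<^sub>M count_space (carrier G)"
  by (subst measurable_cong_sets[OF m.sets_\<mu> refl]) simp

lemma group_prob_reflected: "group_prob G (reflected G \<mu>)"
  unfolding group_prob_def reflected_def using m.prob_space_distr[OF inv_measurable] by simp

sublocale p: group_walk G "reflected G \<mu>" "borel_on d Yp" act
  by (rule group_walk_horo[OF group_prob_reflected]) simp

sublocale p: stationary_action "reflected G \<mu>" "borel_on d Yp" act \<nu>s
  by unfold_locales (rule stationary_\<nu>s)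

lemma measurable_busemann:
  assumes "Y = Ym \<or> Y = Yp"
  shows "(\<lambda>(g, x). \<beta> g x) \<in> borel_measurable (count_space (carrier G) \<Otimes>\<^sub>M borel_on d Y)"
  unfolding busemann_def
  by (rule m.measurable_countable_pair) (use assms Ym_cont Yp_cont measurable_eval in auto)

lemma integral_reflected:
  fixes f :: "'g \<Rightarrow> real"
  shows "integrable (reflected G \<mu>) f \<longleftrightarrow> integrable \<mu> (\<lambda>g. f (inv g))"
    and "(\<integral>g. f g \<partial>reflected G \<mu>) = (\<integral>g. f (inv g) \<partial>\<mu>)"
  unfolding reflected_def
  by (auto simp: integrable_distr_eq[OF inv_measurable] integral_distr[OF inv_measurable])

lemma first_moment: "integrable \<mu> (\<lambda>g. sym_dist d (\<phi> g x\<^sub>0) x\<^sub>0)"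
  by (rule m.square_integrable_imp_integrable[OF borel_measurable_discrete[OF m.sets_\<mu>] second_moment])

lemma integrable_busemann:
  assumes g: "g \<in> carrier G" shows "integrable \<nu>s (\<beta> g)"
proof (rule p.\<nu>.integrable_const_bound)
  show "AE x in \<nu>s. norm (\<beta> g x) \<le> sym_dist d (\<phi> g x\<^sub>0) x\<^sub>0"
    using busemann_bound[OF g] by (intro AE_I2) simp
  have "(\<lambda>x. \<beta> g x) \<in> borel_measurable (borel_on d Yp)"
    unfolding busemann_def by (rule measurable_eval[OF Yp_cont])
  then show "\<beta> g \<in> borel_measurable \<nu>s"
    by (subst measurable_cong_sets[OF p.sets_\<nu> refl]) simp
qed

text \<open>The forward Busemann cocycle at \<open>inv g\<close>, averaged over \<open>\<nu>\<^sup>*\<close>; its \<open>\<mu>\<close>-mean is \<open>lam\<close>.\<close>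

definition mean_busemann :: "'g \<Rightarrow> real" where
  "mean_busemann g = (\<integral>y. \<beta> (inv g) y \<partial>\<nu>s)"

lemma mean_busemann: "has_bochner_integral \<mu> mean_busemann lam"
proof -
  have F: "integrable (reflected G \<mu>) (\<lambda>g. sym_dist d (\<phi> g x\<^sub>0) x\<^sub>0)"
    unfolding integral_reflected
    by (rule iffD1[OF Bochner_Integration.integrable_cong[OF refl] first_moment]) (simp add: sym_dist_inv)
  have i: "integrable (reflected G \<mu> \<Otimes>\<^sub>M \<nu>s) (\<lambda>(g, y). \<beta> g y)"
  proof (rule Bochner_Integration.integrable_bound)
    show "integrable (reflected G \<mu> \<Otimes>\<^sub>M \<nu>s) (\<lambda>p. sym_dist d (\<phi> (fst p) x\<^sub>0) x\<^sub>0)"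
      using integrable_distr[of fst "reflected G \<mu> \<Otimes>\<^sub>M \<nu>s" "reflected G \<mu>"
          "\<lambda>g. sym_dist d (\<phi> g x\<^sub>0) x\<^sub>0"] F
      by (simp add: p.\<nu>.distr_pair_fst)
    show "AE p in reflected G \<mu> \<Otimes>\<^sub>M \<nu>s. norm ((\<lambda>(g, y). \<beta> g y) p) \<le> norm (sym_dist d (\<phi> (fst p) x\<^sub>0) x\<^sub>0)"
      using busemann_bound by (intro AE_I2) (force simp: space_pair_measure)
    show "(\<lambda>(g, y). \<beta> g y) \<in> borel_measurable (reflected G \<mu> \<Otimes>\<^sub>M \<nu>s)"
      using measurable_busemann[of Yp]
        measurable_cong_sets[OF sets_pair_measure_cong[OF p.sets_\<mu> p.sets_\<nu>] refl] by blast
  qed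
  have "integrable (reflected G \<mu>) (\<lambda>g. \<integral>y. \<beta> g y \<partial>\<nu>s)"
    using p.integrable_fst'[OF i] by simp
  moreover have "(\<integral>g. \<integral>y. \<beta> g y \<partial>\<nu>s \<partial>reflected G \<mu>) = lam"
    using p.integral_fst'[OF i] mean by simp
  ultimately show ?thesis
    unfolding integral_reflected mean_busemann_def[abs_def] by (simp add: has_bochner_integral_iff)
qed

section \<open>The potential\<close>

lemma kernel_measurable_snd:
  assumes x: "x \<in> Ym" shows "(\<lambda>y. kernel x y) \<in> borel_measurable \<nu>s"
proof -
  have "(\<lambda>y. (\<lambda>(x, y). kernel x y) (x, y)) \<in> borel_measurable (borel_on d Yp)"
    by (rule measurable_Pair2[OF kernel_measurable[OF Ym_cont Yp_cont]]) (use x in simp)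
  then show ?thesis by (subst measurable_cong_sets[OF p.sets_\<nu> refl]) simp
qed

lemma kernel_nonneg': "x \<in> Ym \<Longrightarrow> y \<in> Yp \<Longrightarrow> 0 \<le> kernel x y"
  by (intro kernel_nonneg) (auto simp: base_zero)

text \<open>A uniform bound on the integral of the kernel: a number \<open>k \<ge> 0\<close> is at most \<open>\<alpha>\<close> times the number of
\<open>n \<ge> 0\<close> with \<open>\<alpha> n \<le> k\<close>, so the integral is at most \<open>\<alpha>\<close> times the sum of the tail probabilities.\<close>

lemma kernel_integral_bound:
  obtains K where "0 \<le> K"
    "\<And>x. x \<in> Ym \<Longrightarrow> (\<integral>\<^sup>+y. e2ennreal (kernel x y) \<partial>\<nu>s) \<le> ennreal K"
proof -
  obtain \<alpha> C where \<alpha>: "\<alpha> > 0" and C: "summable (\<lambda>n. \<bar>C n\<bar>)"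
    and tail: "\<And>x n. x \<in> Ym \<Longrightarrow> measure \<nu>s {y \<in> Yp. gromov_product x y \<ge> ereal (\<alpha> * real n)} \<le> C n"
    using gromov_tail by blast
  have "(\<integral>\<^sup>+y. e2ennreal (kernel x y) \<partial>\<nu>s) \<le> ennreal (\<alpha> * (\<Sum>n. \<bar>C n\<bar>))" if x: "x \<in> Ym" for x
  proof -
    let ?E = "\<lambda>n. {y \<in> Yp. gromov_product x y \<ge> ereal (\<alpha> * real n)}"
    have E[measurable]: "?E n \<in> sets \<nu>s" for n
      using gromov_level_measurable[OF Yp_cont] by simp
    have "e2ennreal (kernel x y) \<le> (\<Sum>n. ennreal \<alpha> * indicator (?E n) y)" if y: "y \<in> Yp" for y
    proof -
      have part: "ennreal (\<alpha> * real m) \<le> (\<Sum>n. ennreal \<alpha> * indicator (?E n) y)"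
        if m: "\<And>n. n < m \<Longrightarrow> ereal (\<alpha> * real n) \<le> kernel x y" for m :: nat
      proof -
        have "ennreal (\<alpha> * real m) = (\<Sum>n<m. ennreal \<alpha>)"
          using \<alpha> by (simp add: ennreal_mult'' ennreal_of_nat_eq_real_of_nat mult.commute)
        also have "\<dots> = (\<Sum>n<m. ennreal \<alpha> * indicator (?E n) y)"
          using m y order_trans[OF _ kernel_le_gromov] by (intro sum.cong refl) (auto simp: indicator_def)
        also have "\<dots> \<le> (\<Sum>n. ennreal \<alpha> * indicator (?E n) y)"
          by (rule sum_le_suminf) auto
        finally show ?thesis .
      qed
      show ?thesis
      proof (cases "kernel x y")
        case (real k)
        have k0: "0 \<le> k" using kernel_nonneg'[OF x y] real by simp
        define m where "m = Suc (nat \<lfloor>k / \<alpha>\<rfloor>)"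
        have "k / \<alpha> \<le> real m" unfolding m_def using k0 \<alpha> by (simp add: of_nat_nat) linarith
        then have "e2ennreal (kernel x y) \<le> ennreal (\<alpha> * real m)"
          using \<alpha> real by (auto simp: field_simps intro!: ennreal_leI)
        also have "\<dots> \<le> (\<Sum>n. ennreal \<alpha> * indicator (?E n) y)"
        proof (rule part)
          fix n assume "n < m"
          then have "real n \<le> real (nat \<lfloor>k / \<alpha>\<rfloor>)" by (simp add: m_def)
          also have "\<dots> \<le> k / \<alpha>" using k0 \<alpha> by simp
          finally show "ereal (\<alpha> * real n) \<le> kernel x y"
            using real \<alpha> by (simp add: field_simps)
        qed
        finally show ?thesis .
      next
        case PInf
        have "ennreal (\<alpha> * real m) \<le> (\<Sum>n. ennreal \<alpha> * indicator (?E n) y)" for m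
          by (rule part) (simp add: PInf)
        moreover have "\<exists>m. b < ennreal (\<alpha> * real m)" if b: "b < \<infinity>" for b :: ennreal
        proof -
          obtain r where r: "b = ennreal r" "0 \<le> r" using b by (cases b) auto
          obtain m :: nat where "r / \<alpha> < real m" using reals_Archimedean2 by blast
          then show ?thesis using r \<alpha> by (intro exI[of _ m]) (auto simp: field_simps ennreal_less_iff)
        qed
        ultimately have "\<not> (\<Sum>n. ennreal \<alpha> * indicator (?E n) y) < \<infinity>"
          using leD by blast
        then have "(\<Sum>n. ennreal \<alpha> * indicator (?E n) y) = \<infinity>"
          by (simp add: less_top[symmetric])
        then show ?thesis by simp
      next
        case MInf
        then show ?thesis using kernel_nonneg'[OF x y] by simp
      qed
    qed
    then have "(\<integral>\<^sup>+y. e2ennreal (kernel x y) \<partial>\<nu>s) \<le> (\<integral>\<^sup>+y. (\<Sum>n. ennreal \<alpha> * indicator (?E n) y) \<partial>\<nu>s)"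
      by (intro nn_integral_mono) simp
    also have "\<dots> = (\<Sum>n. \<integral>\<^sup>+y. ennreal \<alpha> * indicator (?E n) y \<partial>\<nu>s)"
      by (intro nn_integral_suminf borel_measurable_times_ennreal borel_measurable_const
          borel_measurable_indicator E)
    also have "\<dots> = (\<Sum>n. ennreal \<alpha> * emeasure \<nu>s (?E n))"
      by (simp only: nn_integral_cmult_indicator[OF E])
    also have "\<dots> \<le> (\<Sum>n. ennreal (\<alpha> * \<bar>C n\<bar>))"
    proof (rule suminf_le)
      show "ennreal \<alpha> * emeasure \<nu>s (?E n) \<le> ennreal (\<alpha> * \<bar>C n\<bar>)" for n
        using tail[OF x, of n] \<alpha>
        by (auto simp: p.\<nu>.emeasure_eq_measure ennreal_mult'[symmetric] intro!: ennreal_leI mult_left_mono)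
    qed auto
    also have "\<dots> = ennreal (\<alpha> * (\<Sum>n. \<bar>C n\<bar>))"
      using \<alpha> C by (subst suminf_ennreal2) (auto simp: suminf_mult summable_mult)
    finally show ?thesis .
  qed
  moreover have "0 \<le> \<alpha> * (\<Sum>n. \<bar>C n\<bar>)" using \<alpha> C by (simp add: suminf_nonneg)
  ultimately show ?thesis by (rule that[rotated])
qed

text \<open>The real value of the kernel. An infinite kernel becomes \<open>0\<close>; for each \<open>x\<close> this happens only on a
\<open>\<nu>\<^sup>*\<close>-null set (\<open>AE_kernel_finite\<close>).\<close>

definition rkernel where "rkernel x y = real_of_ereal (kernel x y)"

lemma AE_kernel_finite:
  assumes x: "x \<in> Ym" shows "AE y in \<nu>s. kernel x y \<noteq> \<infinity>"
proof -
  note [measurable] = kernel_measurable_snd[OF x]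
  obtain K where "(\<integral>\<^sup>+y. e2ennreal (kernel x y) \<partial>\<nu>s) \<le> ennreal K"
    by (rule kernel_integral_bound) (use x in blast)
  then have "(\<integral>\<^sup>+y. e2ennreal (kernel x y) \<partial>\<nu>s) \<noteq> \<infinity>"
    by (auto simp: top_unique)
  then have "AE y in \<nu>s. e2ennreal (kernel x y) \<noteq> \<infinity>"
    by (intro nn_integral_PInf_AE) measurable
  then show ?thesis by eventually_elim auto
qed

lemma rkernel_nonneg: "x \<in> Ym \<Longrightarrow> y \<in> Yp \<Longrightarrow> 0 \<le> rkernel x y"
  unfolding rkernel_def by (intro real_of_ereal_pos kernel_nonneg')

lemma rkernel_integral_bound:
  obtains K where "0 \<le> K" "\<And>x. x \<in> Ym \<Longrightarrow> integrable \<nu>s (rkernel x)"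
    "\<And>x. x \<in> Ym \<Longrightarrow> (\<integral>y. rkernel x y \<partial>\<nu>s) \<le> K"
proof -
  obtain K where K: "0 \<le> K" "\<And>x. x \<in> Ym \<Longrightarrow> (\<integral>\<^sup>+y. e2ennreal (kernel x y) \<partial>\<nu>s) \<le> ennreal K"
    by (rule kernel_integral_bound) blast
  have nn: "(\<integral>\<^sup>+y. ennreal (rkernel x y) \<partial>\<nu>s) \<le> ennreal K" if x: "x \<in> Ym" for x
  proof -
    have "(\<integral>\<^sup>+y. ennreal (rkernel x y) \<partial>\<nu>s) \<le> (\<integral>\<^sup>+y. e2ennreal (kernel x y) \<partial>\<nu>s)"
    proof (rule nn_integral_mono)
      fix y
      show "ennreal (rkernel x y) \<le> e2ennreal (kernel x y)"
        unfolding rkernel_def by (cases "kernel x y") auto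
    qed
    with K(2)[OF x] show ?thesis by (rule order_trans[rotated])
  qed
  have meas: "rkernel x \<in> borel_measurable \<nu>s" if "x \<in> Ym" for x
    unfolding rkernel_def[abs_def] using kernel_measurable_snd[OF that] by measurable
  have ae: "AE y in \<nu>s. 0 \<le> rkernel x y" if "x \<in> Ym" for x
    using rkernel_nonneg[OF that] by (intro AE_I2) simp
  have int: "integrable \<nu>s (rkernel x)" if "x \<in> Ym" for x
    by (rule integrableI_nonneg[OF meas[OF that] ae[OF that]])
       (use nn[OF that] in \<open>auto intro: le_less_trans\<close>)
  have "(\<integral>y. rkernel x y \<partial>\<nu>s) \<le> K" if "x \<in> Ym" for x
  proof -
    have "ennreal (\<integral>y. rkernel x y \<partial>\<nu>s) \<le> ennreal K"
      using nn[OF that] nn_integral_eq_integral[OF int[OF that] ae[OF that]] by simp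
    then show ?thesis using K(1) by (simp add: ennreal_le_iff)
  qed
  with K(1) int show ?thesis by (rule that)
qed

text \<open>The function whose coboundary corrects the Busemann cocycle to one with constant drift.\<close>

definition potential :: "('x \<Rightarrow> real) \<Rightarrow> real" where
  "potential x = 2 * (\<integral>y. rkernel x y \<partial>\<nu>s)"

lemma potential_bdd: "potential \<in> bdd_meas (borel_on d Ym)"
proof -
  obtain K where K: "0 \<le> K" "\<And>x. x \<in> Ym \<Longrightarrow> integrable \<nu>s (rkernel x)"
    "\<And>x. x \<in> Ym \<Longrightarrow> (\<integral>y. rkernel x y \<partial>\<nu>s) \<le> K" by (rule rkernel_integral_bound) blast
  have [measurable]: "(\<lambda>(x, y). kernel x y) \<in> borel_measurable (borel_on d Ym \<Otimes>\<^sub>M \<nu>s)"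
    using kernel_measurable[OF Ym_cont Yp_cont]
      measurable_cong_sets[OF sets_pair_measure_cong[OF refl p.sets_\<nu>] refl] by blast
  have "(\<lambda>x. \<integral>y. real_of_ereal (kernel x y) \<partial>\<nu>s) \<in> borel_measurable (borel_on d Ym)"
    by measurable
  then have "potential \<in> borel_measurable (borel_on d Ym)"
    unfolding potential_def[abs_def] rkernel_def by measurable
  then show ?thesis
  proof (rule bdd_measI)
    fix x assume "x \<in> space (borel_on d Ym)"
    then have x: "x \<in> Ym" by simp
    have "0 \<le> (\<integral>y. rkernel x y \<partial>\<nu>s)"
      by (intro integral_nonneg_AE AE_I2) (simp add: rkernel_nonneg x)
    then show "norm (potential x) \<le> 2 * K"
      using K(3)[OF x] by (simp add: potential_def)
  qed
qed

lemma act_Ym: "g \<in> carrier G \<Longrightarrow> x \<in> Ym \<Longrightarrow> act g x \<in> Ym"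
  using Ym_inv by blast

text \<open>The transformation rule solved for the kernel at \<open>(x, inv g y)\<close>, with
\<open>\<beta> g (inv g y) = - \<beta> (inv g) y\<close>.\<close>

lemma rkernel_act:
  assumes g: "g \<in> carrier G" and x: "x \<in> Ym" and y: "y \<in> Yp" and fin: "kernel (act g x) y \<noteq> \<infinity>"
  shows "2 * rkernel x (act (inv g) y) = 2 * rkernel (act g x) y - \<beta> g x + \<beta> (inv g) y"
proof -
  let ?y = "act (inv g) y"
  have ig: "inv g \<in> carrier G" using g by simp
  have y': "?y \<in> Yp" using Yp_inv[OF ig] y by blast
  have "act g ?y = act (g \<otimes> inv g) y" by (rule act_mult[symmetric]) (use g in auto)
  also have "\<dots> = y" using g y base_zero by (simp add: act_one)
  finally have gy: "act g ?y = y" .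
  have "\<beta> (g \<otimes> inv g) y = \<beta> g ?y + \<beta> (inv g) y" by (rule busemann_mult) (use g in auto)
  moreover have "\<beta> (g \<otimes> inv g) y = 0"
    using g y base_zero by (simp add: busemann_def \<phi>_one)
  ultimately have bgy: "\<beta> g ?y = - \<beta> (inv g) y" by simp
  have "kernel (act g x) y = kernel x ?y + ereal ((\<beta> g x - \<beta> (inv g) y) / 2)"
    using kernel_act[OF g, of x ?y] by (simp add: gy bgy)
  with fin show ?thesis
    unfolding rkernel_def using kernel_nonneg'[OF x y']
    by (cases "kernel x ?y") (auto simp: field_simps)
qed

lemma busemann_potential:
  assumes g: "g \<in> carrier G" and x: "x \<in> Ym"
  shows "\<beta> g x + potential x - potential (act g x)
    = mean_busemann g + potential x - 2 * (\<integral>y. rkernel x (act (inv g) y) \<partial>\<nu>s)"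
proof -
  obtain K where K: "\<And>x. x \<in> Ym \<Longrightarrow> integrable \<nu>s (rkernel x)" by (rule rkernel_integral_bound) blast
  have gx: "act g x \<in> Ym" by (rule act_Ym[OF g x])
  have ig: "inv g \<in> carrier G" using g by simp
  have [measurable]: "act (inv g) \<in> borel_on d Yp \<rightarrow>\<^sub>M borel_on d Yp" by (rule p.act_measurable[OF ig])
  have [measurable]: "rkernel x \<in> borel_measurable (borel_on d Yp)"
    using borel_measurable_integrable[OF K[OF x]] by (simp cong: measurable_cong_sets)
  have [measurable]: "\<beta> (inv g) \<in> borel_measurable \<nu>s" "rkernel (act g x) \<in> borel_measurable \<nu>s"
    using integrable_busemann[OF ig] K[OF gx] by auto
  have "(\<integral>y. 2 * rkernel x (act (inv g) y) \<partial>\<nu>s)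
      = (\<integral>y. 2 * rkernel (act g x) y - \<beta> g x + \<beta> (inv g) y \<partial>\<nu>s)"
  proof (rule integral_cong_AE)
    show "AE y in \<nu>s. 2 * rkernel x (act (inv g) y) = 2 * rkernel (act g x) y - \<beta> g x + \<beta> (inv g) y"
      using AE_kernel_finite[OF gx] AE_space
      by eventually_elim (rule rkernel_act[OF g x], simp_all)
  qed measurable
  also have "\<dots> = potential (act g x) - \<beta> g x + mean_busemann g"
    using K[OF gx] integrable_busemann[OF ig]
    by (simp add: potential_def mean_busemann_def p.prob_space_M[simplified])
  finally show ?thesis by simp
qed

text \<open>In \<open>busemann_potential\<close> the last integral averages, over \<open>\<mu>\<close>, to \<open>potential x / 2\<close>, because \<open>\<nu>\<^sup>*\<close> is
stationary for the reflected measure. Hence only the mean \<open>lam\<close> of \<open>mean_busemann\<close> remains.\<close>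

theorem drift_potential:
  assumes x: "x \<in> Ym"
  shows "has_bochner_integral \<mu> (\<lambda>g. \<beta> g x + potential x - potential (act g x)) lam"
proof -
  obtain K where K: "\<And>x. x \<in> Ym \<Longrightarrow> integrable \<nu>s (rkernel x)" by (rule rkernel_integral_bound) blast
  have meas: "rkernel x \<in> borel_measurable (borel_on d Yp)"
    using borel_measurable_integrable[OF K[OF x]] by (simp cong: measurable_cong_sets)
  have i: "integrable (reflected G \<mu> \<Otimes>\<^sub>M \<nu>s) (\<lambda>(g, y). rkernel x (act g y))"
    by (rule p.integrable_distr_act[OF K[OF x]])
  have "integrable (reflected G \<mu>) (\<lambda>g. \<integral>y. rkernel x (act g y) \<partial>\<nu>s)"
    using p.integrable_fst'[OF i] by simp
  moreover have "(\<integral>g. \<integral>y. rkernel x (act g y) \<partial>\<nu>s \<partial>reflected G \<mu>) = (\<integral>y. rkernel x y \<partial>\<nu>s)"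
    using p.integral_fst'[OF i] p.integral_distr_act[OF meas] by simp
  ultimately have c: "has_bochner_integral \<mu> (\<lambda>g. \<integral>y. rkernel x (act (inv g) y) \<partial>\<nu>s) (\<integral>y. rkernel x y \<partial>\<nu>s)"
    unfolding integral_reflected by (simp add: has_bochner_integral_iff)
  have k: "has_bochner_integral \<mu> (\<lambda>g. potential x) (potential x)"
    by (simp add: has_bochner_integral_iff)
  have "has_bochner_integral \<mu> (\<lambda>g. mean_busemann g + potential x - 2 * (\<integral>y. rkernel x (act (inv g) y) \<partial>\<nu>s))
      (lam + potential x - 2 * (\<integral>y. rkernel x y \<partial>\<nu>s))"
    by (intro has_bochner_integral_diff has_bochner_integral_add mean_busemann k
        has_bochner_integral_mult_right c)
  moreover have "lam + potential x - 2 * (\<integral>y. rkernel x y \<partial>\<nu>s) = lam" by (simp add: potential_def)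
  ultimately show ?thesis
    by (subst has_bochner_integral_cong[OF refl busemann_potential refl]) (use x in auto)
qed

lemma measurable_cocycle_cohomologous:
  assumes \<psi>: "\<psi> \<in> borel_measurable (borel_on d Ym)"
  shows "measurable_cocycle G act (borel_on d Ym) (\<lambda>g x. \<beta> g x + \<psi> x - \<psi> (act g x))"
  unfolding measurable_cocycle_def
proof (intro conjI ballI)
  fix g h x assume "g \<in> carrier G" "h \<in> carrier G"
  then show "\<beta> (g \<otimes> h) x + \<psi> x - \<psi> (act (g \<otimes> h) x)
      = \<beta> g (act h x) + \<psi> (act h x) - \<psi> (act g (act h x)) + (\<beta> h x + \<psi> x - \<psi> (act h x))"
    by (simp add: busemann_mult act_mult)
next
  show "(\<lambda>(g, x). \<beta> g x + \<psi> x - \<psi> (act g x))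
      \<in> borel_measurable (count_space (carrier G) \<Otimes>\<^sub>M borel_on d Ym)"
  proof (rule m.measurable_countable_pair)
    fix g assume g: "g \<in> carrier G"
    have [measurable]: "(\<lambda>x. \<beta> g x) \<in> borel_measurable (borel_on d Ym)"
      unfolding busemann_def by (rule measurable_eval[OF Ym_cont])
    have [measurable]: "(\<lambda>x. \<psi> (act g x)) \<in> borel_measurable (borel_on d Ym)"
      by (rule measurable_compose[OF m.act_measurable[OF g] \<psi>])
    show "(\<lambda>x. \<beta> g x + \<psi> x - \<psi> (act g x)) \<in> borel_measurable (borel_on d Ym)"
      using \<psi> by measurable
  qed
qed

theorem centering_potential:
  "centering G \<mu> act (borel_on d Ym) \<beta> (\<lambda>g x. \<beta> g x + potential x - potential (act g x))"
  unfolding centering_def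
proof (intro conjI)
  show "measurable_cocycle G act (borel_on d Ym) (\<lambda>g x. \<beta> g x + potential x - potential (act g x))"
    by (rule measurable_cocycle_cohomologous[OF bdd_measD[OF potential_bdd]])
  show "\<exists>l. constant_drift \<mu> (borel_on d Ym) (\<lambda>g x. \<beta> g x + potential x - potential (act g x)) l"
    unfolding constant_drift_def using drift_potential by auto
  obtain C where C: "\<And>x. x \<in> space (borel_on d Ym) \<Longrightarrow> norm (- potential x) \<le> C"
    using bdd_meas_uminus[OF potential_bdd] by (rule bdd_measE) blast
  have "bounded ((\<lambda>x. - potential x) ` space (borel_on d Ym))"
    by (rule boundedI[of _ C]) (use C in auto)
  moreover have "(\<lambda>x. - potential x) \<in> borel_measurable (borel_on d Ym)"
    using bdd_meas_uminus[OF potential_bdd] by (rule bdd_measD)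
  ultimately show "\<exists>\<psi>\<in>borel_measurable (borel_on d Ym). bounded (\<psi> ` space (borel_on d Ym)) \<and>
      (\<forall>g\<in>carrier G. \<forall>x\<in>space (borel_on d Ym).
        \<beta> g x = \<beta> g x + potential x - potential (act g x) + \<psi> x - \<psi> (act g x))"
    by (intro bexI[of _ "\<lambda>x. - potential x"]) auto
qed

text \<open>Two centerings differ by a bounded coboundary, whose drift integrates to \<open>0\<close> against a stationary
measure.\<close>

lemma drift_unique:
  assumes \<nu>: "stationary \<mu> act (borel_on d Ym) \<nu>"
    and drift: "constant_drift \<mu> (borel_on d Ym) \<sigma> l"
    and \<psi>: "\<psi> \<in> bdd_meas (borel_on d Ym)"
    and eq: "\<And>g x. g \<in> carrier G \<Longrightarrow> x \<in> Ym \<Longrightarrow> \<beta> g x = \<sigma> g x + \<psi> x - \<psi> (act g x)"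
  shows "l = lam"
proof -
  interpret n: stationary_action \<mu> "borel_on d Ym" act \<nu>
    by unfold_locales (rule \<nu>)
  define \<eta> where "\<eta> x = \<psi> x + potential x" for x
  have \<eta>: "\<eta> \<in> bdd_meas (borel_on d Ym)"
    unfolding \<eta>_def[abs_def] by (rule bdd_meas_add[OF \<psi> potential_bdd])
  have "\<eta> x - m.markov \<eta> x = lam - l" if x: "x \<in> Ym" for x
  proof -
    have "has_bochner_integral \<mu> (\<lambda>g. (\<beta> g x + potential x - potential (act g x)) - \<sigma> g x) (lam - l)"
      using drift x by (intro has_bochner_integral_diff drift_potential) (auto simp: constant_drift_def)
    then have "(\<integral>g. (\<beta> g x + potential x - potential (act g x)) - \<sigma> g x \<partial>\<mu>) = lam - l"
      by (simp add: has_bochner_integral_iff)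
    also have "(\<integral>g. (\<beta> g x + potential x - potential (act g x)) - \<sigma> g x \<partial>\<mu>) = (\<integral>g. \<eta> x - \<eta> (act g x) \<partial>\<mu>)"
      by (rule Bochner_Integration.integral_cong) (use x in \<open>auto simp: eq \<eta>_def\<close>)
    also have "\<dots> = \<eta> x - m.markov \<eta> x"
      using m.integrable_act[OF \<eta>] x by (simp add: m.markov_def)
    finally show ?thesis by simp
  qed
  then have "(\<integral>x. \<eta> x - m.markov \<eta> x \<partial>\<nu>) = (\<integral>x. lam - l \<partial>\<nu>)"
    by (intro Bochner_Integration.integral_cong) auto
  also have "\<dots> = lam - l" using n.prob_space_M by simp
  finally have "(\<integral>x. \<eta> x - m.markov \<eta> x \<partial>\<nu>) = lam - l" .
  moreover have "(\<integral>x. \<eta> x - m.markov \<eta> x \<partial>\<nu>) = 0"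
    using n.integrable_\<nu>[OF \<eta>] n.integrable_\<nu>[OF m.markov_bdd_meas[OF \<eta>]] n.integral_markov[OF \<eta>]
    by simp
  ultimately show ?thesis by simp
qed

theorem busemann_clt:
  assumes \<nu>: "ergodic_stationary \<mu> act (borel_on d Ym) \<nu>"
    and \<beta>\<^sub>0: "centering G \<mu> act (borel_on d Ym) \<beta> \<beta>\<^sub>0"
  shows "AE x in \<nu>. \<forall>F :: real \<Rightarrow> real.
    continuous_on UNIV F \<and> compact (closure {t. F t \<noteq> 0}) \<longrightarrow>
    (\<lambda>n. \<integral>g. F ((\<beta> g x - real n * lam) / sqrt (real n)) \<partial>(conv_power G \<mu> n))
      \<longlonglongrightarrow> (\<integral>t. F t \<partial>(centered_gaussian (cocycle_variance \<mu> \<nu> \<beta>\<^sub>0 lam)))"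
proof -
  obtain l \<psi> where cocycle: "measurable_cocycle G act (borel_on d Ym) \<beta>\<^sub>0"
    and drift: "constant_drift \<mu> (borel_on d Ym) \<beta>\<^sub>0 l"
    and \<psi>: "\<psi> \<in> borel_measurable (borel_on d Ym)" "bounded (\<psi> ` Ym)"
    and eq: "\<And>g x. g \<in> carrier G \<Longrightarrow> x \<in> Ym \<Longrightarrow> \<beta> g x = \<beta>\<^sub>0 g x + \<psi> x - \<psi> (act g x)"
    using \<beta>\<^sub>0 unfolding centering_def space_borel_on by blast
  obtain C where C: "0 < C" "\<And>x. x \<in> Ym \<Longrightarrow> \<bar>\<psi> x\<bar> \<le> C"
    using \<psi>(2) unfolding bounded_pos by auto
  have \<psi>_bdd: "\<psi> \<in> bdd_meas (borel_on d Ym)"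
    by (rule bdd_measI[OF \<psi>(1), of C]) (use C in auto)
  have "stationary \<mu> act (borel_on d Ym) \<nu>" using \<nu> by (simp add: ergodic_stationary_def)
  then have l: "l = lam" by (rule drift_unique[OF _ drift \<psi>_bdd eq])
  have close: "\<bar>\<beta> g x - \<beta>\<^sub>0 g x\<bar> \<le> 2 * C" if "g \<in> carrier G" "x \<in> Ym" for g x
    using eq[OF that] C(2)[OF that(2)] C(2)[OF act_Ym[OF that]] by auto
  define H where "H g = sym_dist d (\<phi> g x\<^sub>0) x\<^sub>0 + (2 * C + \<bar>lam\<bar>)" for g
  have sd: "0 \<le> sym_dist d x y" for x y
    using nonneg[of x y] by (simp add: sym_dist_def le_max_iff_disj)
  interpret c: ergodic_cocycle G \<mu> "borel_on d Ym" act \<beta>\<^sub>0 lam H \<nu>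
  proof unfold_locales
    show "constant_drift \<mu> (borel_on d Ym) \<beta>\<^sub>0 lam" using drift l by simp
    show "\<bar>\<beta>\<^sub>0 g x - lam\<bar> \<le> H g" if "g \<in> carrier G" "x \<in> space (borel_on d Ym)" for g x
      using close[of g x] busemann_bound[of g x] that unfolding H_def by auto
    show "0 \<le> H g" for g unfolding H_def using sd[of "\<phi> g x\<^sub>0" x\<^sub>0] C(1) by simp
    have "integrable \<mu> (\<lambda>g. (sym_dist d (\<phi> g x\<^sub>0) x\<^sub>0)\<^sup>2 + (2 * C + \<bar>lam\<bar>)\<^sup>2
        + 2 * sym_dist d (\<phi> g x\<^sub>0) x\<^sub>0 * (2 * C + \<bar>lam\<bar>))"
      using second_moment first_moment by auto
    then show "integrable \<mu> (\<lambda>g. (H g)\<^sup>2)" unfolding H_def power2_sum .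
  qed (fact cocycle \<nu>)+
  show ?thesis by (rule c.central_limit[of _ "2 * C"]) (use close in simp)
qed

end

lemma sets_borel_on_subset: "A \<in> sets (borel_on d Y) \<Longrightarrow> A \<subseteq> Y"
  using sets.sets_into_space[of A "borel_on d Y"] by simp

theorem theorem0p3:
  fixes d :: "'x \<Rightarrow> 'x \<Rightarrow> real" and x\<^sub>0 :: 'x
    and G :: "('g, 'm) monoid_scheme" and \<phi> :: "'g \<Rightarrow> 'x \<Rightarrow> 'x"
    and \<mu> :: "'g measure"
    and Ym Yp :: "('x \<Rightarrow> real) set" and \<nu> \<nu>s :: "('x \<Rightarrow> real) measure"
    and lam :: real
  defines "act \<equiv> horo_act G \<phi> x\<^sub>0" and "\<beta> \<equiv> busemann G \<phi> x\<^sub>0"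
  assumes "asymmetric_metric d" and "geodesic d"
    and "group_action G UNIV \<phi>" and "countable (carrier G)"
    and "\<And>g x y. g \<in> carrier G \<Longrightarrow> d (\<phi> g x) (\<phi> g y) = d x y"
    and "group_prob G \<mu>"
    and "integrable \<mu> (\<lambda>g. (sym_dist d (\<phi> g x\<^sub>0) x\<^sub>0)\<^sup>2)"
    and "Ym \<in> sets (borel_on d (horoboundary (reverse d) x\<^sub>0))"
    and "\<And>g. g \<in> carrier G \<Longrightarrow> act g ` Ym = Ym"
    and "ergodic_stationary \<mu> act (borel_on d Ym) \<nu>"
    and "Yp \<in> sets (borel_on d (horoboundary d x\<^sub>0))"
    and "\<And>g. g \<in> carrier G \<Longrightarrow> act g ` Yp = Yp"
    and "stationary (reflected G \<mu>) act (borel_on d Yp) \<nu>s"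
    and "(\<integral>(g, y). \<beta> g y \<partial>(reflected G \<mu> \<Otimes>\<^sub>M \<nu>s)) = lam"
    and "\<exists>\<alpha> > 0. \<exists>C :: nat \<Rightarrow> real. summable (\<lambda>n. \<bar>C n\<bar>) \<and>
           (\<forall>x\<in>Ym. \<forall>n. measure \<nu>s {y \<in> Yp. gromov_product x y \<ge> ereal (\<alpha> * real n)} \<le> C n)"
  shows "centerable G \<mu> act (borel_on d Ym) \<beta> \<and>
    (\<forall>\<beta>\<^sub>0. centering G \<mu> act (borel_on d Ym) \<beta> \<beta>\<^sub>0 \<longrightarrow>
       (AE x in \<nu>. \<forall>F :: real \<Rightarrow> real.
          continuous_on UNIV F \<and> compact (closure {t. F t \<noteq> 0}) \<longrightarrow>
          (\<lambda>n. \<integral>g. F ((\<beta> g x - real n * lam) / sqrt (real n)) \<partial>(conv_power G \<mu> n))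
            \<longlonglongrightarrow> (\<integral>t. F t \<partial>(centered_gaussian (cocycle_variance \<mu> \<nu> \<beta>\<^sub>0 lam)))))"
proof -
  interpret isometric_action d G \<phi> x\<^sub>0
    using assms(3,5-7) by (auto simp: isometric_action_def isometric_action_axioms_def)
  interpret horo_walk d G \<phi> x\<^sub>0 \<mu> Ym Yp \<nu>s lam
  proof unfold_locales
    show "Ym \<subseteq> horoclosure (reverse d) x\<^sub>0" "Yp \<subseteq> horoclosure d x\<^sub>0"
      using sets_borel_on_subset[OF assms(10)] sets_borel_on_subset[OF assms(13)]
      by (auto simp: horoboundary_def)
  qed (use assms in \<open>simp_all only: act_def \<beta>_def\<close>)
  have "ergodic_stationary \<mu> (horo_act G \<phi> x\<^sub>0) (borel_on d Ym) \<nu>"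
    using assms(12) by (simp only: act_def)
  then show ?thesis
    unfolding assms(1,2) using centering_potential busemann_clt
    unfolding centerable_def by blast
qed

end
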